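(* Let $X$ be a full Hilbert $C^{*}$-module over a $C^{*}$-algebra $A$, let $H$ and $K$ be two Hilbert spaces and let $\Phi:X\to L(H,K)$ be a completely positive map. Then: (1) There are two Hilbert spaces $H_\Phi$ and $K_\Phi$, a representation $\pi_\Phi:X\to L(H_\Phi,K_\Phi)$ of $X$, a bounded linear operator $V_\Phi:H\to H_\Phi$ and a coisometry $W_\Phi:K\to K_\Phi$ such that: (a) $\Phi(x)=W_\Phi^{*}\,\pi_\Phi(x)\,V_\Phi$ for all $x\in X$; (b) $[\pi_\Phi(X)V_\Phi H]=K_\Phi$; (c) $[\pi_\Phi(X)^{*}W_\Phi K]=H_\Phi$. (2) Let $H_\Phi,K_\Phi,\pi_\Phi,V_\Phi,W_\Phi$ be as in (1). If $H'$ and $K'$ are two Hilbert spaces, $\pi_X:X\to L(H',K')$ is a representation of $X$, $V'\in L(H,H')$, and $W':K\to K'$ is a coisometry, satisfying (a) $\Phi(x)=W'^{*}\,\pi_X(x)\,V'$ for all $x\in X$; (b) $[\pi_X(X)V'H]=K'$; (c) $[\pi_X(X)^{*}W'K]=H'$, then there are two unitary operators $U_1\in L(H_\Phi,H')$ and $U_2\in L(K_\Phi,K')$ such that $U_2\pi_\Phi(x)=\pi_X(x)U_1$ for all $x\in X$, $V'=U_1V_\Phi$ and $W'=U_2W_\Phi$.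
   Context: $L(H,K)$ is the space of bounded linear operators between Hilbert spaces $H$ and $K$, $L(H)=L(H,H)$. A coisometry is a bounded operator $W$ with $WW^{*}=\mathrm{id}$. $[Y]$ denotes the closed linear span of a subset $Y$ of a Hilbert space; e.g. $[\pi(X)VH]$ is the closed linear span of $\{\pi(x)Vh: x\in X,h\in H\}$ and $[\pi(X)^{*}WK]$ is that of $\{\pi(x)^{*}Wk: x\in X,k\in K\}$. A Hilbert $A$-module $X$ is a right $A$-module with an $A$-valued inner product $\langle\cdot,\cdot\rangle$, linear over $\mathbb C$ and $A$ in the second variable and conjugate linear in the first, complete for the norm $\|x\|=\|\langle x,x\rangle\|^{1/2}$. It is full if the closed two-sided ideal of $A$ generated by $\{\langle x,y\rangle:x,y\in X\}$ equals $A$. A representation of $X$ on Hilbert spaces $H$ and $K$ is a map $\pi_X:X\to L(H,K)$ for which there is a $*$-representation $\pi_A$ of $A$ on $H$ with $\pi_X(x)^{*}\pi_X(y)=\pi_A(\langle x,y\rangle)$ for all $x,y\in X$. A map $\Phi:X\to L(H,K)$ is called completely positive if there is a completely positive linear map $\varphi:A\to L(H)$ with $\Phi(x)^{*}\Phi(y)=\varphi(\langle x,y\rangle)$ for all $x,y\in X$. *)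

theory Defs
  imports "HOL-Analysis.Analysis" "HOL-Library.Function_Algebras"
begin

class complex_vector = ab_group_add +
  fixes scaleC :: "complex \<Rightarrow> 'a \<Rightarrow> 'a" (infixr "*\<^sub>C" 75)
  assumes scaleC_add_right: "c *\<^sub>C (x + y) = c *\<^sub>C x + c *\<^sub>C y"
    and scaleC_add_left: "(c + d) *\<^sub>C x = c *\<^sub>C x + d *\<^sub>C x"
    and scaleC_scaleC: "c *\<^sub>C d *\<^sub>C x = (c * d) *\<^sub>C x"
    and scaleC_one: "1 *\<^sub>C x = x"

class complex_normed_vector = complex_vector + real_normed_vector +
  assumes scaleR_scaleC: "r *\<^sub>R x = complex_of_real r *\<^sub>C x"
    and norm_scaleC: "norm (c *\<^sub>C x) = cmod c * norm x"

instantiation complex :: complex_vector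
begin
definition scaleC_complex :: "complex \<Rightarrow> complex \<Rightarrow> complex"
  where "scaleC_complex c x = c * x"
instance by standard (simp_all add: scaleC_complex_def algebra_simps)
end

instantiation "fun" :: (type, complex_vector) complex_vector
begin
definition scaleC_fun :: "complex \<Rightarrow> ('a \<Rightarrow> 'b) \<Rightarrow> 'a \<Rightarrow> 'b"
  where "scaleC_fun c f = (\<lambda>x. c *\<^sub>C f x)"
instance
  by standard
    (simp_all add: scaleC_fun_def fun_eq_iff scaleC_add_right scaleC_add_left
      scaleC_scaleC scaleC_one)
end


section \<open>C*-algebras and Hilbert modules\<close>

(* Neither a unit nor a nonzero element is required. *)
class cstar_algebra = complex_normed_vector + real_normed_algebra + banach +
  fixes star :: "'a \<Rightarrow> 'a"
  assumes mult_scaleC_left: "(c *\<^sub>C a) * b = c *\<^sub>C (a * b)"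
    and mult_scaleC_right: "a * (c *\<^sub>C b) = c *\<^sub>C (a * b)"
    and star_star: "star (star a) = a"
    and star_add: "star (a + b) = star a + star b"
    and star_scaleC: "star (c *\<^sub>C a) = cnj c *\<^sub>C star a"
    and star_mult: "star (a * b) = star b * star a"
    and cstar_identity: "norm (star a * a) = (norm a)\<^sup>2"

definition cstar_positive :: "'a::cstar_algebra \<Rightarrow> bool"
  where "cstar_positive a \<longleftrightarrow> (\<exists>b. a = star b * b)"

(* Positivity in the C*-algebra of n by n matrices over 'a: the matrix a has the form b^* b.
   Only the entries with indices below n are relevant. *)
definition cstar_matrix_positive :: "nat \<Rightarrow> (nat \<Rightarrow> nat \<Rightarrow> 'a::cstar_algebra) \<Rightarrow> bool"
  where "cstar_matrix_positive n a \<longleftrightarrow>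
    (\<exists>b :: nat \<Rightarrow> nat \<Rightarrow> 'a. \<forall>i<n. \<forall>j<n. a i j = (\<Sum>k<n. star (b k i) * b k j))"

definition closed_two_sided_ideal :: "'a::cstar_algebra set \<Rightarrow> bool"
  where "closed_two_sided_ideal I \<longleftrightarrow>
    closed I \<and> module.subspace scaleC I \<and> (\<forall>a. \<forall>i\<in>I. a * i \<in> I \<and> i * a \<in> I)"

(* Right Hilbert modules. The module is the whole type 'x; completeness is the class banach,
   whose norm is tied to the inner product by norm_eq. Conjugate linearity in the first
   variable follows from star_ip. *)
locale hilbert_module =
  fixes act :: "'x::{complex_normed_vector, banach} \<Rightarrow> 'a::cstar_algebra \<Rightarrow> 'x"
    and ip :: "'x \<Rightarrow> 'x \<Rightarrow> 'a"
  assumes act_add_left: "act (x + y) a = act x a + act y a"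
    and act_add_right: "act x (a + b) = act x a + act x b"
    and act_mult: "act x (a * b) = act (act x a) b"
    and act_scaleC_left: "act (c *\<^sub>C x) a = c *\<^sub>C act x a"
    and act_scaleC_right: "act x (c *\<^sub>C a) = c *\<^sub>C act x a"
    and ip_add_right: "ip x (y + z) = ip x y + ip x z"
    and ip_scaleC_right: "ip x (c *\<^sub>C y) = c *\<^sub>C ip x y"
    and ip_act_right: "ip x (act y a) = ip x y * a"
    and star_ip: "star (ip x y) = ip y x"
    and ip_positive: "cstar_positive (ip x x)"
    and ip_definite: "ip x x = 0 \<Longrightarrow> x = 0"
    and norm_eq: "norm x = sqrt (norm (ip x x))"

definition full_module :: "('x \<Rightarrow> 'x \<Rightarrow> 'a::cstar_algebra) \<Rightarrow> bool"
  where "full_module ip \<longleftrightarrow>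
    \<Inter>{I. closed_two_sided_ideal I \<and> {ip x y | x y. True} \<subseteq> I} = UNIV"


section \<open>Hilbert spaces and their operators\<close>

(* A Hilbert space is a complex linear subspace hcarrier of some ambient complex vector space,
   together with an inner product on it (conjugate linear in the first variable). The ambient
   type carries no topology. Working with carriers instead of whole types allows quantifying
   existentially over Hilbert spaces, and the ambient type 'a \<times> 'h \<Rightarrow> complex is large enough for
   the completion of a quotient of the algebraic tensor product of 'a and 'h: identify v with
   (a, h) \<mapsto> \<langle>a \<otimes> h, v\<rangle>. *)
record 'v hilbert =
  hcarrier :: "'v set"
  hinner :: "'v \<Rightarrow> 'v \<Rightarrow> complex"

definition hnorm :: "'v hilbert \<Rightarrow> 'v \<Rightarrow> real"
  where "hnorm H x = sqrt (Re (hinner H x x))"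

locale hilbert_space =
  fixes H :: "'v::complex_vector hilbert"
  assumes subspace_hcarrier: "module.subspace scaleC (hcarrier H)"
    and hinner_add_right: "\<lbrakk>x \<in> hcarrier H; y \<in> hcarrier H; z \<in> hcarrier H\<rbrakk>
      \<Longrightarrow> hinner H x (y + z) = hinner H x y + hinner H x z"
    and hinner_scaleC_right: "\<lbrakk>x \<in> hcarrier H; y \<in> hcarrier H\<rbrakk>
      \<Longrightarrow> hinner H x (c *\<^sub>C y) = c * hinner H x y"
    and hinner_commute: "\<lbrakk>x \<in> hcarrier H; y \<in> hcarrier H\<rbrakk>
      \<Longrightarrow> hinner H y x = cnj (hinner H x y)"
    and hinner_nonneg: "x \<in> hcarrier H \<Longrightarrow> 0 \<le> Re (hinner H x x)"
    and hinner_definite: "\<lbrakk>x \<in> hcarrier H; hinner H x x = 0\<rbrakk> \<Longrightarrow> x = 0"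
    and hcomplete: "\<lbrakk>\<forall>n. s n \<in> hcarrier H;
        \<forall>e>0. \<exists>N. \<forall>m\<ge>N. \<forall>n\<ge>N. hnorm H (s m - s n) < e\<rbrakk>
      \<Longrightarrow> \<exists>l\<in>hcarrier H. (\<lambda>n. hnorm H (s n - l)) \<longlonglongrightarrow> 0"

definition hclosed_span :: "'v::complex_vector hilbert \<Rightarrow> 'v set \<Rightarrow> 'v set"
  where "hclosed_span H Y =
    {v \<in> hcarrier H. \<forall>e>0. \<exists>u\<in>module.span scaleC Y. hnorm H (v - u) < e}"

(* The values of an operator outside the carrier of its domain are irrelevant; accordingly,
   operators are compared on carriers only. *)
definition bounded_ops ::
    "'v::complex_vector hilbert \<Rightarrow> 'w::complex_vector hilbert \<Rightarrow> ('v \<Rightarrow> 'w) set"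
  where "bounded_ops H K = {T.
    (\<forall>x\<in>hcarrier H. T x \<in> hcarrier K) \<and>
    (\<forall>x\<in>hcarrier H. \<forall>y\<in>hcarrier H. T (x + y) = T x + T y) \<and>
    (\<forall>c. \<forall>x\<in>hcarrier H. T (c *\<^sub>C x) = c *\<^sub>C T x) \<and>
    (\<exists>C. \<forall>x\<in>hcarrier H. hnorm K (T x) \<le> C * hnorm H x)}"

definition hadj :: "'v hilbert \<Rightarrow> 'w hilbert \<Rightarrow> ('v \<Rightarrow> 'w) \<Rightarrow> 'w \<Rightarrow> 'v"
  where "hadj H K T k =
    (THE h. h \<in> hcarrier H \<and> (\<forall>g\<in>hcarrier H. hinner H h g = hinner K k (T g)))"

definition coisometry ::
    "'v::complex_vector hilbert \<Rightarrow> 'w::complex_vector hilbert \<Rightarrow> ('v \<Rightarrow> 'w) \<Rightarrow> bool"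
  where "coisometry H K W \<longleftrightarrow>
    W \<in> bounded_ops H K \<and> (\<forall>k\<in>hcarrier K. W (hadj H K W k) = k)"

definition unitary_op ::
    "'v::complex_vector hilbert \<Rightarrow> 'w::complex_vector hilbert \<Rightarrow> ('v \<Rightarrow> 'w) \<Rightarrow> bool"
  where "unitary_op H K U \<longleftrightarrow>
    U \<in> bounded_ops H K \<and>
    (\<forall>h\<in>hcarrier H. hadj H K U (U h) = h) \<and> (\<forall>k\<in>hcarrier K. U (hadj H K U k) = k)"


section \<open>Representations and completely positive maps\<close>

definition linear_into_ops ::
    "'v::complex_vector hilbert \<Rightarrow> ('a::cstar_algebra \<Rightarrow> 'v \<Rightarrow> 'v) \<Rightarrow> bool"
  where "linear_into_ops H \<phi> \<longleftrightarrow>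
    (\<forall>a. \<phi> a \<in> bounded_ops H H) \<and>
    (\<forall>a b. \<forall>h\<in>hcarrier H. \<phi> (a + b) h = \<phi> a h + \<phi> b h) \<and>
    (\<forall>c a. \<forall>h\<in>hcarrier H. \<phi> (c *\<^sub>C a) h = c *\<^sub>C \<phi> a h)"

definition star_representation ::
    "'v::complex_vector hilbert \<Rightarrow> ('a::cstar_algebra \<Rightarrow> 'v \<Rightarrow> 'v) \<Rightarrow> bool"
  where "star_representation H \<rho> \<longleftrightarrow>
    linear_into_ops H \<rho> \<and>
    (\<forall>a b. \<forall>h\<in>hcarrier H. \<rho> (a * b) h = \<rho> a (\<rho> b h)) \<and>
    (\<forall>a. \<forall>h\<in>hcarrier H. \<rho> (star a) h = hadj H H (\<rho> a) h)"

(* For every n, the amplification of \<phi> sends positive n by n matrices over 'a to positive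
   elements of M_n(L(H)) = L(H^n), i.e. to operator matrices with nonnegative quadratic form. *)
definition completely_positive ::
    "'v::complex_vector hilbert \<Rightarrow> ('a::cstar_algebra \<Rightarrow> 'v \<Rightarrow> 'v) \<Rightarrow> bool"
  where "completely_positive H \<phi> \<longleftrightarrow>
    linear_into_ops H \<phi> \<and>
    (\<forall>n a. cstar_matrix_positive n a \<longrightarrow>
      (\<forall>h. (\<forall>i<n. h i \<in> hcarrier H) \<longrightarrow>
        (\<Sum>i<n. \<Sum>j<n. hinner H (h i) (\<phi> (a i j) (h j))) \<in> \<real>\<^sub>\<ge>\<^sub>0))"

definition module_representation ::
    "('x \<Rightarrow> 'x \<Rightarrow> 'a::cstar_algebra) \<Rightarrow> 'v::complex_vector hilbert \<Rightarrow>
      'w::complex_vector hilbert \<Rightarrow> ('x \<Rightarrow> 'v \<Rightarrow> 'w) \<Rightarrow> bool"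
  where "module_representation ip H K \<pi> \<longleftrightarrow>
    (\<forall>x. \<pi> x \<in> bounded_ops H K) \<and>
    (\<exists>\<rho>. star_representation H \<rho> \<and>
      (\<forall>x y. \<forall>h\<in>hcarrier H. hadj H K (\<pi> x) (\<pi> y h) = \<rho> (ip x y) h))"

definition module_completely_positive ::
    "('x \<Rightarrow> 'x \<Rightarrow> 'a::cstar_algebra) \<Rightarrow> 'v::complex_vector hilbert \<Rightarrow>
      'w::complex_vector hilbert \<Rightarrow> ('x \<Rightarrow> 'v \<Rightarrow> 'w) \<Rightarrow> bool"
  where "module_completely_positive ip H K \<Phi> \<longleftrightarrow>
    (\<forall>x. \<Phi> x \<in> bounded_ops H K) \<and>
    (\<exists>\<phi>. completely_positive H \<phi> \<and>
      (\<forall>x y. \<forall>h\<in>hcarrier H. hadj H K (\<Phi> x) (\<Phi> y h) = \<phi> (ip x y) h))"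

definition stinespring_construction ::
    "('x \<Rightarrow> 'x \<Rightarrow> 'a::cstar_algebra) \<Rightarrow> 'h::complex_vector hilbert \<Rightarrow>
      'k::complex_vector hilbert \<Rightarrow> ('x \<Rightarrow> 'h \<Rightarrow> 'k) \<Rightarrow>
      'p::complex_vector hilbert \<Rightarrow> 'q::complex_vector hilbert \<Rightarrow>
      ('x \<Rightarrow> 'p \<Rightarrow> 'q) \<Rightarrow> ('h \<Rightarrow> 'p) \<Rightarrow> ('k \<Rightarrow> 'q) \<Rightarrow> bool"
  where "stinespring_construction ip H K \<Phi> H' K' \<pi> V W \<longleftrightarrow>
    hilbert_space H' \<and> hilbert_space K' \<and> module_representation ip H' K' \<pi> \<and>
    V \<in> bounded_ops H H' \<and> coisometry K K' W \<and>
    (\<forall>x. \<forall>h\<in>hcarrier H. \<Phi> x h = hadj K K' W (\<pi> x (V h))) \<and>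
    hclosed_span K' {\<pi> x (V h) | x h. h \<in> hcarrier H} = hcarrier K' \<and>
    hclosed_span H' {hadj H' K' (\<pi> x) (W k) | x k. k \<in> hcarrier K} = hcarrier H'"

end

theory Submission
  imports Defs
begin

text \<open>The space \<open>K\<^sub>\<Phi>\<close> is the closed span of \<open>\<Phi>(X)H\<close>, and \<open>H\<^sub>\<Phi>\<close> is the reproducing kernel Hilbert space of
  \<open>((a, g), (b, h)) \<mapsto> \<langle>g, \<phi>(a* b)h\<rangle>\<close>, with \<open>a\<close> and \<open>b\<close> inner products of elements of \<open>X\<close>. The operators
  \<open>\<pi>(x)*\<close> and \<open>V\<close> are given by explicit functions on the index set. That these lie in \<open>H\<^sub>\<Phi>\<close> follows from
  \<open>\<phi>(b* a* a b) \<le> \<parallel>a\<parallel>\<^sup>2 \<phi>(b* b)\<close> for \<open>\<pi>(x)*\<close>, and for \<open>V\<close>, as there need not be a unit, from a bounded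
  approximate unit and the automatic continuity of \<open>\<phi>\<close>. Uniqueness holds because the total families
  \<open>\<pi>(x)Vh\<close> and \<open>\<pi>(x)*\<pi>(y)Vh\<close> have Gram matrices that depend on \<open>\<Phi>\<close> only.\<close>

section \<open>Elementary C*-algebra\<close>

text \<open>A vector of the dilation space is stored as the function whose value at
  \<open>(a, g)\<close> is its inner product with a \<otimes> g. Equality of vectors is then
  equality of functions, and operators are written down by their values. What remains is to show
  that these functions lie in the space, and this is an inequality between quadratic forms.
  Restricting the first index to inner products turns each a \<otimes> g with a = <x,y> into
  \<pi>(x)* \<Phi>(y) g, so that condition (c) is built into the construction. The obstacle is
  analytic: positivity in \<open>'a\<close> means only the form b* b, each single \<phi>(a) is
  bounded but no bound uniform in a is given, and there may be no unit. The inequalities therefore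
  call for square roots and an approximate unit. Both are obtained from operators x \<mapsto> \<mu>
  x + b x on the algebra itself, which model scalars plus algebra elements: a fixed-point iteration
  gives 1 - sqrt(1 - q), and means of the powers of an isometry give the approximate unit.\<close>

lemma scaleC_zero_left [simp]: "0 *\<^sub>C (x::'a::complex_vector) = 0"
  using scaleC_add_left[of 0 0 x] by simp

lemma scaleC_zero_right [simp]: "c *\<^sub>C (0::'a::complex_vector) = 0"
  using scaleC_add_right[of c 0 0] by simp

lemma scaleC_minus_left: "(- c) *\<^sub>C (x::'a::complex_vector) = - (c *\<^sub>C x)"
  using scaleC_add_left[of c "- c" x] by (simp add: minus_unique)

lemma scaleC_minus1: "(-1) *\<^sub>C (x::'a::complex_vector) = - x"
  by (simp add: scaleC_minus_left scaleC_one)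

lemma star_zero [simp]: "star (0::'a::cstar_algebra) = 0"
  using star_add[of 0 "0::'a"] by simp

lemma star_minus: "star (- a) = - star (a::'a::cstar_algebra)"
  using star_add[of a "- a"] by (simp add: minus_unique)

lemma star_diff: "star (a - b) = star a - star (b::'a::cstar_algebra)"
  using star_add[of a "- b"] by (simp add: star_minus)

lemma star_scaleR: "star (r *\<^sub>R a) = r *\<^sub>R star (a::'a::cstar_algebra)"
  by (simp add: scaleR_scaleC star_scaleC)

lemma norm_star [simp]: "norm (star a) = norm (a::'a::cstar_algebra)"
proof -
  have le: "norm b \<le> norm (star b)" for b :: 'a
  proof (cases "b = 0")
    case False
    have "(norm b)\<^sup>2 \<le> norm (star b) * norm b"
      using cstar_identity[of b] norm_mult_ineq[of "star b" b] by simp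
    then show ?thesis using False by (simp add: power2_eq_square)
  qed simp
  show ?thesis using le[of a] le[of "star a"] by (simp add: star_star)
qed

lemma cstar_identity': "norm (a * star a) = (norm (a::'a::cstar_algebra))\<^sup>2"
  using cstar_identity[of "star a"] by (simp add: star_star)

text \<open>Testing on \<open>x = star a\<close> shows that left multiplication is isometric.
  Elements of the unitization occur below only through their action on the algebra, and this lemma
  turns estimates for that action into norm estimates.\<close>

lemma norm_le_of_left_mult:
  fixes a :: "'a::cstar_algebra"
  assumes "\<And>x. norm (a * x) \<le> C * norm x" "0 \<le> C"
  shows "norm a \<le> C"
proof (cases "a = 0")
  case False
  have "(norm a)\<^sup>2 \<le> C * norm a"
    using assms(1)[of "star a"] by (simp add: cstar_identity')
  then show ?thesis using False by (simp add: power2_eq_square)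
qed (use assms in simp)

lemma bounded_linear_star: "bounded_linear (star :: 'a::cstar_algebra \<Rightarrow> 'a)"
  by (rule bounded_linear_intro[where K = 1]) (simp_all add: star_add star_scaleR)

text \<open>The increments of this sequence majorize those of the iteration for square roots below. They
  are summable even in the boundary case of norm 1, where the iteration is no strict contraction.\<close>

primrec sqrt_majorant :: "nat \<Rightarrow> real" where
  "sqrt_majorant 0 = 0"
| "sqrt_majorant (Suc n) = (1 + (sqrt_majorant n)\<^sup>2) / 2"

lemma sqrt_majorant_bounds: "0 \<le> sqrt_majorant n" "sqrt_majorant n \<le> 1"
proof -
  have "0 \<le> sqrt_majorant n \<and> sqrt_majorant n \<le> 1"
    by (induction n) (auto simp: power_le_one)
  then show "0 \<le> sqrt_majorant n" "sqrt_majorant n \<le> 1" by auto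
qed

lemma sqrt_majorant_Suc_le: "sqrt_majorant n \<le> sqrt_majorant (Suc n)"
proof -
  have "0 \<le> (1 - sqrt_majorant n)\<^sup>2" by simp
  then show ?thesis by (simp add: power2_eq_square algebra_simps)
qed

text \<open>The majorant increases and stays below 1, so its increments telescope to a convergent
  series; no geometric decay is involved.\<close>

lemma Cauchy_of_majorant:
  fixes a :: "nat \<Rightarrow> 'b::banach"
  assumes "\<And>n. norm (a (Suc n) - a n) \<le> C * (sqrt_majorant (Suc n) - sqrt_majorant n)"
  shows "convergent a"
proof -
  have "incseq sqrt_majorant" using sqrt_majorant_Suc_le by (rule incseq_SucI)
  then obtain l where "sqrt_majorant \<longlonglongrightarrow> l"
    using incseq_convergent[of sqrt_majorant 1] sqrt_majorant_bounds(2) by blast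
  then have "summable (\<lambda>n. sqrt_majorant (Suc n) - sqrt_majorant n)"
    by (rule telescope_summable)
  then have "summable (\<lambda>n. C * (sqrt_majorant (Suc n) - sqrt_majorant n))"
    by (rule summable_mult)
  then have "summable (\<lambda>n. a (Suc n) - a n)"
    by (rule summable_comparison_test[rotated]) (use assms in auto)
  then have "convergent (\<lambda>n. \<Sum>i<n. a (Suc i) - a i)"
    by (rule summable_iff_convergent[THEN iffD1])
  then have "convergent (\<lambda>n. a n - a 0)"
    by (simp add: sum_lessThan_telescope)
  then show ?thesis
    using convergent_add[OF _ convergent_const[of "a 0"]] by fastforce
qed

text \<open>With q acting on the algebra as the real scalar \<mu> plus left multiplication by b, the
  iteration s \<mapsto> (q + s^2) / 2 converges to 1 - sqrt (1 - q).\<close>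

lemma sqrt_in_unitization:
  fixes b :: "'a::cstar_algebra" and \<mu> :: real
  assumes mu: "0 \<le> \<mu>" "\<mu> \<le> 1" and sa: "star b = b"
    and contr: "\<And>x. norm (\<mu> *\<^sub>R x + b * x) \<le> norm x"
  shows "\<exists>\<nu> a. 0 \<le> \<nu> \<and> \<nu> \<le> 1 \<and> 2 * \<nu> = \<mu> + \<nu>\<^sup>2 \<and>
    star a = a \<and> 2 *\<^sub>R a = b + (2 * \<nu>) *\<^sub>R a + a * a \<and>
    (\<forall>g. g * b = b * g \<longrightarrow> g * a = a * g)"
proof -
  \<comment> \<open>\<open>m n\<close> and \<open>a n\<close> are the scalar part and the algebra
    part of the n-th iterate, and \<open>S n\<close> below is its action on the algebra.\<close>
  define m where "m = rec_nat 0 (\<lambda>_ m. (\<mu> + m\<^sup>2) / 2)"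
  have m0: "m 0 = 0" and mS: "\<And>n. m (Suc n) = (\<mu> + (m n)\<^sup>2) / 2"
    by (simp_all add: m_def)
  define a where "a = rec_nat 0 (\<lambda>n a. (1/2) *\<^sub>R (b + (2 * m n) *\<^sub>R a + a * a))"
  have a0: "a 0 = 0" and aS: "\<And>n. a (Suc n) = (1/2) *\<^sub>R (b + (2 * m n) *\<^sub>R a n + a n * a n)"
    by (simp_all add: a_def)
  define S where "S n x = m n *\<^sub>R x + a n * x" for n x
  have SS: "S (Suc n) x = (1/2) *\<^sub>R ((\<mu> *\<^sub>R x + b * x) + S n (S n x))" for n x
    unfolding S_def mS aS
    by (simp add: algebra_simps power2_eq_square add_divide_distrib)
       (simp flip: scaleR_left_distrib)
  have Sdiff: "S n (x - y) = S n x - S n y" for n x y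
    by (simp add: S_def algebra_simps)
  let ?s = sqrt_majorant
  have Sb: "norm (S n x) \<le> ?s n * norm x" for n x
  proof (induction n arbitrary: x)
    case 0 then show ?case by (simp add: S_def m0 a0)
  next
    case (Suc n)
    have "norm (S n (S n x)) \<le> ?s n * (?s n * norm x)"
      by (rule order_trans[OF Suc mult_left_mono[OF Suc]]) (rule sqrt_majorant_bounds)
    then have "norm ((\<mu> *\<^sub>R x + b * x) + S n (S n x)) \<le> norm x + ?s n * (?s n * norm x)"
      using contr[of x] norm_triangle_ineq[of "\<mu> *\<^sub>R x + b * x" "S n (S n x)"] by linarith
    moreover have "norm (S (Suc n) x) = (1/2) * norm ((\<mu> *\<^sub>R x + b * x) + S n (S n x))"
      unfolding SS norm_scaleR by simp
    ultimately show ?case by (simp add: power2_eq_square algebra_simps)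
  qed
  \<comment> \<open>The difference of squares is split as s' s' - s s = s' (s' - s) + (s' - s) s,
    which requires no commutativity; the majorant satisfies the corresponding recursion with
    equality.\<close>
  have Sd: "norm (S (Suc n) x - S n x) \<le> (?s (Suc n) - ?s n) * norm x" for n x
  proof (induction n arbitrary: x)
    case 0
    show ?case using Sb[of 1 x] by (simp add: S_def[of 0] m0 a0)
  next
    case (Suc n)
    let ?d = "?s (Suc n) - ?s n"
    have d: "0 \<le> ?d" using sqrt_majorant_Suc_le[of n] by linarith
    have "S (Suc (Suc n)) x - S (Suc n) x
        = (1/2) *\<^sub>R (S (Suc n) (S (Suc n) x) - S n (S n x))"
      unfolding SS[of "Suc n"] SS[of n x] by (simp add: algebra_simps flip: scaleR_diff_right)
    also have "\<dots> = (1/2) *\<^sub>R (S (Suc n) (S (Suc n) x - S n x) + (S (Suc n) (S n x) - S n (S n x)))"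
      by (simp add: Sdiff)
    finally have eq: "norm (S (Suc (Suc n)) x - S (Suc n) x)
        = (1/2) * norm (S (Suc n) (S (Suc n) x - S n x) + (S (Suc n) (S n x) - S n (S n x)))"
      by simp
    have "norm (S (Suc n) (S (Suc n) x - S n x)) \<le> ?s (Suc n) * (?d * norm x)"
      by (rule order_trans[OF Sb mult_left_mono[OF Suc]]) (rule sqrt_majorant_bounds)
    moreover have "norm (S (Suc n) (S n x) - S n (S n x)) \<le> ?d * (?s n * norm x)"
      by (rule order_trans[OF Suc mult_left_mono[OF Sb d]])
    ultimately have "norm (S (Suc (Suc n)) x - S (Suc n) x)
        \<le> (1/2) * (?s (Suc n) * (?d * norm x) + ?d * (?s n * norm x))"
      unfolding eq by (intro mult_left_mono order_trans[OF norm_triangle_ineq add_mono]) auto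
    also have "\<dots> = (?s (Suc (Suc n)) - ?s (Suc n)) * norm x"
      unfolding sqrt_majorant.simps(2)[of "Suc n"] by (simp add: power2_eq_square field_simps)
    finally show ?case .
  qed
  have mb: "0 \<le> m n \<and> m n \<le> ?s n" for n
  proof (induction n)
    case (Suc n)
    have "(m n)\<^sup>2 \<le> (?s n)\<^sup>2" using Suc by (intro power_mono) auto
    then show ?case using mu by (simp add: mS)
  qed (simp add: m0)
  have md: "\<bar>m (Suc n) - m n\<bar> \<le> ?s (Suc n) - ?s n" for n
  proof (induction n)
    case 0 show ?case using mb[of 1] m0 by (simp)
  next
    case (Suc n)
    have eq: "m (Suc (Suc n)) - m (Suc n) = (m (Suc n) + m n) * (m (Suc n) - m n) / 2"
      unfolding mS[of "Suc n"] mS[of n] by (simp add: power2_eq_square field_simps)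
    have "\<bar>m (Suc (Suc n)) - m (Suc n)\<bar> \<le> (?s (Suc n) + ?s n) * (?s (Suc n) - ?s n) / 2"
    proof -
      have "\<bar>m (Suc n) + m n\<bar> * \<bar>m (Suc n) - m n\<bar> \<le> (?s (Suc n) + ?s n) * (?s (Suc n) - ?s n)"
        using mb[of n] mb[of "Suc n"] Suc by (intro mult_mono) auto
      then show ?thesis unfolding eq abs_mult abs_divide by simp
    qed
    also have "\<dots> = ?s (Suc (Suc n)) - ?s (Suc n)"
      unfolding sqrt_majorant.simps(2)[of "Suc n"] sqrt_majorant.simps(2)[of n]
      by (simp add: power2_eq_square field_simps)
    finally show ?case .
  qed
  have "convergent m"
    by (rule Cauchy_of_majorant[where C = 1]) (use md in auto)
  then obtain \<nu> where nu: "m \<longlonglongrightarrow> \<nu>" by (auto simp: convergent_def)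
  \<comment> \<open>The algebra part is the operator \<open>S n\<close> minus a scalar. Each of the
    two increments is at most that of the majorant, hence the factor 2.\<close>
  have "norm (a (Suc n) - a n) \<le> 2 * (?s (Suc n) - ?s n)" for n
  proof (rule norm_le_of_left_mult)
    fix x
    have "(a (Suc n) - a n) * x = (S (Suc n) x - S n x) - (m (Suc n) - m n) *\<^sub>R x"
      by (simp add: S_def algebra_simps)
    then have "norm ((a (Suc n) - a n) * x)
        \<le> norm (S (Suc n) x - S n x) + \<bar>m (Suc n) - m n\<bar> * norm x"
      by (metis norm_scaleR norm_triangle_ineq4)
    also have "\<dots> \<le> (?s (Suc n) - ?s n) * norm x + (?s (Suc n) - ?s n) * norm x"
      using Sd[of n x] md[of n] by (intro add_mono mult_right_mono) auto
    finally show "norm ((a (Suc n) - a n) * x) \<le> 2 * (?s (Suc n) - ?s n) * norm x"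
      by (simp add: algebra_simps)
  next
    show "0 \<le> 2 * (?s (Suc n) - ?s n)" using sqrt_majorant_Suc_le[of n] by (simp only: zero_le_mult_iff) simp
  qed
  then have "convergent a" by (rule Cauchy_of_majorant)
  then obtain l where l: "a \<longlonglongrightarrow> l" by (auto simp: convergent_def)
  have "(\<lambda>n. m (Suc n)) \<longlonglongrightarrow> (\<mu> + \<nu>\<^sup>2) / 2"
    unfolding mS by (intro tendsto_intros nu) simp
  with LIMSEQ_Suc[OF nu] have 1: "\<nu> = (\<mu> + \<nu>\<^sup>2) / 2" by (rule LIMSEQ_unique)
  have "(\<lambda>n. a (Suc n)) \<longlonglongrightarrow> (1/2) *\<^sub>R (b + (2 * \<nu>) *\<^sub>R l + l * l)"
    unfolding aS by (intro tendsto_intros nu l)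
  with LIMSEQ_Suc[OF l] have 2: "l = (1/2) *\<^sub>R (b + (2 * \<nu>) *\<^sub>R l + l * l)" by (rule LIMSEQ_unique)
  have "star (a n) = a n" for n
    by (induction n) (simp_all add: a0 aS star_scaleR star_add star_mult sa)
  with bounded_linear.tendsto[OF bounded_linear_star l] have "a \<longlonglongrightarrow> star l" by simp
  with l have 3: "star l = l" by (rule LIMSEQ_unique[symmetric])
  have 4: "g * l = l * g" if g: "g * b = b * g" for g
  proof -
    have "g * a n = a n * g" for n
    proof (induction n)
      case (Suc n)
      have "g * (a n * a n) = a n * a n * g" using Suc by (metis mult.assoc)
      then show ?case using Suc g by (simp add: aS algebra_simps)
    qed (simp add: a0)
    then have "(\<lambda>n. a n * g) \<longlonglongrightarrow> g * l" using tendsto_mult[OF tendsto_const[of g] l] by simp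
    moreover have "(\<lambda>n. a n * g) \<longlonglongrightarrow> l * g" by (intro tendsto_intros l)
    ultimately show ?thesis by (rule LIMSEQ_unique)
  qed
  have 5: "0 \<le> \<nu>" by (rule LIMSEQ_le_const[OF nu]) (use mb in auto)
  have 6: "\<nu> \<le> 1"
    by (rule LIMSEQ_le_const2[OF nu]) (use mb sqrt_majorant_bounds order_trans in blast)
  have 7: "2 *\<^sub>R l = b + (2 * \<nu>) *\<^sub>R l + l * l"
  proof -
    have "2 *\<^sub>R l = 2 *\<^sub>R ((1/2) *\<^sub>R (b + (2 * \<nu>) *\<^sub>R l + l * l))" using 2 by metis
    then show ?thesis by simp
  qed
  show ?thesis
  proof (intro exI conjI allI impI)
    show "2 * \<nu> = \<mu> + \<nu>\<^sup>2" using 1 by simp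
  qed (fact 3 4 5 6 7)+
qed

text \<open>The case of scalar part 0: \<open>m\<close> stands for 1 - sqrt(1 - q), and its equation
  reads (1 - m)^2 = 1 - q.\<close>

lemma one_minus_square_root:
  fixes q :: "'a::cstar_algebra"
  assumes "star q = q" "norm q \<le> 1"
  obtains m where "star m = m" "m + m - m * m = q" "\<And>g. g * q = q * g \<Longrightarrow> g * m = m * g"
proof -
  have c: "norm (0 *\<^sub>R x + q * x) \<le> norm x" for x
    using norm_mult_ineq[of q x] mult_right_mono[OF assms(2), of "norm x"] by simp
  obtain \<nu> a where nu: "0 \<le> \<nu>" "\<nu> \<le> 1" "2 * \<nu> = 0 + \<nu>\<^sup>2" and "star a = a"
    and a: "2 *\<^sub>R a = q + (2 * \<nu>) *\<^sub>R a + a * a" and comm: "\<And>g. g * q = q * g \<Longrightarrow> g * a = a * g"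
    using sqrt_in_unitization[OF order.refl zero_le_one assms(1) c] by blast
  \<comment> \<open>The equation leaves 0 and 2, and the bound by 1 excludes 2.\<close>
  have "\<nu> = 0" using nu by (auto simp: power2_eq_square)
  then have "a + a - a * a = q" using a by (simp add: scaleR_2 algebra_simps)
  with \<open>star a = a\<close> show thesis by (rule that) (rule comm)
qed

text \<open>The case q = 1 - p, with scalar part 1; the norm hypothesis says that 1 - p acts as a
  contraction. The equation 2 \<nu> = 1 + \<nu>^2 forces \<nu> = 1, whereupon the linear terms in
  \<open>a\<close> cancel. As 1 + a = 1 - sqrt p, the root obtained is the negative one.\<close>

lemma self_adjoint_square_root:
  fixes p :: "'a::cstar_algebra"
  assumes "star p = p" "\<And>x. norm (x - p * x) \<le> norm x"
  obtains k where "star k = k" "k * k = p"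
proof -
  have c: "norm (1 *\<^sub>R x + (- p) * x) \<le> norm x" for x using assms(2)[of x] by simp
  have "star (- p) = - p" using assms(1) by (simp add: star_minus)
  then obtain \<nu> a where "0 \<le> \<nu>" "\<nu> \<le> 1" and nu: "2 * \<nu> = 1 + \<nu>\<^sup>2" and "star a = a"
    and a: "2 *\<^sub>R a = - p + (2 * \<nu>) *\<^sub>R a + a * a"
    using sqrt_in_unitization[OF zero_le_one order.refl _ c] by blast
  have "(\<nu> - 1)\<^sup>2 = 0" using nu by (simp add: power2_eq_square algebra_simps)
  then have "\<nu> = 1" by simp
  then have "a * a = p" using a by simp
  with \<open>star a = a\<close> show thesis by (rule that)
qed

text \<open>If k denotes the square root of 1 - a^2, then a + ik is unitary and k is the imaginary
  part of it, so k is a contraction.\<close>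

lemma one_minus_square_contraction:
  fixes a :: "'a::cstar_algebra"
  assumes sa: "star a = a" and n: "norm a \<le> 1"
  shows "norm (x - a * a * x) \<le> norm x"
proof -
  have "norm (a * a) \<le> 1"
    using cstar_identity[of a] n by (simp add: sa power_le_one)
  moreover have "star (a * a) = a * a" by (simp add: star_mult sa)
  ultimately obtain m where m: "star m = m" "m + m - m * m = a * a" "a * m = m * a"
    using one_minus_square_root[of "a * a"] by (metis mult.assoc)
  \<comment> \<open>\<open>u \<epsilon> x\<close> is (a + \<epsilon> k) x with k = 1 - m, treating
    \<epsilon> = i and \<epsilon> = -i at once.\<close>
  define u where "u \<epsilon> x = a * x + \<epsilon> *\<^sub>C (x - m * x)" for \<epsilon> x
  have iso: "norm (u \<epsilon> x) = norm x" if e: "cnj \<epsilon> = - \<epsilon>" "\<epsilon> * \<epsilon> = -1" for \<epsilon> x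
  proof -
    have aam: "a * a = m + m - m * m" using m by simp
    have am: "a * (m * y) = m * (a * y)" for y using m(3) by (metis mult.assoc)
    have aa: "a * (a * y) = m * y + m * y - m * (m * y)" for y
      using arg_cong[OF aam, of "\<lambda>t. t * y"] by (simp add: algebra_simps)
    have e': "\<epsilon> *\<^sub>C ((- \<epsilon>) *\<^sub>C y) = y" for y :: 'a
      using e(2) by (simp add: scaleC_scaleC scaleC_one)
    have prod: "(p + (- \<epsilon>) *\<^sub>C q) * (r + \<epsilon> *\<^sub>C t)
        = p * r + q * t + (\<epsilon> *\<^sub>C (p * t) + (- \<epsilon>) *\<^sub>C (q * r))" for p q r t :: 'a
      by (simp add: distrib_left distrib_right mult_scaleC_left mult_scaleC_right
          scaleC_add_right e' add_ac)
    let ?y = "x - m * x"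
    have "star (u \<epsilon> x) * u \<epsilon> x
      = (star x * a + (- \<epsilon>) *\<^sub>C (star x - star x * m)) * (a * x + \<epsilon> *\<^sub>C ?y)"
      by (simp add: u_def star_add star_scaleC star_diff star_mult sa m(1) e(1))
    also have "\<dots> = star x * (a * (a * x)) + (star x - star x * m) * ?y
        + (\<epsilon> *\<^sub>C (star x * (a * ?y)) + (- \<epsilon>) *\<^sub>C ((star x - star x * m) * (a * x)))"
      unfolding prod by (simp add: mult.assoc)
    also have "(star x - star x * m) * (a * x) = star x * (a * ?y)"
      by (simp add: algebra_simps am)
    also have "\<epsilon> *\<^sub>C (star x * (a * ?y)) + (- \<epsilon>) *\<^sub>C (star x * (a * ?y)) = 0"
      by (simp add: scaleC_minus_left)
    also have "star x * (a * (a * x)) + (star x - star x * m) * ?y + 0 = star x * x"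
      by (simp add: aa algebra_simps)
    finally have "(norm (u \<epsilon> x))\<^sup>2 = (norm x)\<^sup>2" by (metis cstar_identity)
    then show ?thesis by simp
  qed
  have k: "norm (y - m * y) \<le> norm y" for y
  proof -
    have "u \<i> y - u (- \<i>) y = (2 * \<i>) *\<^sub>C (y - m * y)"
      by (simp add: u_def scaleC_minus_left flip: scaleC_add_left)
    then have "2 * norm (y - m * y) = norm (u \<i> y - u (- \<i>) y)"
      by (simp add: norm_scaleC norm_mult)
    also have "\<dots> \<le> norm (u \<i> y) + norm (u (- \<i>) y)" by (rule norm_triangle_ineq4)
    also have "\<dots> = 2 * norm y" by (simp add: iso)
    finally show ?thesis by simp
  qed
  \<comment> \<open>1 - a a = k^2, so the contraction k is applied twice.\<close>
  have "x - a * a * x = (x - m * x) - m * (x - m * x)"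
    unfolding m(2)[symmetric] by (simp add: algebra_simps)
  then show ?thesis using k[of "x - m * x"] k[of x] by (metis order_trans)
qed

text \<open>For skew-adjoint z, the Cayley transform w = (1 + z) / (1 - z) = 1 + 2y is isometric. As
  z = (1 - z)(w - 1) / 2, the means c of the powers of w satisfy the bound for z c of the mean
  ergodic theorem.\<close>

lemma approximate_annihilator_skew:
  fixes z :: "'a::cstar_algebra"
  assumes sk: "star z = - z" and n: "norm z < 1" and N: "0 < N"
  obtains e where "\<And>x. norm (x - e * x) \<le> norm x"
    "\<And>x. norm (z * (x - e * x)) \<le> 2 / real N * norm x"
proof -
  \<comment> \<open>The fixed point is y = z / (1 - z), so that 1 + 2 y is the Cayley
    transform.\<close>
  have "\<exists>!y. z + z * y = y"
    by (rule banach_fix_type[where c = "norm z"])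
       (use n in \<open>auto simp: dist_norm norm_mult_ineq simp flip: right_diff_distrib\<close>)
  then obtain y where y: "y = z + z * y" by metis
  have ysz: "star y * z = - star y - z"
  proof -
    have "star (z * y) = star (y - z)" using y by (metis add_diff_cancel_left')
    then have "- (star y * z) = star y + z" by (simp add: star_mult star_diff sk)
    then show ?thesis by (metis add.inverse_inverse minus_add_distrib uminus_add_conv_diff add.commute)
  qed
  \<comment> \<open>In the form y + y* + 2 y* y = 0 this says that w* w = 1 for w = 1 + 2 y.\<close>
  have yy: "2 *\<^sub>R (star y * y) = - star y - y"
  proof -
    have "star y * y = star y * z + star y * z * y"
      by (subst (2) y) (simp add: algebra_simps)
    also have "\<dots> = - star y - z - star y * y - z * y"
      unfolding ysz by (simp add: algebra_simps)
    finally have "star y * y + star y * y = - star y - (z + z * y)" by (simp add: algebra_simps)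
    then show ?thesis using y by (simp add: scaleR_2)
  qed
  define w where "w x = x + 2 *\<^sub>R (y * x)" for x
  have wadd: "w (x + x') = w x + w x'" for x x' by (simp add: w_def algebra_simps)
  have w0: "w 0 = 0" by (simp add: w_def)
  have iso: "norm (w x) = norm x" for x
  proof -
    have "star (w x) * w x
        = star x * x + 2 *\<^sub>R (star x * (y + star y + 2 *\<^sub>R (star y * y)) * x)"
      by (simp add: w_def star_add star_scaleR star_mult algebra_simps)
    also have "\<dots> = star x * x" unfolding yy by simp
    finally have "(norm (w x))\<^sup>2 = (norm x)\<^sup>2" by (metis cstar_identity)
    then show ?thesis by simp
  qed
  have isoj: "norm ((w ^^ j) x) = norm x" for j x by (induction j) (auto simp: iso)
  have "\<exists>g. \<forall>x. (w ^^ j) x = x + g * x" for j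
  proof (induction j)
    case 0 show ?case by (rule exI[of _ 0]) simp
  next
    case (Suc j)
    then obtain g where "\<forall>x. (w ^^ j) x = x + g * x" by blast
    then have "(w ^^ Suc j) x = x + (g + 2 *\<^sub>R y + 2 *\<^sub>R (y * g)) * x" for x
      by (simp add: w_def algebra_simps)
    then show ?case by blast
  qed
  then obtain g where g: "\<And>j x. (w ^^ j) x = x + g j * x" by metis
  define S where "S x = (\<Sum>j<N. (w ^^ j) x)" for x
  \<comment> \<open>Chosen so that 1 - e is the mean of the first N powers of w; each power is 1
    plus left multiplication by \<open>g j\<close>.\<close>
  define e where "e = - (1 / real N) *\<^sub>R (\<Sum>j<N. g j)"
  have ce: "x - e * x = (1 / real N) *\<^sub>R S x" for x
    using N by (simp add: e_def S_def g sum.distrib sum_distrib_right scaleR_right_distrib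
        sum_constant_scaleR)
  have nS: "norm (S x) \<le> real N * norm x" for x
    using sum_norm_le[of "{..<N}" "\<lambda>j. (w ^^ j) x" "\<lambda>_. norm x"] by (simp add: S_def isoj)
  \<comment> \<open>The sum telescopes: (w - 1) S = w^N - 1, where w - 1 = 2 y.\<close>
  have tel: "2 *\<^sub>R (y * S x) = (w ^^ N) x - x" for x
  proof -
    have wsum: "w (\<Sum>j<n. (w ^^ j) x) = (\<Sum>j<n. (w ^^ Suc j) x)" for n
      by (induction n) (simp_all add: wadd w0)
    have "w (S x) - S x = (\<Sum>j<N. (w ^^ Suc j) x - (w ^^ j) x)"
      unfolding S_def wsum by (simp add: sum_subtractf)
    also have "\<dots> = (w ^^ N) x - x" by (subst sum_lessThan_telescope) simp
    finally show ?thesis by (simp add: w_def)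
  qed
  \<comment> \<open>From z = (1 - z) y it follows that z S = y S - z (y S), and both terms are
    bounded independently of N.\<close>
  have zS: "norm (z * S x) \<le> 2 * norm x" for x
  proof -
    have "2 * norm (y * S x) \<le> 2 * norm x"
      using arg_cong[OF tel[of x], of norm] norm_triangle_ineq4[of "(w ^^ N) x" x] isoj[of N x] by simp
    then have 1: "norm (y * S x) \<le> norm x" by simp
    have "norm (z * (y * S x)) \<le> norm z * norm (y * S x)" by (rule norm_mult_ineq)
    also have "\<dots> \<le> 1 * norm x" using n 1 by (intro mult_mono) auto
    finally have 2: "norm (z * (y * S x)) \<le> norm x" by simp
    have "z * S x = y * S x - z * (y * S x)"
      using arg_cong[OF y, of "\<lambda>t. t * S x"] by (simp add: algebra_simps)
    then show ?thesis using 1 2 norm_triangle_ineq4[of "y * S x" "z * (y * S x)"] by simp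
  qed
  show thesis
  proof (rule that)
    show "norm (x - e * x) \<le> norm x" for x
      unfolding ce using N nS[of x] by (simp add: field_simps)
    show "norm (z * (x - e * x)) \<le> 2 / real N * norm x" for x
      unfolding ce using N zS[of x] by (simp add: field_simps)
  qed
qed

text \<open>The element i t b* b is skew-adjoint, and \<open>t\<close> makes its norm less than 1.
  An estimate for b* b passes to \<open>b\<close> by ||b c||^2 = ||c* b* b c|| at the price of a
  square root, whence the square of \<epsilon> in the choice of \<open>N\<close>.\<close>

lemma approximate_annihilator:
  fixes b :: "'a::cstar_algebra"
  assumes "0 < \<epsilon>"
  obtains e where "\<And>x. norm (x - e * x) \<le> norm x" "\<And>x. norm (b * (x - e * x)) \<le> \<epsilon> * norm x"
proof -
  define t where "t = 1 / (2 * (1 + (norm b)\<^sup>2))"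
  have t: "0 < t" by (simp add: t_def add_pos_nonneg)
  define z where "z = (\<i> * complex_of_real t) *\<^sub>C (star b * b)"
  have "star z = - z"
    by (simp add: z_def star_scaleC star_mult star_star scaleC_minus_left)
  moreover have "norm z = t * (norm b)\<^sup>2"
    using t by (simp add: z_def norm_scaleC norm_mult cstar_identity)
  then have "norm z < 1" by (simp add: t_def pos_divide_less_eq add_pos_nonneg add_nonneg_pos)
  moreover obtain N where N: "2 / (t * \<epsilon>\<^sup>2) < real N" using reals_Archimedean2 by blast
  moreover have N0: "0 < N"
  proof (rule ccontr)
    assume "\<not> 0 < N"
    then have "2 / (t * \<epsilon>\<^sup>2) < 0" using N by simp
    moreover have "0 < 2 / (t * \<epsilon>\<^sup>2)" using t assms by simp
    ultimately show False by linarith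
  qed
  ultimately obtain e where e: "\<And>x. norm (x - e * x) \<le> norm x"
    and ze: "\<And>x. norm (z * (x - e * x)) \<le> 2 / real N * norm x"
    using approximate_annihilator_skew by blast
  have "norm (b * (x - e * x)) \<le> \<epsilon> * norm x" for x
  proof -
    let ?c = "x - e * x"
    have zc: "norm (z * ?c) = t * norm (star b * b * ?c)"
      using t by (simp add: z_def mult_scaleC_left norm_scaleC norm_mult)
    have "(norm (b * ?c))\<^sup>2 = norm (star ?c * (star b * b * ?c))"
      by (simp add: star_mult mult.assoc flip: cstar_identity)
    also have "\<dots> \<le> norm ?c * norm (star b * b * ?c)"
      by (metis norm_mult_ineq norm_star)
    also have "\<dots> \<le> norm x * ((2 / real N * norm x) / t)"
    proof (intro mult_mono)
      show "norm (star b * b * ?c) \<le> 2 / real N * norm x / t"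
        using ze[of x] t unfolding zc by (simp only: pos_le_divide_eq mult.commute)
    qed (use e[of x] in auto)
    also have "\<dots> = (2 / (real N * t)) * (norm x)\<^sup>2" by (simp add: power2_eq_square)
    also have "\<dots> \<le> \<epsilon>\<^sup>2 * (norm x)\<^sup>2"
      using N t assms N0 by (intro mult_right_mono) (auto simp: field_simps)
    finally have "(norm (b * ?c))\<^sup>2 \<le> (\<epsilon> * norm x)\<^sup>2" by (simp add: power_mult_distrib)
    then show ?thesis using assms by (meson power2_le_imp_le mult_nonneg_nonneg less_imp_le norm_ge_zero)
  qed
  with e show thesis by (rule that)
qed

text \<open>A finite set is treated one element at a time, by the product (1 - e)(1 - d) with
  \<open>d\<close> chosen for b (1 - e). As both factors are contractions, the estimates for earlier
  elements survive unchanged. The bound 2 comes from e = 1 - (1 - e).\<close>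

lemma approximate_unit:
  fixes B :: "'a::cstar_algebra set"
  assumes "finite B" "0 < \<epsilon>"
  obtains e where "norm e \<le> 2" "\<And>b. b \<in> B \<Longrightarrow> norm (b - b * e) \<le> \<epsilon>"
proof -
  have "\<exists>e. (\<forall>x. norm (x - e * x) \<le> norm x) \<and> (\<forall>b\<in>B. \<forall>x. norm (b * (x - e * x)) \<le> \<epsilon> * norm x)"
    using assms(1)
  proof induction
    case empty show ?case by (intro exI[of _ 0]) simp
  next
    case (insert b B)
    then obtain e where e: "\<And>x. norm (x - e * x) \<le> norm x"
      and eB: "\<And>b x. b \<in> B \<Longrightarrow> norm (b * (x - e * x)) \<le> \<epsilon> * norm x" by blast
    obtain d where d: "\<And>x. norm (x - d * x) \<le> norm x"
      and db: "\<And>x. norm ((b - b * e) * (x - d * x)) \<le> \<epsilon> * norm x"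
      using approximate_annihilator[OF assms(2)] by blast
    define c where "c = e + d - e * d"
    have c: "x - c * x = (x - d * x) - e * (x - d * x)" for x by (simp add: c_def algebra_simps)
    have "norm (x - c * x) \<le> norm x" for x
      unfolding c by (rule order_trans[OF e d])
    moreover have "norm (b * (x - c * x)) \<le> \<epsilon> * norm x" for x
      using db[of x] unfolding c by (simp add: algebra_simps)
    moreover have "norm (b' * (x - c * x)) \<le> \<epsilon> * norm x" if "b' \<in> B" for b' x
      unfolding c
      by (rule order_trans[OF eB[OF that] mult_left_mono[OF d]]) (use assms in simp)
    ultimately show ?case by blast
  qed
  then obtain e where e: "\<And>x. norm (x - e * x) \<le> norm x"
    and eB: "\<And>b x. b \<in> B \<Longrightarrow> norm (b * (x - e * x)) \<le> \<epsilon> * norm x" by blast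
  show thesis
  proof (rule that)
    show "norm e \<le> 2"
    proof (rule norm_le_of_left_mult)
      show "norm (e * x) \<le> 2 * norm x" for x
        using e[of x] norm_triangle_ineq4[of x "x - e * x"] by simp
    qed simp
    show "norm (b - b * e) \<le> \<epsilon>" if "b \<in> B" for b
      by (rule norm_le_of_left_mult) (use eB[OF that] assms in \<open>simp_all add: algebra_simps\<close>)
  qed
qed

section \<open>Hilbert spaces with carriers\<close>

text \<open>Definiteness and completeness are left out so that the results apply to finitely
  supported functions under a degenerate kernel form, and to their completion before it is known to
  be a Hilbert space.\<close>

locale semi_inner_space =
  fixes H :: "'v::complex_vector hilbert"
  assumes subspace: "module.subspace scaleC (hcarrier H)"
    and inner_add_right: "\<lbrakk>x \<in> hcarrier H; y \<in> hcarrier H; z \<in> hcarrier H\<rbrakk>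
      \<Longrightarrow> hinner H x (y + z) = hinner H x y + hinner H x z"
    and inner_scaleC_right: "\<lbrakk>x \<in> hcarrier H; y \<in> hcarrier H\<rbrakk>
      \<Longrightarrow> hinner H x (c *\<^sub>C y) = c * hinner H x y"
    and inner_commute: "\<lbrakk>x \<in> hcarrier H; y \<in> hcarrier H\<rbrakk>
      \<Longrightarrow> hinner H y x = cnj (hinner H x y)"
    and inner_nonneg: "x \<in> hcarrier H \<Longrightarrow> 0 \<le> Re (hinner H x x)"

sublocale hilbert_space \<subseteq> semi_inner_space
  using subspace_hcarrier hinner_add_right hinner_scaleC_right hinner_commute hinner_nonneg
  by unfold_locales

interpretation scaleC_module: module "scaleC :: complex \<Rightarrow> 'v::complex_vector \<Rightarrow> 'v"
  by unfold_locales (simp_all add: scaleC_add_right scaleC_add_left scaleC_scaleC scaleC_one)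

context semi_inner_space
begin

lemma zero_mem [simp, intro]: "0 \<in> hcarrier H"
  using subspace by (rule scaleC_module.subspace_0)

lemma add_mem [simp, intro]: "x \<in> hcarrier H \<Longrightarrow> y \<in> hcarrier H \<Longrightarrow> x + y \<in> hcarrier H"
  using subspace by (rule scaleC_module.subspace_add)

lemma scaleC_mem [simp, intro]: "x \<in> hcarrier H \<Longrightarrow> c *\<^sub>C x \<in> hcarrier H"
  using subspace by (rule scaleC_module.subspace_scale)

lemma minus_mem [simp, intro]: "x \<in> hcarrier H \<Longrightarrow> - x \<in> hcarrier H"
  using subspace by (rule scaleC_module.subspace_neg)

lemma diff_mem [simp, intro]: "x \<in> hcarrier H \<Longrightarrow> y \<in> hcarrier H \<Longrightarrow> x - y \<in> hcarrier H"
  using subspace by (rule scaleC_module.subspace_diff)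

lemma sum_mem: "(\<And>i. i \<in> I \<Longrightarrow> f i \<in> hcarrier H) \<Longrightarrow> (\<Sum>i\<in>I. f i) \<in> hcarrier H"
  using subspace by (rule scaleC_module.subspace_sum)

lemma inner_zero_right [simp]: "x \<in> hcarrier H \<Longrightarrow> hinner H x 0 = 0"
  using inner_scaleC_right[of x 0 0] by simp

lemma inner_zero_left [simp]: "x \<in> hcarrier H \<Longrightarrow> hinner H 0 x = 0"
  using inner_commute[of x 0] by simp

lemma inner_minus_right: "x \<in> hcarrier H \<Longrightarrow> y \<in> hcarrier H \<Longrightarrow> hinner H x (- y) = - hinner H x y"
  using inner_scaleC_right[of x y "-1"] by (simp add: scaleC_minus1)

lemma inner_diff_right: "x \<in> hcarrier H \<Longrightarrow> y \<in> hcarrier H \<Longrightarrow> z \<in> hcarrier H \<Longrightarrow>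
    hinner H x (y - z) = hinner H x y - hinner H x z"
  using inner_add_right[of x y "- z"] by (simp add: inner_minus_right)

lemma inner_add_left: "x \<in> hcarrier H \<Longrightarrow> y \<in> hcarrier H \<Longrightarrow> z \<in> hcarrier H \<Longrightarrow>
    hinner H (x + y) z = hinner H x z + hinner H y z"
  using inner_commute[of z "x + y"] inner_commute[of z x] inner_commute[of z y]
  by (simp add: inner_add_right)

lemma inner_scaleC_left: "x \<in> hcarrier H \<Longrightarrow> y \<in> hcarrier H \<Longrightarrow>
    hinner H (c *\<^sub>C x) y = cnj c * hinner H x y"
  using inner_commute[of y "c *\<^sub>C x"] inner_commute[of y x] by (simp add: inner_scaleC_right)

lemma inner_minus_left: "x \<in> hcarrier H \<Longrightarrow> y \<in> hcarrier H \<Longrightarrow> hinner H (- x) y = - hinner H x y"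
  using inner_scaleC_left[of x y "-1"] by (simp add: scaleC_minus1)

lemma inner_diff_left: "x \<in> hcarrier H \<Longrightarrow> y \<in> hcarrier H \<Longrightarrow> z \<in> hcarrier H \<Longrightarrow>
    hinner H (x - y) z = hinner H x z - hinner H y z"
  using inner_add_left[of x "- y" z] by (simp add: inner_minus_left)

lemma inner_sum_right: "x \<in> hcarrier H \<Longrightarrow> (\<And>i. i \<in> I \<Longrightarrow> f i \<in> hcarrier H) \<Longrightarrow>
    hinner H x (\<Sum>i\<in>I. f i) = (\<Sum>i\<in>I. hinner H x (f i))"
  by (induction I rule: infinite_finite_induct) (simp_all add: inner_add_right sum_mem)

lemma inner_sum_left: "x \<in> hcarrier H \<Longrightarrow> (\<And>i. i \<in> I \<Longrightarrow> f i \<in> hcarrier H) \<Longrightarrow>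
    hinner H (\<Sum>i\<in>I. f i) x = (\<Sum>i\<in>I. hinner H (f i) x)"
  by (induction I rule: infinite_finite_induct) (simp_all add: inner_add_left sum_mem)

lemma hnorm_nonneg [simp]: "x \<in> hcarrier H \<Longrightarrow> 0 \<le> hnorm H x"
  by (simp add: hnorm_def inner_nonneg)

lemma hnorm_sq: "x \<in> hcarrier H \<Longrightarrow> (hnorm H x)\<^sup>2 = Re (hinner H x x)"
  by (simp add: hnorm_def inner_nonneg)

lemma inner_self: "x \<in> hcarrier H \<Longrightarrow> hinner H x x = complex_of_real ((hnorm H x)\<^sup>2)"
  using inner_commute[of x x] by (simp add: hnorm_sq complex_eq_iff)

lemma hnorm_zero [simp]: "hnorm H 0 = 0"
  by (simp add: hnorm_def)

lemma hnorm_scaleC: "x \<in> hcarrier H \<Longrightarrow> hnorm H (c *\<^sub>C x) = cmod c * hnorm H x"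
proof -
  assume x: "x \<in> hcarrier H"
  have "(hnorm H (c *\<^sub>C x))\<^sup>2 = Re (cnj c * (c * hinner H x x))"
    using x by (simp only: hnorm_sq inner_scaleC_left inner_scaleC_right scaleC_mem mult.left_commute)
  also have "cnj c * (c * hinner H x x) = complex_of_real ((cmod c)\<^sup>2) * hinner H x x"
    by (simp only: complex_norm_square mult_ac)
  also have "Re \<dots> = (cmod c)\<^sup>2 * (hnorm H x)\<^sup>2"
    using x by (simp only: hnorm_sq Re_complex_of_real Im_complex_of_real times_complex.sel mult_zero_left diff_zero)
  finally have "(hnorm H (c *\<^sub>C x))\<^sup>2 = (cmod c * hnorm H x)\<^sup>2" by (simp add: power_mult_distrib)
  then show ?thesis using x by (simp add: power2_eq_iff_nonneg)
qed

lemma hnorm_minus: "x \<in> hcarrier H \<Longrightarrow> hnorm H (- x) = hnorm H x"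
  using hnorm_scaleC[of x "-1"] by (simp add: scaleC_minus1)

lemma hnorm_diff_commute: "x \<in> hcarrier H \<Longrightarrow> y \<in> hcarrier H \<Longrightarrow> hnorm H (x - y) = hnorm H (y - x)"
  using hnorm_minus[of "x - y"] by simp

lemma hnorm_add_sq: "x \<in> hcarrier H \<Longrightarrow> y \<in> hcarrier H \<Longrightarrow>
    (hnorm H (x + y))\<^sup>2 = (hnorm H x)\<^sup>2 + 2 * Re (hinner H x y) + (hnorm H y)\<^sup>2"
  using inner_commute[of x y] by (simp add: hnorm_sq inner_add_left inner_add_right)

lemma hnorm_diff_sq: "x \<in> hcarrier H \<Longrightarrow> y \<in> hcarrier H \<Longrightarrow>
    (hnorm H (x - y))\<^sup>2 = (hnorm H x)\<^sup>2 - 2 * Re (hinner H x y) + (hnorm H y)\<^sup>2"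
  using hnorm_add_sq[of x "- y"] by (simp add: inner_minus_right hnorm_minus)

lemma Cauchy_Schwarz:
  assumes x: "x \<in> hcarrier H" and y: "y \<in> hcarrier H"
  shows "cmod (hinner H x y) \<le> hnorm H x * hnorm H y"
proof -
  let ?d = "hinner H x y"
  \<comment> \<open>With d = <x,y> this expands |y - t d x|^2 \<ge> 0 into a real quadratic in t. In
    a degenerate space |x| = 0 does not imply x = 0; a large t then forces d = 0. Otherwise t = 1 /
    |x|^2 is the optimal choice.\<close>
  have ineq: "0 \<le> (hnorm H y)\<^sup>2 - 2 * t * (cmod ?d)\<^sup>2 + t\<^sup>2 * (cmod ?d)\<^sup>2 * (hnorm H x)\<^sup>2" for t :: real
  proof -
    let ?c = "complex_of_real t * ?d"
    have re: "Re (hinner H y (?c *\<^sub>C x)) = t * (cmod ?d)\<^sup>2"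
    proof -
      have "hinner H y (?c *\<^sub>C x) = ?c * cnj ?d"
        using x y inner_commute[of x y] by (simp add: inner_scaleC_right)
      also have "\<dots> = complex_of_real (t * (cmod ?d)\<^sup>2)"
        by (simp only: mult.assoc of_real_mult complex_norm_square)
      finally show ?thesis by simp
    qed
    have "0 \<le> (hnorm H (y - ?c *\<^sub>C x))\<^sup>2" by simp
    also have "\<dots> = (hnorm H y)\<^sup>2 - 2 * (t * (cmod ?d)\<^sup>2) + (cmod ?c * hnorm H x)\<^sup>2"
      using x y re by (simp only: hnorm_diff_sq scaleC_mem hnorm_scaleC)
    finally show ?thesis by (simp add: norm_mult power_mult_distrib)
  qed
  have "(cmod ?d)\<^sup>2 \<le> (hnorm H x)\<^sup>2 * (hnorm H y)\<^sup>2"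
  proof (cases "hnorm H x = 0")
    case True
    have "(cmod ?d)\<^sup>2 = 0"
    proof (rule ccontr)
      assume nz: "(cmod ?d)\<^sup>2 \<noteq> 0"
      then have "2 * (((hnorm H y)\<^sup>2 + 1) / (2 * (cmod ?d)\<^sup>2)) * (cmod ?d)\<^sup>2 = (hnorm H y)\<^sup>2 + 1" by simp
      then show False using ineq[of "((hnorm H y)\<^sup>2 + 1) / (2 * (cmod ?d)\<^sup>2)"] True by simp
    qed
    then show ?thesis by simp
  next
    case False
    then have p: "0 < (hnorm H x)\<^sup>2" by simp
    have "(1 / r)\<^sup>2 * d * r = 1 / r * d" if "0 < r" for r d :: real
      using that by (simp add: power2_eq_square)
    from this[OF p] have "0 \<le> (hnorm H y)\<^sup>2 - (cmod ?d)\<^sup>2 / (hnorm H x)\<^sup>2"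
      using ineq[of "1 / (hnorm H x)\<^sup>2"] by simp
    then show ?thesis using p by (simp add: field_simps)
  qed
  then show ?thesis
    using x y by (metis power_mult_distrib power2_le_imp_le mult_nonneg_nonneg hnorm_nonneg)
qed

lemma hnorm_triangle:
  assumes x: "x \<in> hcarrier H" and y: "y \<in> hcarrier H"
  shows "hnorm H (x + y) \<le> hnorm H x + hnorm H y"
proof -
  have "Re (hinner H x y) \<le> hnorm H x * hnorm H y"
    using Cauchy_Schwarz[OF x y] complex_Re_le_cmod order_trans by blast
  then have "(hnorm H (x + y))\<^sup>2 \<le> (hnorm H x + hnorm H y)\<^sup>2"
    using x y by (simp add: hnorm_add_sq power2_sum)
  then show ?thesis using x y by (meson power2_le_imp_le add_nonneg_nonneg hnorm_nonneg)
qed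

lemma hnorm_triangle_diff:
  assumes "x \<in> hcarrier H" "y \<in> hcarrier H" "z \<in> hcarrier H"
  shows "hnorm H (x - z) \<le> hnorm H (x - y) + hnorm H (y - z)"
  using hnorm_triangle[of "x - y" "y - z"] assms by simp

lemma abs_hnorm_diff:
  assumes x: "x \<in> hcarrier H" and y: "y \<in> hcarrier H"
  shows "\<bar>hnorm H x - hnorm H y\<bar> \<le> hnorm H (x - y)"
  using hnorm_triangle[of "x - y" y] hnorm_triangle[of "y - x" x] hnorm_diff_commute[of x y] x y
  by auto

lemma hnorm_eq_0_inner:
  assumes "x \<in> hcarrier H" "y \<in> hcarrier H" "hnorm H x = 0"
  shows "hinner H x y = 0"
  using Cauchy_Schwarz[OF assms(1,2)] assms(3) by simp

text \<open>Riesz representation by a minimizing sequence of |u|^2 - 2 Re f(u), without completeness.\<close>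

lemma Riesz_approximation:
  assumes add: "\<And>x y. x \<in> hcarrier H \<Longrightarrow> y \<in> hcarrier H \<Longrightarrow> f (x + y) = f x + f y"
    and scale: "\<And>c x. x \<in> hcarrier H \<Longrightarrow> f (c *\<^sub>C x) = c * f x"
    and bound: "\<And>x. x \<in> hcarrier H \<Longrightarrow> cmod (f x) \<le> C * hnorm H x"
  obtains u where "\<And>n. u n \<in> hcarrier H"
    "\<forall>e>0. \<exists>N. \<forall>m\<ge>N. \<forall>n\<ge>N. hnorm H (u m - u n) < e"
    "\<And>g. g \<in> hcarrier H \<Longrightarrow> (\<lambda>n. hinner H (u n) g) \<longlonglongrightarrow> f g"
proof -
  define J where "J x = (hnorm H x)\<^sup>2 - 2 * Re (f x)" for x
  have J_ge: "- (C\<^sup>2) \<le> J x" if x: "x \<in> hcarrier H" for x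
  proof -
    have "Re (f x) \<le> C * hnorm H x" using bound[OF x] complex_Re_le_cmod order_trans by blast
    moreover have "0 \<le> (hnorm H x - C)\<^sup>2" by simp
    ultimately show ?thesis unfolding J_def power2_diff by (simp add: algebra_simps)
  qed
  define m where "m = Inf (J ` hcarrier H)"
  have bdd: "bdd_below (J ` hcarrier H)" using J_ge by (auto simp: bdd_below_def)
  have m_le: "m \<le> J x" if "x \<in> hcarrier H" for x
    unfolding m_def by (rule cINF_lower[OF bdd that])
  have "\<exists>x\<in>hcarrier H. J x < m + 1 / real (Suc n)" for n
  proof -
    have "Inf (J ` hcarrier H) < m + 1 / real (Suc n)" unfolding m_def by simp
    then show ?thesis
      by (subst (asm) cINF_less_iff[OF _ bdd]) auto
  qed
  then obtain u where u: "\<And>n. u n \<in> hcarrier H" and Ju: "\<And>n. J (u n) < m + 1 / real (Suc n)"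
    by metis
  \<comment> \<open>At the midpoint of two nearly minimizing vectors \<open>J\<close> cannot fall
    below \<open>m\<close>, so the parallelogram law bounds their distance.\<close>
  have par: "(hnorm H (u i - u j))\<^sup>2 \<le> 2 / real (Suc i) + 2 / real (Suc j)" for i j
  proof -
    let ?m = "(1/2) *\<^sub>C (u i + u j)"
    have "(hnorm H (u i + u j))\<^sup>2 + (hnorm H (u i - u j))\<^sup>2
        = 2 * (hnorm H (u i))\<^sup>2 + 2 * (hnorm H (u j))\<^sup>2"
      using u by (simp add: hnorm_add_sq hnorm_diff_sq)
    moreover have "J ?m = (hnorm H (u i + u j))\<^sup>2 / 4 - Re (f (u i)) - Re (f (u j))"
      using u by (simp add: J_def hnorm_scaleC scale add power_divide add_divide_distrib)
    moreover have "m \<le> J ?m" using u by (intro m_le) auto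
    ultimately show ?thesis using Ju[of i] Ju[of j] by (simp add: J_def)
  qed
  have "\<forall>e>0. \<exists>N. \<forall>i\<ge>N. \<forall>j\<ge>N. hnorm H (u i - u j) < e"
  proof (intro allI impI)
    fix e :: real assume e: "0 < e"
    obtain N where N: "4 / e\<^sup>2 < real N" using reals_Archimedean2 by blast
    have "hnorm H (u i - u j) < e" if "i \<ge> N" "j \<ge> N" for i j
    proof -
      have *: "1 / real (Suc k) < e\<^sup>2 / 4" if "k \<ge> N" for k
      proof -
        have "4 / e\<^sup>2 < real (Suc k)" using N that by linarith
        then show ?thesis using e by (simp add: field_simps)
      qed
      have "(hnorm H (u i - u j))\<^sup>2 < e\<^sup>2"
        using par[of i j] *[OF that(1)] *[OF that(2)] by simp
      then show ?thesis using e by (meson power2_less_imp_less less_imp_le)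
    qed
    then show "\<exists>N. \<forall>i\<ge>N. \<forall>j\<ge>N. hnorm H (u i - u j) < e" by blast
  qed
  moreover have "(\<lambda>n. hinner H (u n) g) \<longlonglongrightarrow> f g" if g: "g \<in> hcarrier H" for g
  proof -
    define B where "B = (hnorm H g)\<^sup>2 + 1"
    have B: "0 < B" by (simp add: B_def add_nonneg_pos)
    have bd: "(cmod (hinner H (u n) g - f g))\<^sup>2 \<le> B / real (Suc n)" for n
    proof -
      define d where "d = hinner H (u n) g - f g"
      \<comment> \<open>Moving from \<open>u n\<close> by c g changes \<open>J\<close> by -2 |d|^2 /
        B + |c|^2 |g|^2 \<le> - |d|^2 / B, while \<open>J\<close> can drop by at most 1 / (n + 1).
        The summand 1 in \<open>B\<close> keeps it positive for null vectors
        \<open>g\<close>.\<close>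
      define c where "c = - (complex_of_real (1 / B)) * cnj d"
      have "c * d = complex_of_real (- (1 / B) * (cmod d)\<^sup>2)"
        unfolding c_def of_real_mult complex_norm_square by simp
      then have cd: "Re (c * d) = - (1 / B) * (cmod d)\<^sup>2" by simp
      have "J (u n + c *\<^sub>C g) = J (u n) + 2 * Re (c * d) + (cmod c)\<^sup>2 * (hnorm H g)\<^sup>2"
        using u[of n] g by (simp add: J_def hnorm_add_sq inner_scaleC_right hnorm_scaleC add scale
            d_def power_mult_distrib algebra_simps)
      moreover have "m \<le> J (u n + c *\<^sub>C g)" using u g by (intro m_le) auto
      moreover have "(cmod c)\<^sup>2 * (hnorm H g)\<^sup>2 \<le> (cmod d)\<^sup>2 / B"
      proof -
        have "(cmod c)\<^sup>2 = (cmod d)\<^sup>2 / B\<^sup>2" by (simp add: c_def norm_mult norm_divide power_divide power_mult_distrib)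
        moreover have "(cmod d)\<^sup>2 / B\<^sup>2 * (hnorm H g)\<^sup>2 \<le> (cmod d)\<^sup>2 / B\<^sup>2 * B"
          by (intro mult_left_mono) (simp_all add: B_def)
        ultimately show ?thesis using B by (simp add: power2_eq_square)
      qed
      ultimately have "(cmod d)\<^sup>2 / B \<le> 1 / real (Suc n)" using Ju[of n] cd by simp
      then show ?thesis using B by (simp add: d_def field_simps)
    qed
    have "(\<lambda>n. B / real (Suc n)) \<longlonglongrightarrow> 0"
      using tendsto_mult_right[OF LIMSEQ_inverse_real_of_nat, of B]
      by (simp add: divide_inverse mult.commute)
    then have "(\<lambda>n. (cmod (hinner H (u n) g - f g))\<^sup>2) \<longlonglongrightarrow> 0"
      by (rule tendsto_sandwich[OF _ _ tendsto_const, rotated 2]) (use bd in auto)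
    then have "(\<lambda>n. cmod (hinner H (u n) g - f g)) \<longlonglongrightarrow> 0"
      using tendsto_real_sqrt[of "\<lambda>n. (cmod (hinner H (u n) g - f g))\<^sup>2" 0] by simp
    then show ?thesis by (simp add: tendsto_norm_zero_iff LIM_zero_iff)
  qed
  ultimately show thesis using u that by blast
qed

lemma tendsto_inner_left:
  assumes u: "\<And>n. u n \<in> hcarrier H" and l: "l \<in> hcarrier H" and g: "g \<in> hcarrier H"
    and lim: "(\<lambda>n. hnorm H (u n - l)) \<longlonglongrightarrow> 0"
  shows "(\<lambda>n. hinner H (u n) g) \<longlonglongrightarrow> hinner H l g"
proof -
  have "(\<lambda>n. hnorm H (u n - l) * hnorm H g) \<longlonglongrightarrow> 0"
    using tendsto_mult_right[OF lim, of "hnorm H g"] by simp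
  then have "(\<lambda>n. hinner H (u n) g - hinner H l g) \<longlonglongrightarrow> 0"
  proof (rule Lim_null_comparison[rotated])
    show "\<forall>\<^sub>F n in sequentially. norm (hinner H (u n) g - hinner H l g) \<le> hnorm H (u n - l) * hnorm H g"
      using Cauchy_Schwarz[of "u _ - l" g] u l g by (auto simp: inner_diff_left)
  qed
  then show ?thesis by (simp add: LIM_zero_iff)
qed

lemma tendsto_hnorm:
  assumes u: "\<And>n. u n \<in> hcarrier H" and l: "l \<in> hcarrier H"
    and lim: "(\<lambda>n. hnorm H (u n - l)) \<longlonglongrightarrow> 0"
  shows "(\<lambda>n. hnorm H (u n)) \<longlonglongrightarrow> hnorm H l"
proof -
  have "(\<lambda>n. hnorm H (u n) - hnorm H l) \<longlonglongrightarrow> 0"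
    by (rule Lim_null_comparison[OF _ lim]) (use abs_hnorm_diff[OF u l] in auto)
  then show ?thesis by (simp add: LIM_zero_iff)
qed

lemma hnorm_bounded_of_Cauchy:
  fixes u :: "nat \<Rightarrow> 'v"
  assumes u: "\<And>n. u n \<in> hcarrier H"
    and cau: "\<forall>e>0. \<exists>N. \<forall>m\<ge>N. \<forall>n\<ge>N. hnorm H (u m - u n) < e"
  obtains B where "0 < B" "\<And>n. hnorm H (u n) \<le> B"
proof -
  have "Cauchy (\<lambda>n. hnorm H (u n))"
    unfolding Cauchy_def dist_real_def
    using cau abs_hnorm_diff[OF u u] le_less_trans by meson
  then have "Bseq (\<lambda>n. hnorm H (u n))" by (simp add: Cauchy_convergent_iff convergent_imp_Bseq)
  then obtain B where "0 < B" "\<And>n. norm (hnorm H (u n)) \<le> B" unfolding Bseq_def by blast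
  then show thesis using that by (metis abs_le_D1 real_norm_def)
qed

lemma inner_diff_bound:
  assumes "x \<in> hcarrier H" "x' \<in> hcarrier H" "y \<in> hcarrier H" "y' \<in> hcarrier H"
  shows "cmod (hinner H x y - hinner H x' y') \<le> hnorm H (x - x') * hnorm H y + hnorm H x' * hnorm H (y - y')"
proof -
  have "hinner H x y - hinner H x' y' = hinner H (x - x') y + hinner H x' (y - y')"
    using assms by (simp add: inner_diff_left inner_diff_right)
  moreover have "cmod (hinner H (x - x') y) \<le> hnorm H (x - x') * hnorm H y"
    "cmod (hinner H x' (y - y')) \<le> hnorm H x' * hnorm H (y - y')"
    using assms by (auto intro!: Cauchy_Schwarz)
  ultimately show ?thesis
    using norm_triangle_ineq[of "hinner H (x - x') y" "hinner H x' (y - y')"] by simp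
qed

lemma convergent_inner_of_Cauchy:
  fixes u w :: "nat \<Rightarrow> 'v"
  assumes u: "\<And>n. u n \<in> hcarrier H" "\<forall>e>0. \<exists>N. \<forall>m\<ge>N. \<forall>n\<ge>N. hnorm H (u m - u n) < e"
    and w: "\<And>n. w n \<in> hcarrier H" "\<forall>e>0. \<exists>N. \<forall>m\<ge>N. \<forall>n\<ge>N. hnorm H (w m - w n) < e"
  shows "convergent (\<lambda>n. hinner H (u n) (w n))"
proof -
  obtain A where A: "0 < A" "\<And>n. hnorm H (u n) \<le> A" using hnorm_bounded_of_Cauchy[OF u] by blast
  obtain B where B: "0 < B" "\<And>n. hnorm H (w n) \<le> B" using hnorm_bounded_of_Cauchy[OF w] by blast
  have "Cauchy (\<lambda>n. hinner H (u n) (w n))"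
    unfolding Cauchy_def dist_norm
  proof (intro allI impI)
    fix e :: real assume e: "0 < e"
    have "0 < e / (2 * B)" "0 < e / (2 * A)" using e A B by auto
    then obtain M N where M: "\<And>m n. m \<ge> M \<Longrightarrow> n \<ge> M \<Longrightarrow> hnorm H (u m - u n) < e / (2 * B)"
      and N: "\<And>m n. m \<ge> N \<Longrightarrow> n \<ge> N \<Longrightarrow> hnorm H (w m - w n) < e / (2 * A)"
      using u(2) w(2) by meson
    have "cmod (hinner H (u m) (w m) - hinner H (u n) (w n)) < e" if "m \<ge> max M N" "n \<ge> max M N" for m n
    proof -
      have "hnorm H (u m - u n) * hnorm H (w m) \<le> hnorm H (u m - u n) * B"
        using u w B by (intro mult_left_mono) auto
      also have "\<dots> < e / 2" using M[of m n] that B by (simp add: field_simps)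
      finally have 1: "hnorm H (u m - u n) * hnorm H (w m) < e / 2" .
      have "hnorm H (u n) * hnorm H (w m - w n) \<le> A * hnorm H (w m - w n)"
        using u w A by (intro mult_right_mono) auto
      also have "\<dots> < e / 2" using N[of m n] that A by (simp add: field_simps)
      finally show ?thesis
        using 1 inner_diff_bound[OF u(1)[of m] u(1)[of n] w(1)[of m] w(1)[of n]] by linarith
    qed
    then show "\<exists>M. \<forall>m\<ge>M. \<forall>n\<ge>M. cmod (hinner H (u m) (w m) - hinner H (u n) (w n)) < e" by blast
  qed
  then show ?thesis by (simp add: Cauchy_convergent_iff)
qed

lemma Cauchy_add:
  fixes u w :: "nat \<Rightarrow> 'v"
  assumes u: "\<And>n. u n \<in> hcarrier H" "\<forall>e>0. \<exists>N. \<forall>m\<ge>N. \<forall>n\<ge>N. hnorm H (u m - u n) < e"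
    and w: "\<And>n. w n \<in> hcarrier H" "\<forall>e>0. \<exists>N. \<forall>m\<ge>N. \<forall>n\<ge>N. hnorm H (w m - w n) < e"
  shows "\<forall>e>0. \<exists>N. \<forall>m\<ge>N. \<forall>n\<ge>N. hnorm H ((u m + w m) - (u n + w n)) < e"
proof (intro allI impI)
  fix e :: real assume "0 < e"
  then have "0 < e / 2" by simp
  then obtain M N where M: "\<And>m n. m \<ge> M \<Longrightarrow> n \<ge> M \<Longrightarrow> hnorm H (u m - u n) < e / 2"
    and N: "\<And>m n. m \<ge> N \<Longrightarrow> n \<ge> N \<Longrightarrow> hnorm H (w m - w n) < e / 2"
    using u(2) w(2) by meson
  have "hnorm H ((u m + w m) - (u n + w n)) < e" if "m \<ge> max M N" "n \<ge> max M N" for m n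
  proof -
    have eq: "(u m + w m) - (u n + w n) = (u m - u n) + (w m - w n)" by simp
    have "hnorm H ((u m - u n) + (w m - w n)) \<le> hnorm H (u m - u n) + hnorm H (w m - w n)"
      by (intro hnorm_triangle diff_mem u(1) w(1))
    moreover have "hnorm H (u m - u n) < e / 2" "hnorm H (w m - w n) < e / 2"
      using M N that by auto
    ultimately show ?thesis unfolding eq by linarith
  qed
  then show "\<exists>N. \<forall>m\<ge>N. \<forall>n\<ge>N. hnorm H ((u m + w m) - (u n + w n)) < e" by blast
qed

lemma Cauchy_scaleC:
  fixes u :: "nat \<Rightarrow> 'v"
  assumes u: "\<And>n. u n \<in> hcarrier H" "\<forall>e>0. \<exists>N. \<forall>m\<ge>N. \<forall>n\<ge>N. hnorm H (u m - u n) < e"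
  shows "\<forall>e>0. \<exists>N. \<forall>m\<ge>N. \<forall>n\<ge>N. hnorm H (c *\<^sub>C u m - c *\<^sub>C u n) < e"
proof (intro allI impI)
  fix e :: real assume "0 < e"
  then have "0 < e / (cmod c + 1)" by (simp add: add_nonneg_pos)
  then obtain N where N: "\<And>m n. m \<ge> N \<Longrightarrow> n \<ge> N \<Longrightarrow> hnorm H (u m - u n) < e / (cmod c + 1)"
    using u(2) by meson
  have "hnorm H (c *\<^sub>C u m - c *\<^sub>C u n) < e" if "m \<ge> N" "n \<ge> N" for m n
  proof -
    have "hnorm H (c *\<^sub>C u m - c *\<^sub>C u n) = cmod c * hnorm H (u m - u n)"
      using hnorm_scaleC[of "u m - u n" c] u(1) by (simp add: scaleC_module.scale_right_diff_distrib)
    also have "\<dots> \<le> (cmod c + 1) * hnorm H (u m - u n)"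
      using u(1) by (intro mult_right_mono) auto
    also have "\<dots> < e" using N[OF that] by (simp add: pos_less_divide_eq add_nonneg_pos mult.commute)
    finally show ?thesis .
  qed
  then show "\<exists>N. \<forall>m\<ge>N. \<forall>n\<ge>N. hnorm H (c *\<^sub>C u m - c *\<^sub>C u n) < e" by blast
qed

lemma span_mem: "Y \<subseteq> hcarrier H \<Longrightarrow> u \<in> module.span scaleC Y \<Longrightarrow> u \<in> hcarrier H"
  using scaleC_module.span_minimal[OF _ subspace] by blast

lemma subset_hclosed_span: "Y \<subseteq> hcarrier H \<Longrightarrow> Y \<subseteq> hclosed_span H Y"
  unfolding hclosed_span_def
proof safe
  fix v and e :: real
  assume "v \<in> Y" "0 < e"
  then show "\<exists>u\<in>scaleC_module.span Y. hnorm H (v - u) < e"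
    by (intro bexI[of _ v] scaleC_module.span_base) auto
qed auto

lemma hclosed_span_sequence:
  assumes Y: "Y \<subseteq> hcarrier H" and v: "v \<in> hclosed_span H Y"
  obtains u where "\<And>n. u n \<in> module.span scaleC Y" "\<And>n. u n \<in> hcarrier H"
    "(\<lambda>n. hnorm H (u n - v)) \<longlonglongrightarrow> 0"
    "\<forall>e>0. \<exists>N. \<forall>m\<ge>N. \<forall>n\<ge>N. hnorm H (u m - u n) < e"
proof -
  have vH: "v \<in> hcarrier H" using v by (auto simp: hclosed_span_def)
  have "\<exists>u\<in>module.span scaleC Y. hnorm H (v - u) < 1 / real (Suc n)" for n
    using v by (auto simp: hclosed_span_def)
  then obtain u where u: "\<And>n. u n \<in> module.span scaleC Y"
    and uv: "\<And>n. hnorm H (v - u n) < 1 / real (Suc n)" by metis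
  have uH: "u n \<in> hcarrier H" for n using span_mem[OF Y u] .
  have lim: "(\<lambda>n. hnorm H (u n - v)) \<longlonglongrightarrow> 0"
  proof (rule tendsto_sandwich[OF _ _ tendsto_const LIMSEQ_inverse_real_of_nat])
    show "\<forall>\<^sub>F n in sequentially. hnorm H (u n - v) \<le> inverse (real (Suc n))"
      using uv by (simp add: hnorm_diff_commute[OF uH vH] inverse_eq_divide less_imp_le)
  qed (simp add: uH vH)
  have "\<exists>N. \<forall>m\<ge>N. \<forall>n\<ge>N. hnorm H (u m - u n) < e" if e: "0 < e" for e
  proof -
    obtain N where N: "\<And>n. n \<ge> N \<Longrightarrow> hnorm H (u n - v) < e / 2"
      using LIMSEQ_D[OF lim, of "e / 2"] e uH vH by fastforce
    have "hnorm H (u m - u n) < e" if "m \<ge> N" "n \<ge> N" for m n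
      using hnorm_triangle_diff[OF uH vH uH, of m n] N[OF that(1)] N[OF that(2)]
        hnorm_diff_commute[OF uH vH, of n] by linarith
    then show ?thesis by blast
  qed
  with u uH lim that show thesis by blast
qed

end

section \<open>Riesz representation, projections and total sets\<close>

context hilbert_space
begin

lemma inner_ext:
  assumes "x \<in> hcarrier H" "y \<in> hcarrier H"
    "\<And>g. g \<in> hcarrier H \<Longrightarrow> hinner H g x = hinner H g y"
  shows "x = y"
proof -
  have "hinner H (x - y) (x - y) = 0"
    using assms by (simp add: inner_diff_right)
  then show ?thesis using hinner_definite[of "x - y"] assms by simp
qed

lemma inner_ext_left:
  assumes "x \<in> hcarrier H" "y \<in> hcarrier H"
    "\<And>g. g \<in> hcarrier H \<Longrightarrow> hinner H x g = hinner H y g"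
  shows "x = y"
  using assms(1,2)
proof (rule inner_ext)
  show "hinner H g x = hinner H g y" if "g \<in> hcarrier H" for g
    using assms that inner_commute by metis
qed

lemma Riesz:
  assumes "\<And>x y. x \<in> hcarrier H \<Longrightarrow> y \<in> hcarrier H \<Longrightarrow> f (x + y) = f x + f y"
    and "\<And>c x. x \<in> hcarrier H \<Longrightarrow> f (c *\<^sub>C x) = c * f x"
    and "\<And>x. x \<in> hcarrier H \<Longrightarrow> cmod (f x) \<le> C * hnorm H x"
  obtains l where "l \<in> hcarrier H" "\<And>g. g \<in> hcarrier H \<Longrightarrow> hinner H l g = f g"
proof -
  obtain u where u: "\<And>n. u n \<in> hcarrier H"
    "\<forall>e>0. \<exists>N. \<forall>m\<ge>N. \<forall>n\<ge>N. hnorm H (u m - u n) < e"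
    and f: "\<And>g. g \<in> hcarrier H \<Longrightarrow> (\<lambda>n. hinner H (u n) g) \<longlonglongrightarrow> f g"
    using Riesz_approximation[of f, OF assms] by blast
  then obtain l where l: "l \<in> hcarrier H" "(\<lambda>n. hnorm H (u n - l)) \<longlonglongrightarrow> 0"
    using hcomplete[of u] by blast
  have "hinner H l g = f g" if "g \<in> hcarrier H" for g
    by (rule LIMSEQ_unique[OF tendsto_inner_left[OF u(1) l(1) that l(2)] f[OF that]])
  with l(1) show thesis by (rule that)
qed

lemma hcomplete_hclosed_span:
  assumes Y: "Y \<subseteq> hcarrier H"
  shows "hilbert_space \<lparr>hcarrier = hclosed_span H Y, hinner = hinner H\<rparr>"
    (is "hilbert_space ?K")
proof -
  have sub: "x \<in> hcarrier H" if "x \<in> hclosed_span H Y" for x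
    using that by (simp add: hclosed_span_def)
  have approx: "\<exists>u\<in>module.span scaleC Y. hnorm H (x - u) < e"
    if "x \<in> hclosed_span H Y" "0 < e" for x e
    using that by (simp add: hclosed_span_def)
  have nrm: "hnorm ?K x = hnorm H x" for x by (simp add: hnorm_def)
  show ?thesis
  proof
    have "0 \<in> hclosed_span H Y"
      unfolding hclosed_span_def by (auto intro!: bexI[of _ 0] scaleC_module.span_zero)
    moreover have "x + y \<in> hclosed_span H Y" if x: "x \<in> hclosed_span H Y" and y: "y \<in> hclosed_span H Y" for x y
      unfolding hclosed_span_def
    proof safe
      show "x + y \<in> hcarrier H" using sub[OF x] sub[OF y] by auto
      fix e :: real assume "0 < e"
      then have e: "0 < e / 2" by simp
      obtain u where u: "u \<in> module.span scaleC Y" "hnorm H (x - u) < e / 2"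
        using approx[OF x e] by blast
      obtain v where v: "v \<in> module.span scaleC Y" "hnorm H (y - v) < e / 2"
        using approx[OF y e] by blast
      have "hnorm H ((x - u) + (y - v)) \<le> hnorm H (x - u) + hnorm H (y - v)"
        using sub[OF x] sub[OF y] span_mem[OF Y u(1)] span_mem[OF Y v(1)] by (intro hnorm_triangle) auto
      then have "hnorm H (x + y - (u + v)) < e" using u v by (simp add: algebra_simps)
      then show "\<exists>u\<in>module.span scaleC Y. hnorm H (x + y - u) < e"
        using scaleC_module.span_add[OF u(1) v(1)] by blast
    qed
    moreover have "c *\<^sub>C x \<in> hclosed_span H Y" if x: "x \<in> hclosed_span H Y" for c x
      unfolding hclosed_span_def
    proof safe
      show "c *\<^sub>C x \<in> hcarrier H" using sub[OF x] by auto
      fix e :: real assume e: "0 < e"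
      then have "0 < e / (cmod c + 1)" by (simp add: add_nonneg_pos)
      then obtain u where u: "u \<in> module.span scaleC Y" "hnorm H (x - u) < e / (cmod c + 1)"
        using x unfolding hclosed_span_def by blast
      have xu: "x - u \<in> hcarrier H" using sub[OF x] span_mem[OF Y u(1)] by auto
      have "hnorm H (c *\<^sub>C x - c *\<^sub>C u) = cmod c * hnorm H (x - u)"
        using hnorm_scaleC[OF xu, of c] by (simp add: scaleC_module.scale_right_diff_distrib)
      also have "\<dots> \<le> (cmod c + 1) * hnorm H (x - u)"
        using xu by (intro mult_right_mono) auto
      also have "\<dots> < e" using u(2) by (simp add: pos_less_divide_eq add_nonneg_pos mult.commute)
      finally show "\<exists>u\<in>module.span scaleC Y. hnorm H (c *\<^sub>C x - u) < e"
        using scaleC_module.span_scale[OF u(1)] by blast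
    qed
    ultimately show "module.subspace scaleC (hcarrier ?K)"
      by (auto intro!: scaleC_module.subspaceI)
    fix s :: "nat \<Rightarrow> 'v" assume s: "\<forall>n. s n \<in> hcarrier ?K"
      and cau: "\<forall>e>0. \<exists>N. \<forall>m\<ge>N. \<forall>n\<ge>N. hnorm ?K (s m - s n) < e"
    have sH: "s n \<in> hcarrier H" for n using s sub by simp
    obtain l where l: "l \<in> hcarrier H" and lim: "(\<lambda>n. hnorm H (s n - l)) \<longlonglongrightarrow> 0"
      using hcomplete[of s] sH cau unfolding nrm by blast
    have "\<exists>u\<in>module.span scaleC Y. hnorm H (l - u) < e" if e: "0 < e" for e
    proof -
      obtain n where n: "hnorm H (s n - l) < e / 2"
        using LIMSEQ_D[OF lim, of "e / 2"] e sH l by fastforce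
      obtain u where u: "u \<in> module.span scaleC Y" "hnorm H (s n - u) < e / 2"
        using approx[of "s n" "e / 2"] s e by auto
      have "hnorm H (l - u) < e"
        using hnorm_triangle_diff[OF l sH span_mem[OF Y u(1)], of n] u n
          hnorm_diff_commute[OF sH l, of n] by linarith
      with u(1) show ?thesis by blast
    qed
    then have "l \<in> hclosed_span H Y" using l by (simp add: hclosed_span_def)
    then show "\<exists>l\<in>hcarrier ?K. (\<lambda>n. hnorm ?K (s n - l)) \<longlonglongrightarrow> 0"
      using lim unfolding nrm by auto
  qed (auto dest!: sub simp: inner_add_right inner_scaleC_right inner_nonneg hinner_definite
        intro: inner_commute)
qed

lemma projection_exists:
  assumes K: "hilbert_space K" and sub: "hcarrier K \<subseteq> hcarrier H" and ip: "hinner K = hinner H"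
    and k: "k \<in> hcarrier H"
  obtains p where "p \<in> hcarrier K" "\<And>g. g \<in> hcarrier K \<Longrightarrow> hinner H p g = hinner H k g"
proof -
  interpret K: hilbert_space K by fact
  have nrm: "hnorm K x = hnorm H x" for x by (simp add: hnorm_def ip)
  obtain p where "p \<in> hcarrier K" "\<And>g. g \<in> hcarrier K \<Longrightarrow> hinner K p g = hinner H k g"
  proof (rule K.Riesz[of "hinner H k" "hnorm H k"])
    show "cmod (hinner H k x) \<le> hnorm H k * hnorm K x" if "x \<in> hcarrier K" for x
      unfolding nrm using that sub k by (intro Cauchy_Schwarz) auto
  qed (use sub k in \<open>auto simp: inner_add_right inner_scaleC_right subset_iff\<close>)
  then show thesis using that ip by auto
qed

text \<open>The difference between \<open>v\<close> and its projection onto the closed span is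
  orthogonal to \<open>Y\<close>.\<close>

lemma hclosed_span_eq_carrierI:
  assumes Y: "Y \<subseteq> hcarrier H"
    and tot: "\<And>v. v \<in> hcarrier H \<Longrightarrow> (\<And>y. y \<in> Y \<Longrightarrow> hinner H y v = 0) \<Longrightarrow> v = 0"
  shows "hclosed_span H Y = hcarrier H"
proof
  show "hcarrier H \<subseteq> hclosed_span H Y"
  proof
    fix v assume v: "v \<in> hcarrier H"
    obtain p where p: "p \<in> hclosed_span H Y"
      and pv: "\<And>g. g \<in> hclosed_span H Y \<Longrightarrow> hinner H p g = hinner H v g"
      by (rule projection_exists[OF hcomplete_hclosed_span[OF Y] _ _ v])
         (auto simp: hclosed_span_def)
    have pH: "p \<in> hcarrier H" using p by (simp add: hclosed_span_def)
    have "v - p = 0"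
    proof (rule tot)
      show "v - p \<in> hcarrier H" using v pH by auto
      fix y assume y: "y \<in> Y"
      then have yH: "y \<in> hcarrier H" and ys: "y \<in> hclosed_span H Y"
        using Y subset_hclosed_span[OF Y] by auto
      have "hinner H (v - p) y = 0" using pv[OF ys] v pH yH by (simp add: inner_diff_left)
      then show "hinner H y (v - p) = 0" using inner_commute[of "v - p" y] v pH yH by simp
    qed
    then show "v \<in> hclosed_span H Y" using p by simp
  qed
qed (auto simp: hclosed_span_def)

lemma total_of_hclosed_span:
  assumes Y: "Y \<subseteq> hcarrier H" and full: "hclosed_span H Y = hcarrier H"
    and v: "v \<in> hcarrier H" and orth: "\<And>y. y \<in> Y \<Longrightarrow> hinner H y v = 0"
  shows "v = 0"
proof -
  obtain u where u: "\<And>n. u n \<in> module.span scaleC Y" "\<And>n. u n \<in> hcarrier H"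
    "(\<lambda>n. hnorm H (u n - v)) \<longlonglongrightarrow> 0"
    using hclosed_span_sequence[OF Y] v full by metis
  have "module.span scaleC Y \<subseteq> {x \<in> hcarrier H. hinner H x v = 0}"
    using Y v orth
    by (intro scaleC_module.span_minimal scaleC_module.subspaceI)
       (auto simp: inner_add_left inner_scaleC_left)
  then have z: "hinner H x v = 0" if "x \<in> module.span scaleC Y" for x
    using that by auto
  have "(\<lambda>n. hinner H (u n) v) \<longlonglongrightarrow> hinner H v v"
    by (rule tendsto_inner_left) (use u v in auto)
  then have "hinner H v v = 0" using z[OF u(1)] by (simp add: LIMSEQ_const_iff)
  then show ?thesis using hinner_definite v by blast
qed

end

section \<open>Bounded operators and their adjoints\<close>

lemma bounded_opsI:
  assumes "\<And>x. x \<in> hcarrier H \<Longrightarrow> T x \<in> hcarrier K"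
    and "\<And>x y. x \<in> hcarrier H \<Longrightarrow> y \<in> hcarrier H \<Longrightarrow> T (x + y) = T x + T y"
    and "\<And>c x. x \<in> hcarrier H \<Longrightarrow> T (c *\<^sub>C x) = c *\<^sub>C T x"
    and "\<And>x. x \<in> hcarrier H \<Longrightarrow> hnorm K (T x) \<le> C * hnorm H x"
  shows "T \<in> bounded_ops H K"
  using assms unfolding bounded_ops_def by blast

lemma bounded_opsD:
  assumes "T \<in> bounded_ops H K"
  shows "x \<in> hcarrier H \<Longrightarrow> T x \<in> hcarrier K"
    and "x \<in> hcarrier H \<Longrightarrow> y \<in> hcarrier H \<Longrightarrow> T (x + y) = T x + T y"
    and "x \<in> hcarrier H \<Longrightarrow> T (c *\<^sub>C x) = c *\<^sub>C T x"
  using assms by (auto simp: bounded_ops_def)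

lemma bounded_ops_bound:
  assumes "T \<in> bounded_ops H K" "hilbert_space H"
  obtains C where "0 \<le> C" "\<And>x. x \<in> hcarrier H \<Longrightarrow> hnorm K (T x) \<le> C * hnorm H x"
proof -
  interpret H: hilbert_space H by fact
  obtain C where C: "\<And>x. x \<in> hcarrier H \<Longrightarrow> hnorm K (T x) \<le> C * hnorm H x"
    using assms(1) unfolding bounded_ops_def by blast
  show thesis
  proof (rule that[of "\<bar>C\<bar>"])
    show "hnorm K (T x) \<le> \<bar>C\<bar> * hnorm H x" if "x \<in> hcarrier H" for x
      by (rule order_trans[OF C[OF that]]) (use that in \<open>auto intro: mult_right_mono\<close>)
  qed simp
qed

locale hilbert_pair = H: hilbert_space H + K: hilbert_space K
  for H :: "'v::complex_vector hilbert" and K :: "'w::complex_vector hilbert"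
begin

lemma hadj_unique:
  assumes "h \<in> hcarrier H" "\<And>g. g \<in> hcarrier H \<Longrightarrow> hinner H h g = hinner K k (T g)"
  shows "hadj H K T k = h"
  unfolding hadj_def
proof (rule the_equality)
  fix h' assume "h' \<in> hcarrier H \<and> (\<forall>g\<in>hcarrier H. hinner H h' g = hinner K k (T g))"
  then show "h' = h" using assms by (intro H.inner_ext_left) auto
qed (use assms in auto)

lemma hadj:
  assumes T: "T \<in> bounded_ops H K" and k: "k \<in> hcarrier K"
  shows hadj_mem: "hadj H K T k \<in> hcarrier H"
    and hadj_inner: "g \<in> hcarrier H \<Longrightarrow> hinner H (hadj H K T k) g = hinner K k (T g)"
proof -
  note TD = bounded_opsD[OF T]
  obtain C where C: "\<And>x. x \<in> hcarrier H \<Longrightarrow> hnorm K (T x) \<le> C * hnorm H x"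
    using bounded_ops_bound[OF T H.hilbert_space_axioms] by blast
  obtain h where h: "h \<in> hcarrier H" "\<And>g. g \<in> hcarrier H \<Longrightarrow> hinner H h g = hinner K k (T g)"
  proof (rule H.Riesz[of "\<lambda>g. hinner K k (T g)" "hnorm K k * C"])
    show "cmod (hinner K k (T x)) \<le> hnorm K k * C * hnorm H x" if "x \<in> hcarrier H" for x
    proof -
      have "cmod (hinner K k (T x)) \<le> hnorm K k * hnorm K (T x)"
        using that k TD by (intro K.Cauchy_Schwarz) auto
      also have "\<dots> \<le> hnorm K k * (C * hnorm H x)"
        using that k C by (intro mult_left_mono) auto
      finally show ?thesis by (simp add: mult.assoc)
    qed
  qed (use k TD in \<open>auto simp: K.inner_add_right K.inner_scaleC_right\<close>)
  have "hadj H K T k = h" by (rule hadj_unique) (use h in auto)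
  then show "hadj H K T k \<in> hcarrier H"
    "g \<in> hcarrier H \<Longrightarrow> hinner H (hadj H K T k) g = hinner K k (T g)" using h by auto
qed

lemma hadj_inner_right:
  assumes T: "T \<in> bounded_ops H K" and k: "k \<in> hcarrier K" and g: "g \<in> hcarrier H"
  shows "hinner H g (hadj H K T k) = hinner K (T g) k"
  using hadj_inner[OF T k g] H.inner_commute[OF hadj_mem[OF T k] g]
    K.inner_commute[OF k bounded_opsD(1)[OF T g]] by simp

lemma hadj_bounded_ops:
  assumes T: "T \<in> bounded_ops H K"
  shows "hadj H K T \<in> bounded_ops K H"
proof -
  note TD = bounded_opsD[OF T]
  note adj = hadj_mem[OF T] hadj_inner[OF T]
  obtain C where C: "0 \<le> C" "\<And>x. x \<in> hcarrier H \<Longrightarrow> hnorm K (T x) \<le> C * hnorm H x"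
    using bounded_ops_bound[OF T H.hilbert_space_axioms] by blast
  have "hadj H K T (x + y) = hadj H K T x + hadj H K T y"
    if "x \<in> hcarrier K" "y \<in> hcarrier K" for x y
    by (rule hadj_unique) (use that adj TD in \<open>auto simp: H.inner_add_left K.inner_add_left\<close>)
  moreover have "hadj H K T (c *\<^sub>C x) = c *\<^sub>C hadj H K T x" if "x \<in> hcarrier K" for c x
    by (rule hadj_unique) (use that adj TD in \<open>auto simp: H.inner_scaleC_left K.inner_scaleC_left\<close>)
  moreover have "hnorm H (hadj H K T x) \<le> C * hnorm K x" if x: "x \<in> hcarrier K" for x
  proof -
    let ?y = "hadj H K T x"
    have y: "?y \<in> hcarrier H" using adj x by blast
    have "(hnorm H ?y)\<^sup>2 = Re (hinner K x (T ?y))"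
      using adj(2)[OF x y] by (simp add: H.hnorm_sq[OF y])
    also have "\<dots> \<le> hnorm K x * hnorm K (T ?y)"
      using K.Cauchy_Schwarz[OF x TD(1)[OF y]] complex_Re_le_cmod order_trans by blast
    also have "\<dots> \<le> hnorm K x * (C * hnorm H ?y)"
      using C(2)[OF y] x by (intro mult_left_mono) auto
    finally have *: "hnorm H ?y * hnorm H ?y \<le> (C * hnorm K x) * hnorm H ?y"
      by (simp add: power2_eq_square mult_ac)
    show ?thesis
    proof (cases "hnorm H ?y = 0")
      case True then show ?thesis using C(1) x by simp
    next
      case False
      then have "0 < hnorm H ?y" using H.hnorm_nonneg[OF y] by linarith
      then show ?thesis using * by (simp add: mult_le_cancel_right)
    qed
  qed
  ultimately show ?thesis using adj(1) unfolding bounded_ops_def by blast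
qed

lemma hadj_hadj:
  assumes T: "T \<in> bounded_ops H K" and g: "g \<in> hcarrier H"
  shows "hadj K H (hadj H K T) g = T g"
proof -
  interpret KH: hilbert_pair K H by unfold_locales
  show ?thesis
  proof (rule KH.hadj_unique)
    show "T g \<in> hcarrier K" using bounded_opsD[OF T] g by blast
    show "hinner K (T g) k = hinner H g (hadj H K T k)" if "k \<in> hcarrier K" for k
      using hadj_inner_right[OF T that g] by simp
  qed
qed

lemma isometry_unitary_op:
  assumes add: "\<And>x y. x \<in> hcarrier H \<Longrightarrow> y \<in> hcarrier H \<Longrightarrow> U (x + y) = U x + U y"
    and scale: "\<And>c x. x \<in> hcarrier H \<Longrightarrow> U (c *\<^sub>C x) = c *\<^sub>C U x"
    and mem: "\<And>x. x \<in> hcarrier H \<Longrightarrow> U x \<in> hcarrier K"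
    and iso: "\<And>x y. x \<in> hcarrier H \<Longrightarrow> y \<in> hcarrier H \<Longrightarrow> hinner K (U x) (U y) = hinner H x y"
    and surj: "\<And>k. k \<in> hcarrier K \<Longrightarrow> \<exists>h\<in>hcarrier H. U h = k"
  shows "unitary_op H K U"
proof -
  have "hnorm K (U x) \<le> 1 * hnorm H x" if "x \<in> hcarrier H" for x
    using that by (simp add: hnorm_def iso)
  then have "U \<in> bounded_ops H K"
    using add scale mem unfolding bounded_ops_def by blast
  moreover have adj: "hadj H K U (U h) = h" if "h \<in> hcarrier H" for h
    by (rule hadj_unique) (use that iso in auto)
  moreover have "U (hadj H K U k) = k" if "k \<in> hcarrier K" for k
    using surj[OF that] adj by metis
  ultimately show ?thesis unfolding unitary_op_def by blast
qed

end

section \<open>The Hilbert space of a positive definite kernel\<close>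

lemma scaleC_fun_apply: "(a *\<^sub>C f) s = a * (f s :: complex)"
  by (simp add: scaleC_fun_def scaleC_complex_def)

locale positive_kernel =
  fixes S :: "'s set" and k :: "'s \<Rightarrow> 's \<Rightarrow> complex"
  assumes kernel_commute: "s \<in> S \<Longrightarrow> t \<in> S \<Longrightarrow> k t s = cnj (k s t)"
    and kernel_nonneg: "\<lbrakk>finite T; T \<subseteq> S\<rbrakk> \<Longrightarrow>
      0 \<le> Re (\<Sum>s\<in>T. \<Sum>t\<in>T. cnj (c s) * c t * k s t)"
begin

abbreviation supp :: "('s \<Rightarrow> complex) \<Rightarrow> 's set" where "supp c \<equiv> {s. c s \<noteq> 0}"

text \<open>The free vector space on \<open>S\<close> under the kernel form. The form may be
  degenerate; null vectors disappear only under \<open>ev\<close>.\<close>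

definition F :: "('s \<Rightarrow> complex) hilbert" where
  "F = \<lparr>hcarrier = {c. finite (supp c) \<and> supp c \<subseteq> S},
    hinner = \<lambda>c d. \<Sum>s\<in>supp c. \<Sum>t\<in>supp d. cnj (c s) * d t * k s t\<rparr>"

text \<open>On \<open>S\<close> the value is the product of \<open>delta s\<close> with
  \<open>c\<close>. Two vectors of \<open>F\<close> have the same image exactly if they differ by a
  null vector, so this plays the part of the quotient map. The value 0 outside \<open>S\<close>
  makes the image determined by its values on \<open>S\<close>.\<close>

definition ev :: "('s \<Rightarrow> complex) \<Rightarrow> 's \<Rightarrow> complex" where
  "ev c s = (if s \<in> S then \<Sum>t\<in>supp c. c t * k s t else 0)"

definition delta :: "'s \<Rightarrow> 's \<Rightarrow> complex" where "delta s = (\<lambda>t. if t = s then 1 else 0)"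

lemma F_mem: "c \<in> hcarrier F \<longleftrightarrow> finite (supp c) \<and> supp c \<subseteq> S"
  by (simp add: F_def)

lemma F_inner_eq:
  assumes "finite A" "finite B" "supp c \<subseteq> A" "supp d \<subseteq> B"
  shows "hinner F c d = (\<Sum>s\<in>A. \<Sum>t\<in>B. cnj (c s) * d t * k s t)"
proof -
  have "hinner F c d = (\<Sum>s\<in>supp c. \<Sum>t\<in>B. cnj (c s) * d t * k s t)"
    unfolding F_def hilbert.select_convs
    by (intro sum.cong refl sum.mono_neutral_left) (use assms in auto)
  also have "\<dots> = (\<Sum>s\<in>A. \<Sum>t\<in>B. cnj (c s) * d t * k s t)"
    by (intro sum.mono_neutral_left) (use assms in auto)
  finally show ?thesis .
qed

lemma semi_inner_F: "semi_inner_space F"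
proof
  show "module.subspace scaleC (hcarrier F)"
  proof (rule scaleC_module.subspaceI)
    show "0 \<in> hcarrier F" by (simp add: F_mem)
    show "c + d \<in> hcarrier F" if "c \<in> hcarrier F" "d \<in> hcarrier F" for c d
    proof -
      have "supp (c + d) \<subseteq> supp c \<union> supp d" by auto
      then show ?thesis using that unfolding F_mem by (auto intro: finite_subset)
    qed
    show "a *\<^sub>C c \<in> hcarrier F" if "c \<in> hcarrier F" for a c
    proof -
      have "supp (a *\<^sub>C c) \<subseteq> supp c" by (auto simp: scaleC_fun_def scaleC_complex_def)
      then show ?thesis using that unfolding F_mem by (auto intro: finite_subset)
    qed
  qed
next
  fix c d e assume m: "c \<in> hcarrier F" "d \<in> hcarrier F" "e \<in> hcarrier F"
  let ?A = "supp c" and ?B = "supp d \<union> supp e"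
  have fin: "finite ?A" "finite ?B" using m by (auto simp: F_mem)
  have "supp (d + e) \<subseteq> ?B" by auto
  then show "hinner F c (d + e) = hinner F c d + hinner F c e"
    using fin by (simp add: F_inner_eq[of ?A ?B] algebra_simps sum.distrib)
next
  fix c d a assume m: "c \<in> hcarrier F" "d \<in> hcarrier F"
  have "supp (a *\<^sub>C d) \<subseteq> supp d" by (auto simp: scaleC_fun_def scaleC_complex_def)
  then show "hinner F c (a *\<^sub>C d) = a * hinner F c d"
    using m by (simp add: F_mem F_inner_eq[of "supp c" "supp d"] sum_distrib_left
        scaleC_fun_def scaleC_complex_def mult_ac)
next
  fix c d assume m: "c \<in> hcarrier F" "d \<in> hcarrier F"
  have "hinner F d c = (\<Sum>s\<in>supp c. \<Sum>t\<in>supp d. cnj (d t) * c s * k t s)"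
    unfolding F_def hilbert.select_convs by (rule sum.swap)
  also have "\<dots> = (\<Sum>s\<in>supp c. \<Sum>t\<in>supp d. cnj (cnj (c s) * d t * k s t))"
  proof (intro sum.cong refl)
    fix s t assume "s \<in> supp c" "t \<in> supp d"
    then have "k t s = cnj (k s t)" using m by (intro kernel_commute) (auto simp: F_mem)
    then show "cnj (d t) * c s * k t s = cnj (cnj (c s) * d t * k s t)" by simp
  qed
  finally show "hinner F d c = cnj (hinner F c d)" by (simp add: F_def)
next
  fix c assume "c \<in> hcarrier F"
  then show "0 \<le> Re (hinner F c c)"
    unfolding F_def hilbert.select_convs by (intro kernel_nonneg) auto
qed

sublocale F: semi_inner_space F
  by (rule semi_inner_F)

lemma delta_mem: "s \<in> S \<Longrightarrow> delta s \<in> hcarrier F"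
proof -
  have "supp (delta s) = {s}" by (auto simp: delta_def)
  then show "s \<in> S \<Longrightarrow> delta s \<in> hcarrier F" by (simp add: F_mem)
qed

lemma ev_eq: "s \<in> S \<Longrightarrow> ev c s = hinner F (delta s) c"
proof -
  have "supp (delta s) = {s}" by (auto simp: delta_def)
  then show "s \<in> S \<Longrightarrow> ev c s = hinner F (delta s) c" by (simp add: F_def ev_def delta_def)
qed

lemma ev_outside: "s \<notin> S \<Longrightarrow> ev c s = 0"
  by (simp add: ev_def)

lemma F_inner_ev: "c \<in> hcarrier F \<Longrightarrow> hinner F c d = (\<Sum>s\<in>supp c. cnj (c s) * ev d s)"
  unfolding F_def hilbert.select_convs
  by (intro sum.cong refl) (auto simp: ev_def F_mem sum_distrib_left mult.assoc)

lemma ev_add: "c \<in> hcarrier F \<Longrightarrow> d \<in> hcarrier F \<Longrightarrow> ev (c + d) s = ev c s + ev d s"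
  by (cases "s \<in> S") (simp_all add: ev_eq ev_outside delta_mem F.inner_add_right)

lemma ev_scaleC: "c \<in> hcarrier F \<Longrightarrow> ev (a *\<^sub>C c) s = a * ev c s"
  by (cases "s \<in> S") (simp_all add: ev_eq ev_outside delta_mem F.inner_scaleC_right)

lemma ev_diff: "c \<in> hcarrier F \<Longrightarrow> d \<in> hcarrier F \<Longrightarrow> ev (c - d) s = ev c s - ev d s"
  by (cases "s \<in> S") (simp_all add: ev_eq ev_outside delta_mem F.inner_diff_right)

text \<open>In place of a class of Cauchy sequences, an element of the completion is the pointwise
  limit of the embedded sequence.\<close>

definition represents :: "(nat \<Rightarrow> 's \<Rightarrow> complex) \<Rightarrow> ('s \<Rightarrow> complex) \<Rightarrow> bool" where
  "represents u v \<longleftrightarrow> (\<forall>n. u n \<in> hcarrier F) \<and>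
    (\<forall>e>0. \<exists>N. \<forall>m\<ge>N. \<forall>n\<ge>N. hnorm F (u m - u n) < e) \<and>
    (\<forall>s. (\<lambda>n. ev (u n) s) \<longlonglongrightarrow> v s)"

lemma representsD:
  assumes "represents u v"
  shows "\<And>n. u n \<in> hcarrier F" "\<forall>e>0. \<exists>N. \<forall>m\<ge>N. \<forall>n\<ge>N. hnorm F (u m - u n) < e"
    "\<And>s. (\<lambda>n. ev (u n) s) \<longlonglongrightarrow> v s"
  using assms by (auto simp: represents_def)

lemma represents_add:
  assumes "represents u v" "represents w x"
  shows "represents (\<lambda>n. u n + w n) (v + x)"
  using representsD[OF assms(1)] representsD[OF assms(2)] F.Cauchy_add[of u w]
  by (auto simp: represents_def ev_add intro!: tendsto_add)

lemma represents_scaleC: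
  assumes "represents u v"
  shows "represents (\<lambda>n. a *\<^sub>C u n) (a *\<^sub>C v)"
  using representsD[OF assms] F.Cauchy_scaleC[of u a]
  unfolding represents_def
  by (auto simp: ev_scaleC scaleC_fun_apply intro!: tendsto_mult)

lemma represents_const: "c \<in> hcarrier F \<Longrightarrow> represents (\<lambda>_. c) (ev c)"
  by (simp add: represents_def)

lemma represents_diff:
  assumes "represents u v" "represents w x"
  shows "represents (\<lambda>n. u n - w n) (v - x)"
  using represents_add[OF assms(1) represents_scaleC[OF assms(2), of "-1"]]
  by (simp add: scaleC_minus1)

text \<open>This makes the inner product of limit functions well defined. For fixed N the product of
  \<open>u N\<close> with \<open>u n\<close> is a finite combination of values of
  \<open>ev (u n)\<close> and tends to 0, while u n - u N is small for all n beyond N.\<close>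

lemma represents_zero_hnorm:
  assumes u: "represents u 0"
  shows "(\<lambda>n. hnorm F (u n)) \<longlonglongrightarrow> 0"
proof -
  note uD = representsD[OF u]
  obtain B where B: "0 < B" "\<And>n. hnorm F (u n) \<le> B"
    using F.hnorm_bounded_of_Cauchy[OF uD(1,2)] by blast
  have w: "(\<lambda>n. hinner F c (u n)) \<longlonglongrightarrow> 0" if "c \<in> hcarrier F" for c
  proof -
    have "(\<lambda>n. \<Sum>s\<in>supp c. cnj (c s) * ev (u n) s) \<longlonglongrightarrow> (\<Sum>s\<in>supp c. cnj (c s) * 0 s)"
      by (intro tendsto_intros uD(3))
    then show ?thesis using that by (simp add: F_inner_ev)
  qed
  have "(\<lambda>n. (hnorm F (u n))\<^sup>2) \<longlonglongrightarrow> 0"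
  proof (rule LIMSEQ_I)
    fix r :: real assume r: "0 < r"
    then have "0 < r / (2 * B)" using B by simp
    then obtain N where N: "\<And>m n. m \<ge> N \<Longrightarrow> n \<ge> N \<Longrightarrow> hnorm F (u m - u n) < r / (2 * B)"
      using uD(2) by meson
    obtain M where M: "\<And>n. n \<ge> M \<Longrightarrow> cmod (hinner F (u N) (u n)) < r / 2"
      using LIMSEQ_D[OF w[OF uD(1)[of N]], of "r / 2"] r by auto
    have "(hnorm F (u n))\<^sup>2 < r" if n: "n \<ge> max M N" for n
    proof -
      have "hinner F (u n) (u n) = hinner F (u n - u N) (u n) + hinner F (u N) (u n)"
        using uD(1) by (simp add: F.inner_diff_left)
      then have "(hnorm F (u n))\<^sup>2 = Re (hinner F (u n - u N) (u n)) + Re (hinner F (u N) (u n))"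
        using uD(1) by (simp add: F.hnorm_sq)
      also have "\<dots> \<le> cmod (hinner F (u n - u N) (u n)) + cmod (hinner F (u N) (u n))"
        by (intro add_mono complex_Re_le_cmod)
      also have "cmod (hinner F (u n - u N) (u n)) \<le> hnorm F (u n - u N) * hnorm F (u n)"
        using uD(1) by (intro F.Cauchy_Schwarz) auto
      also have "\<dots> \<le> r / (2 * B) * B"
        using N[of n N] n B uD(1) r by (intro mult_mono) auto
      finally show ?thesis using M[of n] n B(1) by simp
    qed
    then show "\<exists>no. \<forall>n\<ge>no. norm ((hnorm F (u n))\<^sup>2 - 0) < r"
      by (intro exI[of _ "max M N"]) simp
  qed
  then show ?thesis
    using tendsto_real_sqrt[of "\<lambda>n. (hnorm F (u n))\<^sup>2" 0] uD(1) by simp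
qed

text \<open>The reproducing kernel Hilbert space. Its inner product is taken along chosen
  representing sequences; \<open>E_inner\<close> shows that every other choice has the same
  limit.\<close>

definition E :: "('s \<Rightarrow> complex) hilbert" where
  "E = \<lparr>hcarrier = {v. \<exists>u. represents u v},
    hinner = \<lambda>v w. lim (\<lambda>n. hinner F ((SOME u. represents u v) n) ((SOME u. represents u w) n))\<rparr>"

lemma E_memI: "represents u v \<Longrightarrow> v \<in> hcarrier E"
  by (auto simp: E_def)

lemma E_memE: assumes "v \<in> hcarrier E" obtains u where "represents u v"
  using assms by (auto simp: E_def)

lemma E_inner:
  assumes uv: "represents u v" and wx: "represents w x"
  shows "(\<lambda>n. hinner F (u n) (w n)) \<longlonglongrightarrow> hinner E v x"
proof -
  let ?u = "SOME u. represents u v" and ?w = "SOME u. represents u x"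
  have u': "represents ?u v" by (rule someI[of "\<lambda>u. represents u v", OF uv])
  have w': "represents ?w x" by (rule someI[of "\<lambda>u. represents u x", OF wx])
  note D = representsD[OF uv] and D' = representsD[OF u'] and G = representsD[OF wx]
    and G' = representsD[OF w']
  have lim: "(\<lambda>n. hinner F (?u n) (?w n)) \<longlonglongrightarrow> hinner E v x"
    using F.convergent_inner_of_Cauchy[OF D'(1,2) G'(1,2)]
    by (simp add: E_def convergent_LIMSEQ_iff)
  have 1: "(\<lambda>n. hnorm F (u n - ?u n)) \<longlonglongrightarrow> 0" and 2: "(\<lambda>n. hnorm F (w n - ?w n)) \<longlonglongrightarrow> 0"
    using represents_zero_hnorm represents_diff[OF uv u'] represents_diff[OF wx w'] by auto
  obtain A where A: "0 < A" "\<And>n. hnorm F (?u n) \<le> A" using F.hnorm_bounded_of_Cauchy[OF D'(1,2)] by blast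
  obtain B where B: "0 < B" "\<And>n. hnorm F (w n) \<le> B" using F.hnorm_bounded_of_Cauchy[OF G(1,2)] by blast
  have "(\<lambda>n. hinner F (u n) (w n) - hinner F (?u n) (?w n)) \<longlonglongrightarrow> 0"
  proof (rule Lim_null_comparison)
    show "(\<lambda>n. hnorm F (u n - ?u n) * B + A * hnorm F (w n - ?w n)) \<longlonglongrightarrow> 0"
      using tendsto_add[OF tendsto_mult_right[OF 1, of B] tendsto_mult_left[OF 2, of A]] by simp
    show "\<forall>\<^sub>F n in sequentially. norm (hinner F (u n) (w n) - hinner F (?u n) (?w n))
        \<le> hnorm F (u n - ?u n) * B + A * hnorm F (w n - ?w n)"
    proof (rule always_eventually, rule allI)
      fix n
      show "norm (hinner F (u n) (w n) - hinner F (?u n) (?w n))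
        \<le> hnorm F (u n - ?u n) * B + A * hnorm F (w n - ?w n)"
        by (rule order_trans[OF F.inner_diff_bound[OF D(1) D'(1) G(1) G'(1)]])
           (intro add_mono mult_left_mono mult_right_mono A B F.hnorm_nonneg F.diff_mem D D' G G')
    qed
  qed
  from tendsto_add[OF this lim] show ?thesis by simp
qed

lemma semi_inner_E: "semi_inner_space E"
proof
  show "module.subspace scaleC (hcarrier E)"
  proof (rule scaleC_module.subspaceI)
    have "ev 0 = 0" by (simp add: fun_eq_iff ev_def)
    then show "0 \<in> hcarrier E" using E_memI[OF represents_const[of 0]] by simp
  qed (auto elim!: E_memE intro: E_memI dest: represents_add represents_scaleC)
next
  fix x y z assume "x \<in> hcarrier E" "y \<in> hcarrier E" "z \<in> hcarrier E"
  then obtain u v w where u: "represents u x" and v: "represents v y" and w: "represents w z"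
    by (auto elim!: E_memE)
  have "(\<lambda>n. hinner F (u n) (v n + w n)) \<longlonglongrightarrow> hinner E x y + hinner E x z"
    using tendsto_add[OF E_inner[OF u v] E_inner[OF u w]] representsD(1)[OF u] representsD(1)[OF v]
      representsD(1)[OF w] by (simp add: F.inner_add_right)
  then show "hinner E x (y + z) = hinner E x y + hinner E x z"
    by (rule LIMSEQ_unique[OF E_inner[OF u represents_add[OF v w]]])
next
  fix x y a assume "x \<in> hcarrier E" "y \<in> hcarrier E"
  then obtain u v where u: "represents u x" and v: "represents v y"
    by (auto elim!: E_memE)
  have "(\<lambda>n. hinner F (u n) (a *\<^sub>C v n)) \<longlonglongrightarrow> a * hinner E x y"
    using tendsto_mult[OF tendsto_const[of a] E_inner[OF u v]] representsD(1)[OF u] representsD(1)[OF v]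
    by (simp add: F.inner_scaleC_right)
  then show "hinner E x (a *\<^sub>C y) = a * hinner E x y"
    by (rule LIMSEQ_unique[OF E_inner[OF u represents_scaleC[OF v]]])
next
  fix x y assume "x \<in> hcarrier E" "y \<in> hcarrier E"
  then obtain u v where u: "represents u x" and v: "represents v y"
    by (auto elim!: E_memE)
  have "(\<lambda>n. cnj (hinner F (u n) (v n))) \<longlonglongrightarrow> cnj (hinner E x y)"
    by (intro tendsto_cnj E_inner u v)
  moreover have "cnj (hinner F (u n) (v n)) = hinner F (v n) (u n)" for n
    using F.inner_commute[OF representsD(1)[OF u] representsD(1)[OF v]] by metis
  ultimately have "(\<lambda>n. hinner F (v n) (u n)) \<longlonglongrightarrow> cnj (hinner E x y)" by simp
  then show "hinner E y x = cnj (hinner E x y)"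
    by (rule LIMSEQ_unique[OF E_inner[OF v u]])
next
  fix x assume "x \<in> hcarrier E"
  then obtain u where u: "represents u x" by (auto elim!: E_memE)
  show "0 \<le> Re (hinner E x x)"
    by (rule LIMSEQ_le_const[OF tendsto_Re[OF E_inner[OF u u]]])
       (use representsD(1)[OF u] F.inner_nonneg in auto)
qed

sublocale E: semi_inner_space E
  by (rule semi_inner_E)

lemma E_hnorm: "represents u v \<Longrightarrow> (\<lambda>n. hnorm F (u n)) \<longlonglongrightarrow> hnorm E v"
  unfolding hnorm_def by (intro tendsto_real_sqrt tendsto_Re E_inner)

lemma ev_mem: "c \<in> hcarrier F \<Longrightarrow> ev c \<in> hcarrier E"
  using E_memI represents_const by blast

lemma ev_inner: "c \<in> hcarrier F \<Longrightarrow> d \<in> hcarrier F \<Longrightarrow> hinner E (ev c) (ev d) = hinner F c d"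
  using LIMSEQ_unique[OF E_inner[OF represents_const represents_const, of c d] tendsto_const] by simp

lemma E_outside:
  assumes "v \<in> hcarrier E" "s \<notin> S" shows "v s = 0"
proof -
  obtain u where "represents u v" using E_memE[OF assms(1)] .
  from representsD(3)[OF this, of s] show ?thesis using assms(2)
    by (simp add: ev_outside LIMSEQ_const_iff)
qed

lemma inner_ev:
  assumes "c \<in> hcarrier F" "v \<in> hcarrier E"
  shows "hinner E (ev c) v = (\<Sum>s\<in>supp c. cnj (c s) * v s)"
proof -
  obtain u where u: "represents u v" using E_memE[OF assms(2)] .
  have "(\<lambda>n. hinner F c (u n)) \<longlonglongrightarrow> (\<Sum>s\<in>supp c. cnj (c s) * v s)"
    unfolding F_inner_ev[OF assms(1)] by (intro tendsto_intros representsD(3)[OF u])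
  then show ?thesis
    by (rule LIMSEQ_unique[OF E_inner[OF represents_const[OF assms(1)] u]])
qed

lemma reproducing:
  assumes "s \<in> S" "v \<in> hcarrier E"
  shows "hinner E (ev (delta s)) v = v s"
proof -
  have "supp (delta s) = {s}" by (auto simp: delta_def)
  then show ?thesis using inner_ev[OF delta_mem[OF assms(1)] assms(2)] by (simp add: delta_def)
qed

lemma ev_delta: "ev (delta s) = (\<lambda>t. if t \<in> S then k t s else 0)"
proof -
  have "supp (delta s) = {s}" by (auto simp: delta_def)
  then show ?thesis by (simp add: ev_def fun_eq_iff delta_def)
qed

lemma represents_approximates:
  assumes u: "represents u v"
  shows "(\<lambda>m. hnorm E (v - ev (u m))) \<longlonglongrightarrow> 0"
proof (rule LIMSEQ_I)
  fix r :: real assume "0 < r"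
  then have r: "0 < r / 2" by simp
  note uD = representsD[OF u]
  obtain N where N: "\<And>m n. m \<ge> N \<Longrightarrow> n \<ge> N \<Longrightarrow> hnorm F (u m - u n) < r / 2" using uD(2) r by meson
  have "hnorm E (v - ev (u m)) < r" if "m \<ge> N" for m
  proof -
    have "(\<lambda>n. hnorm F (u n - u m)) \<longlonglongrightarrow> hnorm E (v - ev (u m))"
      by (rule E_hnorm[OF represents_diff[OF u represents_const[OF uD(1)]]])
    then have "hnorm E (v - ev (u m)) \<le> r / 2"
      by (rule LIMSEQ_le_const2) (use N[OF _ that] less_imp_le in blast)
    then show ?thesis using r by simp
  qed
  moreover have "0 \<le> hnorm E (v - ev (u m))" for m
    using E_memI[OF u] ev_mem[OF uD(1)] by auto
  ultimately show "\<exists>no. \<forall>n\<ge>no. norm (hnorm E (v - ev (u n)) - 0) < r" by auto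
qed

lemma ev_diff_fun: "c \<in> hcarrier F \<Longrightarrow> d \<in> hcarrier F \<Longrightarrow> ev (c - d) = ev c - ev d"
  by (simp add: fun_eq_iff ev_diff)

lemma hilbert_space_E: "hilbert_space E"
proof (unfold hilbert_space_def, intro conjI allI impI)
  fix x assume x: "x \<in> hcarrier E" and 0: "hinner E x x = 0"
  have "hnorm E x = 0" by (simp add: hnorm_def 0)
  have "x s = 0" for s
  proof (cases "s \<in> S")
    case True
    have "cmod (hinner E (ev (delta s)) x) \<le> hnorm E (ev (delta s)) * hnorm E x"
      by (rule E.Cauchy_Schwarz[OF ev_mem[OF delta_mem[OF True]] x])
    then show ?thesis using \<open>hnorm E x = 0\<close> reproducing[OF True x] by simp
  qed (rule E_outside[OF x])
  then show "x = 0" by (simp add: fun_eq_iff)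
next
  fix s :: "nat \<Rightarrow> 's \<Rightarrow> complex"
  assume s: "\<forall>n. s n \<in> hcarrier E"
    and cau: "\<forall>e>0. \<exists>N. \<forall>m\<ge>N. \<forall>n\<ge>N. hnorm E (s m - s n) < e"
  \<comment> \<open>Each term is replaced by an embedded finitely supported function up to 1 / (n +
    1). As the embedding is isometric, these functions form a Cauchy sequence in \<open>F\<close>,
    so their pointwise limit lies in \<open>E\<close> by definition.\<close>
  have "\<exists>c\<in>hcarrier F. hnorm E (s n - ev c) < 1 / real (Suc n)" for n
  proof -
    obtain u where u: "represents u (s n)" using E_memE s by blast
    have "0 < 1 / real (Suc n)" by simp
    then obtain m where "norm (hnorm E (s n - ev (u m)) - 0) < 1 / real (Suc n)"
      using LIMSEQ_D[OF represents_approximates[OF u]] by blast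
    then have "hnorm E (s n - ev (u m)) < 1 / real (Suc n)" by simp
    then show ?thesis using representsD(1)[OF u] by blast
  qed
  then obtain c where c: "\<And>n. c n \<in> hcarrier F" and sc: "\<And>n. hnorm E (s n - ev (c n)) < 1 / real (Suc n)"
    by metis
  have sE: "s n \<in> hcarrier E" for n using s by blast
  note evc = ev_mem[OF c]
  have cC: "\<forall>e>0. \<exists>N. \<forall>m\<ge>N. \<forall>n\<ge>N. hnorm F (c m - c n) < e"
  proof (intro allI impI)
    fix e :: real assume "0 < e"
    then have e: "0 < e / 3" by simp
    then obtain M where M: "\<And>m n. m \<ge> M \<Longrightarrow> n \<ge> M \<Longrightarrow> hnorm E (s m - s n) < e / 3" using cau by meson
    obtain N where N: "1 / real (Suc n) < e / 3" if "n \<ge> N" for n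
      using e LIMSEQ_D[OF LIMSEQ_inverse_real_of_nat e] by (auto simp: inverse_eq_divide)
    have "hnorm F (c m - c n) < e" if "m \<ge> max M N" "n \<ge> max M N" for m n
    proof -
      have "hnorm F (c m - c n) = hnorm E (ev (c m) - ev (c n))"
        unfolding hnorm_def using c by (simp add: ev_inner flip: ev_diff_fun)
      also have "\<dots> \<le> hnorm E (ev (c m) - s m) + (hnorm E (s m - s n) + hnorm E (s n - ev (c n)))"
        using E.hnorm_triangle_diff[OF evc[of m] sE[of m] evc[of n]]
          E.hnorm_triangle_diff[OF sE[of m] sE[of n] evc[of n]]
        by linarith
      finally show ?thesis
        using M[of m n] N[of m] N[of n] sc[of m] sc[of n] that E.hnorm_diff_commute[OF evc sE, of m m]
        by simp
    qed
    then show "\<exists>N. \<forall>m\<ge>N. \<forall>n\<ge>N. hnorm F (c m - c n) < e" by blast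
  qed
  have "convergent (\<lambda>n. ev (c n) p)" for p
  proof (cases "p \<in> S")
    case True
    then show ?thesis
      using F.convergent_inner_of_Cauchy[of "\<lambda>_. delta p" c] c cC by (simp add: ev_eq delta_mem)
  qed (simp add: ev_outside convergent_const)
  then have r: "represents c (\<lambda>p. lim (\<lambda>n. ev (c n) p))" (is "represents c ?v")
    using c cC by (simp add: represents_def convergent_LIMSEQ_iff)
  have vE: "?v \<in> hcarrier E" using r by (rule E_memI)
  have "(\<lambda>n. hnorm E (s n - ?v)) \<longlonglongrightarrow> 0"
  proof (rule tendsto_sandwich[OF _ _ tendsto_const])
    show "(\<lambda>n. inverse (real (Suc n)) + hnorm E (?v - ev (c n))) \<longlonglongrightarrow> 0"
      using tendsto_add[OF LIMSEQ_inverse_real_of_nat represents_approximates[OF r]] by simp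
    have "hnorm E (s n - ?v) \<le> inverse (real (Suc n)) + hnorm E (?v - ev (c n))" for n
      using E.hnorm_triangle_diff[OF sE evc vE, of n n] sc[of n] E.hnorm_diff_commute[OF evc vE, of n]
      by (simp add: inverse_eq_divide)
    then show "\<forall>\<^sub>F n in sequentially. hnorm E (s n - ?v) \<le> inverse (real (Suc n)) + hnorm E (?v - ev (c n))"
      by simp
    show "\<forall>\<^sub>F n in sequentially. 0 \<le> hnorm E (s n - ?v)" using sE vE by auto
  qed
  then show "\<exists>l\<in>hcarrier E. (\<lambda>n. hnorm E (s n - l)) \<longlonglongrightarrow> 0" using vE by blast
qed (use E.subspace E.inner_add_right E.inner_scaleC_right E.inner_nonneg in \<open>auto intro: E.inner_commute\<close>)

sublocale E: hilbert_space E
  by (rule hilbert_space_E)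

text \<open>The bound says that c \<mapsto> <v, c> is a bounded functional on \<open>F\<close>; its
  minimizing sequence from the Riesz argument is Cauchy and has pointwise limit \<open>v\<close>.
  Operators given by a formula for functions are thereby reduced to inequalities between quadratic
  forms.\<close>

lemma memI_of_bound:
  assumes out: "\<And>s. s \<notin> S \<Longrightarrow> v s = 0" and C: "0 \<le> C"
    and bound: "\<And>T c. finite T \<Longrightarrow> T \<subseteq> S \<Longrightarrow>
      cmod (\<Sum>s\<in>T. cnj (c s) * v s) \<le> C * sqrt (Re (\<Sum>s\<in>T. \<Sum>t\<in>T. cnj (c s) * c t * k s t))"
  shows "v \<in> hcarrier E" and "hnorm E v \<le> C"
proof -
  have bd: "cmod (\<Sum>s\<in>supp c. cnj (c s) * v s) \<le> C * hnorm F c" if "c \<in> hcarrier F" for c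
    using bound[of "supp c" c] that by (simp add: hnorm_def F_def)
  define f where "f c = (\<Sum>s\<in>supp c. c s * cnj (v s))" for c
  have f_eq: "f c = (\<Sum>s\<in>A. c s * cnj (v s))" if "finite A" "supp c \<subseteq> A" for A c
    unfolding f_def by (rule sum.mono_neutral_left) (use that in auto)
  obtain u where u: "\<And>n. u n \<in> hcarrier F"
    "\<forall>e>0. \<exists>N. \<forall>m\<ge>N. \<forall>n\<ge>N. hnorm F (u m - u n) < e"
    "\<And>g. g \<in> hcarrier F \<Longrightarrow> (\<lambda>n. hinner F (u n) g) \<longlonglongrightarrow> f g"
  proof (rule F.Riesz_approximation[of f C])
    fix c d assume m: "c \<in> hcarrier F" "d \<in> hcarrier F"
    have "supp (c + d) \<subseteq> supp c \<union> supp d" by auto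
    then show "f (c + d) = f c + f d"
      using m by (simp add: f_eq[of "supp c \<union> supp d"] F_mem algebra_simps sum.distrib)
  next
    fix a c assume m: "c \<in> hcarrier F"
    have "supp (a *\<^sub>C c) \<subseteq> supp c" by (auto simp: scaleC_fun_def scaleC_complex_def)
    then show "f (a *\<^sub>C c) = a * f c"
      using m by (simp add: f_eq[of "supp c"] F_mem sum_distrib_left scaleC_fun_def
          scaleC_complex_def mult.assoc)
  next
    fix c assume m: "c \<in> hcarrier F"
    have "f c = cnj (\<Sum>s\<in>supp c. cnj (c s) * v s)" by (simp add: f_def)
    then show "cmod (f c) \<le> C * hnorm F c" using bd[OF m] by (metis complex_mod_cnj)
  qed blast
  have "(\<lambda>n. ev (u n) s) \<longlonglongrightarrow> v s" for s
  proof (cases "s \<in> S")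
    case True
    have "supp (delta s) = {s}" by (auto simp: delta_def)
    then have "f (delta s) = cnj (v s)" by (simp add: f_def delta_def)
    then have "(\<lambda>n. cnj (hinner F (u n) (delta s))) \<longlonglongrightarrow> v s"
      using tendsto_cnj[OF u(3)[OF delta_mem[OF True]]] by simp
    moreover have "cnj (hinner F (u n) (delta s)) = ev (u n) s" for n
      using F.inner_commute[OF u(1) delta_mem[OF True]] True by (simp add: ev_eq)
    ultimately show ?thesis by simp
  qed (simp add: ev_outside out)
  then have r: "represents u v" using u(1,2) by (simp add: represents_def)
  then show vE: "v \<in> hcarrier E" by (rule E_memI)
  have lim: "(\<lambda>n. hnorm E (ev (u n) - v)) \<longlonglongrightarrow> 0"
    using represents_approximates[OF r] E.hnorm_diff_commute[OF vE ev_mem[OF u(1)]] by simp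
  \<comment> \<open>The norm of \<open>u n\<close> tends to that of \<open>v\<close>, and |<u n, v>|
    \<le> C |u n| tends to |v|^2 \<le> C |v|, from which one factor cancels.\<close>
  have "hnorm E v * hnorm E v \<le> C * hnorm E v"
  proof (rule LIMSEQ_le)
    show "(\<lambda>n. cmod (hinner E (ev (u n)) v)) \<longlonglongrightarrow> hnorm E v * hnorm E v"
      using tendsto_norm[OF E.tendsto_inner_left[OF ev_mem[OF u(1)] vE vE lim]] vE
      by (simp add: E.inner_self power2_eq_square norm_mult)
    show "(\<lambda>n. C * hnorm F (u n)) \<longlonglongrightarrow> C * hnorm E v"
      by (intro tendsto_intros E_hnorm r)
    show "\<exists>N. \<forall>n\<ge>N. cmod (hinner E (ev (u n)) v) \<le> C * hnorm F (u n)"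
      using bd[OF u(1)] by (simp add: inner_ev[OF u(1) vE])
  qed
  then show "hnorm E v \<le> C"
    using C E.hnorm_nonneg[OF vE] by (cases "hnorm E v = 0") (auto simp: mult_le_cancel_right)
qed

text \<open>The Cauchy-Schwarz inequality of \<open>F\<close> for \<open>c\<close> cut off to
  \<open>T\<close> and for \<open>delta t\<close>.\<close>

lemma kernel_Cauchy_Schwarz:
  assumes T: "finite T" "T \<subseteq> S" and t: "t \<in> S"
  shows "cmod (\<Sum>s\<in>T. cnj (c s) * k s t)
    \<le> sqrt (Re (\<Sum>s\<in>T. \<Sum>t\<in>T. cnj (c s) * c t * k s t)) * sqrt (Re (k t t))"
proof -
  let ?c = "\<lambda>s. if s \<in> T then c s else 0"
  have sc: "supp ?c \<subseteq> T" by auto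
  have sd: "supp (delta t) = {t}" by (auto simp: delta_def)
  have c: "?c \<in> hcarrier F" unfolding F_mem using T finite_subset[OF sc] sc by auto
  have 1: "hinner F ?c (delta t) = (\<Sum>s\<in>T. cnj (c s) * k s t)"
    using F_inner_eq[of T "{t}" ?c "delta t"] T sc sd by (simp add: delta_def)
  have 2: "hinner F ?c ?c = (\<Sum>s\<in>T. \<Sum>t\<in>T. cnj (c s) * c t * k s t)"
    using F_inner_eq[of T T ?c ?c] T sc by simp
  have 3: "hinner F (delta t) (delta t) = k t t"
    using F_inner_eq[of "{t}" "{t}" "delta t" "delta t"] sd by (simp add: delta_def)
  show ?thesis
    using F.Cauchy_Schwarz[OF c delta_mem[OF t]] unfolding hnorm_def 1 2 3 .
qed

end

section \<open>Uniqueness\<close>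

context hilbert_pair
begin

text \<open>The vector \<open>v\<close> is approximated by combinations of the \<open>e i\<close>,
  and the coefficients are transferred to the \<open>f i\<close>. Equality of the Gram matrices
  makes the transferred sequence Cauchy as well.\<close>

lemma related_vector_exists:
  fixes e :: "'i \<Rightarrow> 'v" and f :: "'i \<Rightarrow> 'w"
  assumes e: "\<And>i. i \<in> I \<Longrightarrow> e i \<in> hcarrier H" and f: "\<And>i. i \<in> I \<Longrightarrow> f i \<in> hcarrier K"
    and gram: "\<And>i j. i \<in> I \<Longrightarrow> j \<in> I \<Longrightarrow> hinner K (f i) (f j) = hinner H (e i) (e j)"
    and tot: "hclosed_span H (e ` I) = hcarrier H"
    and v: "v \<in> hcarrier H"
  obtains w where "w \<in> hcarrier K" "hnorm K w = hnorm H v"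
    "\<And>i. i \<in> I \<Longrightarrow> hinner K (f i) w = hinner H (e i) v"
proof -
  \<comment> \<open>A relation rather than a map, since a vector may have several expansions in the
    \<open>e i\<close>. Differences of pairs are again pairs, with equal norms in \<open>H\<close>
    and \<open>K\<close>, so any choice of expansion will do.\<close>
  define G where "G = {(\<Sum>i\<in>A. c i *\<^sub>C e i, \<Sum>i\<in>A. c i *\<^sub>C f i) | A c. finite A \<and> A \<subseteq> I}"
  have eI: "e ` I \<subseteq> hcarrier H" using e by auto
  have lift: "\<exists>y. (x, y) \<in> G" if "x \<in> module.span scaleC (e ` I)" for x
  proof -
    have "\<exists>T r. x = (\<Sum>a\<in>T. r a *\<^sub>C a) \<and> finite T \<and> T \<subseteq> e ` I"
      using that unfolding scaleC_module.span_explicit by (rule CollectD)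
    then obtain T r where T: "finite T" "T \<subseteq> e ` I" "x = (\<Sum>a\<in>T. r a *\<^sub>C a)"
      by (elim exE conjE)
    define A where "A = inv_into I e ` T"
    have inj: "inj_on (inv_into I e) T" using T(2) by (rule inj_on_inv_into)
    have "x = (\<Sum>i\<in>A. r (e i) *\<^sub>C e i)"
      unfolding A_def T(3) sum.reindex[OF inj]
      using T(2) by (intro sum.cong) (auto simp: f_inv_into_f subset_iff)
    moreover have "finite A" "A \<subseteq> I" using T by (auto simp: A_def intro: inv_into_into)
    ultimately have "(x, \<Sum>i\<in>A. r (e i) *\<^sub>C f i) \<in> G"
      unfolding G_def
      by (intro CollectI exI[of _ A] exI[of _ "\<lambda>i. r (e i)"] conjI) simp_all
    then show ?thesis by (rule exI)
  qed
  have G_diff: "(x - x', y - y') \<in> G" if xy: "(x, y) \<in> G" "(x', y') \<in> G" for x x' y y'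
  proof -
    obtain A c where A: "finite A" "A \<subseteq> I" "x = (\<Sum>i\<in>A. c i *\<^sub>C e i)" "y = (\<Sum>i\<in>A. c i *\<^sub>C f i)"
      using xy(1) unfolding G_def by blast
    obtain B d where B: "finite B" "B \<subseteq> I" "x' = (\<Sum>i\<in>B. d i *\<^sub>C e i)" "y' = (\<Sum>i\<in>B. d i *\<^sub>C f i)"
      using xy(2) unfolding G_def by blast
    define g where "g i = (if i \<in> A then c i else 0) - (if i \<in> B then d i else 0)" for i
    have *: "(\<Sum>i\<in>A. c i *\<^sub>C h i) - (\<Sum>i\<in>B. d i *\<^sub>C h i) = (\<Sum>i\<in>A \<union> B. g i *\<^sub>C h i)"
      for h :: "'i \<Rightarrow> 'z::complex_vector"
    proof -
      have "(\<Sum>i\<in>A. c i *\<^sub>C h i) = (\<Sum>i\<in>A \<union> B. (if i \<in> A then c i else 0) *\<^sub>C h i)"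
        using A(1) B(1) by (intro sum.mono_neutral_cong_left) auto
      moreover have "(\<Sum>i\<in>B. d i *\<^sub>C h i) = (\<Sum>i\<in>A \<union> B. (if i \<in> B then d i else 0) *\<^sub>C h i)"
        using A(1) B(1) by (intro sum.mono_neutral_cong_left) auto
      ultimately show ?thesis
        by (simp add: g_def scaleC_module.scale_left_diff_distrib sum_subtractf)
    qed
    show ?thesis unfolding A(3,4) B(3,4) * G_def using A(1,2) B(1,2) by blast
  qed
  have G_mem: "x \<in> hcarrier H" "y \<in> hcarrier K" if "(x, y) \<in> G" for x y
    using that e f by (auto simp: G_def subset_iff intro!: H.sum_mem K.sum_mem)
  have G_inner: "hinner K (f i) y = hinner H (e i) x" if "(x, y) \<in> G" "i \<in> I" for x y i
    using that e f gram
    by (auto simp: G_def subset_iff H.inner_sum_right K.inner_sum_right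
        H.inner_scaleC_right K.inner_scaleC_right intro!: sum.cong)
  have G_norm: "hnorm K y = hnorm H x" if xy: "(x, y) \<in> G" for x y
  proof -
    obtain A c where A: "finite A" "A \<subseteq> I" "x = (\<Sum>i\<in>A. c i *\<^sub>C e i)" "y = (\<Sum>i\<in>A. c i *\<^sub>C f i)"
      using xy unfolding G_def by blast
    have "hinner K (\<Sum>i\<in>A. c i *\<^sub>C f i) y = (\<Sum>i\<in>A. cnj (c i) * hinner K (f i) y)"
      using A(2) f G_mem(2)[OF xy] by (auto simp: K.inner_sum_left K.inner_scaleC_left subset_iff intro!: sum.cong)
    then have "hinner K y y = (\<Sum>i\<in>A. cnj (c i) * hinner K (f i) y)" by (simp only: A(4)[symmetric])
    also have "\<dots> = (\<Sum>i\<in>A. cnj (c i) * hinner H (e i) x)"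
      using A(2) G_inner[OF xy] by (intro sum.cong) auto
    also have "\<dots> = hinner H (\<Sum>i\<in>A. c i *\<^sub>C e i) x"
      using A(2) e G_mem(1)[OF xy] by (auto simp: H.inner_sum_left H.inner_scaleC_left subset_iff intro!: sum.cong)
    also have "\<dots> = hinner H x x" by (simp only: A(3)[symmetric])
    finally show ?thesis by (simp add: hnorm_def)
  qed
  obtain u where u: "\<And>n. u n \<in> module.span scaleC (e ` I)" "\<And>n. u n \<in> hcarrier H"
    and lim: "(\<lambda>n. hnorm H (u n - v)) \<longlonglongrightarrow> 0"
    and cau: "\<forall>\<epsilon>>0. \<exists>N. \<forall>m\<ge>N. \<forall>n\<ge>N. hnorm H (u m - u n) < \<epsilon>"
    using H.hclosed_span_sequence[OF eI, of v] v tot by metis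
  obtain w where w: "\<And>n. (u n, w n) \<in> G" using lift[OF u(1)] by metis
  have "hnorm K (w m - w n) = hnorm H (u m - u n)" for m n
    by (rule G_norm[OF G_diff[OF w w]])
  then obtain l where l: "l \<in> hcarrier K" "(\<lambda>n. hnorm K (w n - l)) \<longlonglongrightarrow> 0"
    using K.hcomplete[of w] cau G_mem(2)[OF w] by auto
  show thesis
  proof (rule that[OF l(1)])
    have "(\<lambda>n. hnorm H (u n)) \<longlonglongrightarrow> hnorm K l"
      using K.tendsto_hnorm[OF G_mem(2)[OF w] l] G_norm[OF w] by simp
    then show "hnorm K l = hnorm H v"
      using H.tendsto_hnorm[OF u(2) v lim] by (rule LIMSEQ_unique)
    fix i assume i: "i \<in> I"
    have 1: "(\<lambda>n. hinner H (u n) (e i)) \<longlonglongrightarrow> hinner H v (e i)"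
      by (rule H.tendsto_inner_left[OF u(2) v e[OF i] lim])
    have 2: "(\<lambda>n. hinner K (w n) (f i)) \<longlonglongrightarrow> hinner K l (f i)"
      by (rule K.tendsto_inner_left[OF G_mem(2)[OF w] l(1) f[OF i] l(2)])
    have "hinner K (w n) (f i) = hinner H (u n) (e i)" for n
      using G_inner[OF w i, of n] H.inner_commute[OF e[OF i] u(2), of n]
        K.inner_commute[OF f[OF i] G_mem(2)[OF w], of n] by simp
    then have "hinner K l (f i) = hinner H v (e i)" using LIMSEQ_unique[OF 2] 1 by simp
    then show "hinner K (f i) l = hinner H (e i) v"
      using H.inner_commute[OF v e[OF i]] K.inner_commute[OF l(1) f[OF i]] by simp
  qed
qed

text \<open>\<open>U v\<close> is the only vector with the prescribed products with the total family
  \<open>f\<close>. This yields linearity, and it is passed on as a conclusion so that identities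
  for \<open>U\<close> can be checked against the \<open>f i\<close> alone. Surjectivity is the same
  construction with the roles of the spaces exchanged.\<close>

lemma unitary_of_gram_eq:
  fixes e :: "'i \<Rightarrow> 'v" and f :: "'i \<Rightarrow> 'w"
  assumes e: "\<And>i. i \<in> I \<Longrightarrow> e i \<in> hcarrier H" and f: "\<And>i. i \<in> I \<Longrightarrow> f i \<in> hcarrier K"
    and gram: "\<And>i j. i \<in> I \<Longrightarrow> j \<in> I \<Longrightarrow> hinner K (f i) (f j) = hinner H (e i) (e j)"
    and tote: "hclosed_span H (e ` I) = hcarrier H"
    and totf: "hclosed_span K (f ` I) = hcarrier K"
  obtains U where "unitary_op H K U"
    "\<And>v w. v \<in> hcarrier H \<Longrightarrow> w \<in> hcarrier K \<Longrightarrow>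
      (\<And>i. i \<in> I \<Longrightarrow> hinner K (f i) w = hinner H (e i) v) \<Longrightarrow> U v = w"
    "\<And>v i. v \<in> hcarrier H \<Longrightarrow> i \<in> I \<Longrightarrow> hinner K (f i) (U v) = hinner H (e i) v"
proof -
  interpret KH: hilbert_pair K H by unfold_locales
  have fI: "f ` I \<subseteq> hcarrier K" using f by auto
  have eI: "e ` I \<subseteq> hcarrier H" using e by auto
  have uniq: "w = w'" if "w \<in> hcarrier K" "w' \<in> hcarrier K"
    "\<And>i. i \<in> I \<Longrightarrow> hinner K (f i) w = hinner K (f i) w'" for w w'
  proof -
    have "w - w' = 0"
      by (rule K.total_of_hclosed_span[OF fI totf]) (use that f in \<open>auto simp: K.inner_diff_right\<close>)
    then show ?thesis by simp
  qed
  have uniqH: "w = w'" if "w \<in> hcarrier H" "w' \<in> hcarrier H"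
    "\<And>i. i \<in> I \<Longrightarrow> hinner H (e i) w = hinner H (e i) w'" for w w'
  proof -
    have "w - w' = 0"
      by (rule H.total_of_hclosed_span[OF eI tote]) (use that e in \<open>auto simp: H.inner_diff_right\<close>)
    then show ?thesis by simp
  qed
  have "\<forall>v\<in>hcarrier H. \<exists>w. w \<in> hcarrier K \<and> hnorm K w = hnorm H v \<and>
      (\<forall>i\<in>I. hinner K (f i) w = hinner H (e i) v)"
    using related_vector_exists[of I e f, OF e f gram tote] by metis
  then obtain U where U: "\<And>v. v \<in> hcarrier H \<Longrightarrow> U v \<in> hcarrier K"
    and Unorm: "\<And>v. v \<in> hcarrier H \<Longrightarrow> hnorm K (U v) = hnorm H v"
    and Uf: "\<And>v i. v \<in> hcarrier H \<Longrightarrow> i \<in> I \<Longrightarrow> hinner K (f i) (U v) = hinner H (e i) v"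
    by metis
  have Ueq: "U v = w" if "v \<in> hcarrier H" "w \<in> hcarrier K"
    "\<And>i. i \<in> I \<Longrightarrow> hinner K (f i) w = hinner H (e i) v" for v w
    by (rule uniq) (use that U Uf in auto)
  have add: "U (x + y) = U x + U y" if "x \<in> hcarrier H" "y \<in> hcarrier H" for x y
    by (rule Ueq) (use that U Uf e f in \<open>auto simp: H.inner_add_right K.inner_add_right\<close>)
  have scale: "U (c *\<^sub>C x) = c *\<^sub>C U x" if "x \<in> hcarrier H" for c x
    by (rule Ueq) (use that U Uf e f in \<open>auto simp: H.inner_scaleC_right K.inner_scaleC_right\<close>)
  have re: "Re (hinner K (U x) (U y)) = Re (hinner H x y)"
    if x: "x \<in> hcarrier H" and y: "y \<in> hcarrier H" for x y
    using Unorm[OF H.add_mem[OF x y]] H.hnorm_add_sq[OF x y] K.hnorm_add_sq[OF U[OF x] U[OF y]]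
      Unorm[OF x] Unorm[OF y] add[OF x y] by simp
  have iso: "hinner K (U x) (U y) = hinner H x y"
    if x: "x \<in> hcarrier H" and y: "y \<in> hcarrier H" for x y
  proof (rule complex_eqI)
    show "Re (hinner K (U x) (U y)) = Re (hinner H x y)" by (rule re[OF x y])
    show "Im (hinner K (U x) (U y)) = Im (hinner H x y)"
      using re[OF x H.scaleC_mem[OF y, of "\<i>"]] x y U
      by (simp add: scale H.inner_scaleC_right K.inner_scaleC_right)
  qed
  have surj: "\<exists>h\<in>hcarrier H. U h = k" if k: "k \<in> hcarrier K" for k
  proof -
    obtain h where h: "h \<in> hcarrier H" "\<And>i. i \<in> I \<Longrightarrow> hinner H (e i) h = hinner K (f i) k"
      using KH.related_vector_exists[of I f e k, OF f e gram[symmetric] totf k] by metis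
    have "U h = k" by (rule Ueq) (use h k in auto)
    with h(1) show ?thesis by blast
  qed
  have "unitary_op H K U"
    by (rule isometry_unitary_op) (use add scale U iso surj in auto)
  then show thesis using Ueq Uf by (rule that)
qed

end

section \<open>Identities valid in every Stinespring construction\<close>

locale stinespring =
  H: hilbert_space H + K: hilbert_space K + P: hilbert_space P + Q: hilbert_space Q
  for H :: "'h::complex_vector hilbert" and K :: "'k::complex_vector hilbert"
    and P :: "'p::complex_vector hilbert" and Q :: "'q::complex_vector hilbert" +
  fixes act :: "'x::{complex_normed_vector, banach} \<Rightarrow> 'a::cstar_algebra \<Rightarrow> 'x"
    and ip :: "'x \<Rightarrow> 'x \<Rightarrow> 'a" and \<Phi> :: "'x \<Rightarrow> 'h \<Rightarrow> 'k" and \<pi> V W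
  assumes module: "hilbert_module act ip"
    and construction: "stinespring_construction ip H K \<Phi> P Q \<pi> V W"
begin

sublocale PQ: hilbert_pair P Q by unfold_locales
sublocale KQ: hilbert_pair K Q by unfold_locales
sublocale PP: hilbert_pair P P by unfold_locales
sublocale X: hilbert_module act ip by (rule module)

lemma pi_bounded: "\<pi> x \<in> bounded_ops P Q"
  and V_bounded: "V \<in> bounded_ops H P"
  and W_bounded: "W \<in> bounded_ops K Q"
  and W_W_adj: "k \<in> hcarrier Q \<Longrightarrow> W (hadj K Q W k) = k"
  and Phi_eq: "h \<in> hcarrier H \<Longrightarrow> \<Phi> x h = hadj K Q W (\<pi> x (V h))"
  and span_pi_V: "hclosed_span Q {\<pi> x (V h) | x h. h \<in> hcarrier H} = hcarrier Q"
  and span_pi_adj_W: "hclosed_span P {hadj P Q (\<pi> x) (W k) | x k. k \<in> hcarrier K} = hcarrier P"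
  using construction
  by (auto simp: stinespring_construction_def module_representation_def coisometry_def)

lemma V_mem [simp]: "h \<in> hcarrier H \<Longrightarrow> V h \<in> hcarrier P"
  using bounded_opsD(1)[OF V_bounded] .

lemma W_mem [simp]: "k \<in> hcarrier K \<Longrightarrow> W k \<in> hcarrier Q"
  using bounded_opsD(1)[OF W_bounded] .

lemma pi_mem [simp]: "v \<in> hcarrier P \<Longrightarrow> \<pi> x v \<in> hcarrier Q"
  using bounded_opsD(1)[OF pi_bounded] .

lemma inner_pi_V_W:
  assumes "h \<in> hcarrier H" "k \<in> hcarrier K"
  shows "hinner Q (\<pi> x (V h)) (W k) = hinner K (\<Phi> x h) k"
  using KQ.hadj_inner[OF W_bounded, of "\<pi> x (V h)" k] assms by (simp add: Phi_eq)

text \<open>W W* = 1 turns (a) into W \<Phi>(y) g = \<pi>(y) V g, so the second factor can be moved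
  to \<open>K\<close> through \<open>W\<close>.\<close>

lemma inner_pi_V_pi_V:
  assumes "h \<in> hcarrier H" "g \<in> hcarrier H"
  shows "hinner Q (\<pi> x (V h)) (\<pi> y (V g)) = hinner K (\<Phi> x h) (\<Phi> y g)"
proof -
  have "W (\<Phi> y g) = \<pi> y (V g)" and "\<Phi> y g \<in> hcarrier K"
    using assms KQ.hadj_mem[OF W_bounded] by (simp_all add: Phi_eq W_W_adj)
  then show ?thesis using inner_pi_V_W[OF assms(1), of "\<Phi> y g" x] by simp
qed

lemma total_pi_V:
  assumes v: "v \<in> hcarrier Q"
    and "\<And>x h. h \<in> hcarrier H \<Longrightarrow> hinner Q (\<pi> x (V h)) v = 0"
  shows "v = 0"
  by (rule Q.total_of_hclosed_span[OF _ span_pi_V v]) (use assms in auto)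

text \<open>Condition (c) speaks of \<pi>(x)* W k with arbitrary k. If \<open>v\<close> is
  orthogonal to all \<pi>(x)* \<pi>(y) V h, then \<pi>(x) v is orthogonal to the family of (b),
  hence 0, and so \<open>v\<close> is orthogonal to the family of (c) as well.\<close>

lemma total_pi_adj_pi_V:
  assumes v: "v \<in> hcarrier P"
    and orth: "\<And>x y h. h \<in> hcarrier H \<Longrightarrow> hinner P (hadj P Q (\<pi> x) (\<pi> y (V h))) v = 0"
  shows "v = 0"
proof -
  have piv: "\<pi> x v = 0" for x
  proof (rule total_pi_V)
    show "hinner Q (\<pi> y (V h)) (\<pi> x v) = 0" if "h \<in> hcarrier H" for y h
      using orth[OF that, of x y] PQ.hadj_inner[OF pi_bounded _ v] that by simp
  qed (use v in simp)
  show ?thesis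
  proof (rule P.total_of_hclosed_span[OF _ span_pi_adj_W v])
    show "{hadj P Q (\<pi> x) (W k) |x k. k \<in> hcarrier K} \<subseteq> hcarrier P"
      using PQ.hadj_mem[OF pi_bounded] by auto
    show "hinner P y v = 0" if "y \<in> {hadj P Q (\<pi> x) (W k) |x k. k \<in> hcarrier K}" for y
      using that PQ.hadj_inner[OF pi_bounded _ v] piv by auto
  qed
qed

text \<open>Compatibility with the right action is not part of the definition of a representation.
  It follows by expanding ||\<pi>(xa) v - \<pi>(x) \<rho>(a) v||^2, whose four terms agree up to
  sign. The defining identity is repeated in the conclusion so that it concerns the same
  \<open>\<rho>\<close>.\<close>

lemma pi_act:
  "\<exists>\<rho>. star_representation P \<rho> \<and>
    (\<forall>x y. \<forall>v\<in>hcarrier P. hadj P Q (\<pi> x) (\<pi> y v) = \<rho> (ip x y) v) \<and>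
    (\<forall>x a. \<forall>v\<in>hcarrier P. \<pi> (act x a) v = \<pi> x (\<rho> a v))"
proof -
  obtain \<rho> where rep: "star_representation P \<rho>"
    and rho: "\<And>x y v. v \<in> hcarrier P \<Longrightarrow> hadj P Q (\<pi> x) (\<pi> y v) = \<rho> (ip x y) v"
    using construction by (auto simp: stinespring_construction_def module_representation_def)
  have rb: "\<rho> a \<in> bounded_ops P P" for a using rep
    by (simp add: star_representation_def linear_into_ops_def)
  have rmult: "\<rho> (a * b) v = \<rho> a (\<rho> b v)" if "v \<in> hcarrier P" for a b v
    using rep that by (simp add: star_representation_def)
  have rstar: "\<rho> (star a) v = hadj P P (\<rho> a) v" if "v \<in> hcarrier P" for a v
    using rep that by (simp add: star_representation_def)
  note [simp] = bounded_opsD(1)[OF rb]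
  have inn: "hinner Q (\<pi> x v) (\<pi> y w) = hinner P v (\<rho> (ip x y) w)"
    if "v \<in> hcarrier P" "w \<in> hcarrier P" for x y v w
    using PQ.hadj_inner_right[OF pi_bounded pi_mem[OF that(2)] that(1)] rho[OF that(2)] by simp
  have ipl: "ip (act x a) y = star a * ip x y" for x a y
    using X.ip_act_right[of y x a] X.star_ip star_mult[of "ip y x" a] by metis
  have "\<pi> (act x a) v = \<pi> x (\<rho> a v)" if v: "v \<in> hcarrier P" for x a v
  proof -
    have st: "hinner P v (\<rho> (star a) w) = hinner P (\<rho> a v) w" if "w \<in> hcarrier P" for w
      using PP.hadj_inner_right[OF rb that v] rstar[OF that] by simp
    have "hinner Q (\<pi> (act x a) v - \<pi> x (\<rho> a v)) (\<pi> (act x a) v - \<pi> x (\<rho> a v)) = 0"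
      using v by (simp add: Q.inner_diff_left Q.inner_diff_right inn ipl X.ip_act_right rmult st)
    then have "\<pi> (act x a) v - \<pi> x (\<rho> a v) = 0"
      by (rule Q.hinner_definite[rotated]) (use v in simp)
    then show ?thesis by simp
  qed
  with rep rho show ?thesis by blast
qed

text \<open>Moving \<pi>(x)* to the other side leaves \<pi>(x) \<pi>(x')* \<pi>(y') V g, which is
  \<pi>(x <x',y'>) V g by compatibility with the action.\<close>

lemma pi_adj_pi_V_gram:
  assumes h: "h \<in> hcarrier H" and g: "g \<in> hcarrier H"
  shows "hinner P (hadj P Q (\<pi> x) (\<pi> y (V h))) (hadj P Q (\<pi> x') (\<pi> y' (V g)))
    = hinner K (\<Phi> y h) (\<Phi> (act x (ip x' y')) g)"
proof -
  obtain \<rho> where rep: "star_representation P \<rho>"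
    and rho: "\<And>x y v. v \<in> hcarrier P \<Longrightarrow> hadj P Q (\<pi> x) (\<pi> y v) = \<rho> (ip x y) v"
    and act: "\<And>x a v. v \<in> hcarrier P \<Longrightarrow> \<pi> (act x a) v = \<pi> x (\<rho> a v)"
    using pi_act by blast
  have m: "hadj P Q (\<pi> x') (\<pi> y' (V g)) \<in> hcarrier P"
    using PQ.hadj_mem[OF pi_bounded] g by simp
  have "hinner P (hadj P Q (\<pi> x) (\<pi> y (V h))) (hadj P Q (\<pi> x') (\<pi> y' (V g)))
      = hinner Q (\<pi> y (V h)) (\<pi> x (hadj P Q (\<pi> x') (\<pi> y' (V g))))"
    using PQ.hadj_inner[OF pi_bounded _ m] h by simp
  also have "\<pi> x (hadj P Q (\<pi> x') (\<pi> y' (V g))) = \<pi> (act x (ip x' y')) (V g)"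
    using g by (simp add: rho act)
  finally show ?thesis using h g by (simp add: inner_pi_V_pi_V)
qed

end

lemma stinespring_unique:
  fixes act :: "'x::{complex_normed_vector, banach} \<Rightarrow> 'a::cstar_algebra \<Rightarrow> 'x"
    and H :: "'h::complex_vector hilbert"
  assumes mod: "hilbert_module act ip" and H: "hilbert_space H" and K: "hilbert_space K"
    and c1: "stinespring_construction ip H K \<Phi> P1 Q1 \<pi>1 V1 W1"
    and c2: "stinespring_construction ip H K \<Phi> P2 Q2 \<pi>2 V2 W2"
  shows "\<exists>U1 U2. unitary_op P1 P2 U1 \<and> unitary_op Q1 Q2 U2 \<and>
    (\<forall>x. \<forall>h\<in>hcarrier P1. U2 (\<pi>1 x h) = \<pi>2 x (U1 h)) \<and>
    (\<forall>h\<in>hcarrier H. V2 h = U1 (V1 h)) \<and> (\<forall>k\<in>hcarrier K. W2 k = U2 (W1 k))"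
proof -
  interpret A: stinespring H K P1 Q1 act ip \<Phi> \<pi>1 V1 W1
    using mod H K c1 by (auto simp: stinespring_def stinespring_axioms_def stinespring_construction_def)
  interpret B: stinespring H K P2 Q2 act ip \<Phi> \<pi>2 V2 W2
    using mod H K c2 by (auto simp: stinespring_def stinespring_axioms_def stinespring_construction_def)
  interpret PP: hilbert_pair P1 P2 by unfold_locales
  interpret QQ: hilbert_pair Q1 Q2 by unfold_locales
  let ?I = "UNIV \<times> hcarrier H"
  let ?e = "\<lambda>(x, h). \<pi>1 x (V1 h)" and ?f = "\<lambda>(x, h). \<pi>2 x (V2 h)"
  have img: "?e ` ?I = {\<pi>1 x (V1 h) | x h. h \<in> hcarrier H}"
    "?f ` ?I = {\<pi>2 x (V2 h) | x h. h \<in> hcarrier H}"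
    by auto
  obtain U2 where U2: "unitary_op Q1 Q2 U2"
    and U2eq: "\<And>v w. v \<in> hcarrier Q1 \<Longrightarrow> w \<in> hcarrier Q2 \<Longrightarrow>
      (\<And>i. i \<in> ?I \<Longrightarrow> hinner Q2 (?f i) w = hinner Q1 (?e i) v) \<Longrightarrow> U2 v = w"
    and U2f: "\<And>v i. v \<in> hcarrier Q1 \<Longrightarrow> i \<in> ?I \<Longrightarrow> hinner Q2 (?f i) (U2 v) = hinner Q1 (?e i) v"
  proof (rule QQ.unitary_of_gram_eq[of ?I ?e ?f])
    show "hclosed_span Q1 (?e ` ?I) = hcarrier Q1" by (simp only: img A.span_pi_V)
    show "hclosed_span Q2 (?f ` ?I) = hcarrier Q2" by (simp only: img B.span_pi_V)
  qed (auto simp: A.inner_pi_V_pi_V B.inner_pi_V_pi_V)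
  let ?J = "UNIV \<times> UNIV \<times> hcarrier H"
  let ?e' = "\<lambda>(x, y, h). hadj P1 Q1 (\<pi>1 x) (\<pi>1 y (V1 h))"
    and ?f' = "\<lambda>(x, y, h). hadj P2 Q2 (\<pi>2 x) (\<pi>2 y (V2 h))"
  have e': "i \<in> ?J \<Longrightarrow> ?e' i \<in> hcarrier P1" for i
    using A.PQ.hadj_mem[OF A.pi_bounded] by auto
  have f': "i \<in> ?J \<Longrightarrow> ?f' i \<in> hcarrier P2" for i
    using B.PQ.hadj_mem[OF B.pi_bounded] by auto
  obtain U1 where U1: "unitary_op P1 P2 U1"
    and U1eq: "\<And>v w. v \<in> hcarrier P1 \<Longrightarrow> w \<in> hcarrier P2 \<Longrightarrow>
      (\<And>i. i \<in> ?J \<Longrightarrow> hinner P2 (?f' i) w = hinner P1 (?e' i) v) \<Longrightarrow> U1 v = w"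
    and U1f: "\<And>v i. v \<in> hcarrier P1 \<Longrightarrow> i \<in> ?J \<Longrightarrow> hinner P2 (?f' i) (U1 v) = hinner P1 (?e' i) v"
  proof (rule PP.unitary_of_gram_eq[of ?J ?e' ?f'])
    show "hclosed_span P1 (?e' ` ?J) = hcarrier P1"
    proof (rule A.P.hclosed_span_eq_carrierI)
      fix v assume v: "v \<in> hcarrier P1" and 0: "\<And>y. y \<in> ?e' ` ?J \<Longrightarrow> hinner P1 y v = 0"
      show "v = 0"
        by (rule A.total_pi_adj_pi_V[OF v], rule 0) (force intro: image_eqI)
    qed (use e' in blast)
    show "hclosed_span P2 (?f' ` ?J) = hcarrier P2"
    proof (rule B.P.hclosed_span_eq_carrierI)
      fix v assume v: "v \<in> hcarrier P2" and 0: "\<And>y. y \<in> ?f' ` ?J \<Longrightarrow> hinner P2 y v = 0"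
      show "v = 0"
        by (rule B.total_pi_adj_pi_V[OF v], rule 0) (force intro: image_eqI)
    qed (use f' in blast)
  qed (use e' f' in \<open>auto simp: A.pi_adj_pi_V_gram B.pi_adj_pi_V_gram\<close>)
  have U1mem: "U1 v \<in> hcarrier P2" if "v \<in> hcarrier P1" for v
    using U1 that by (auto simp: unitary_op_def bounded_ops_def)
  \<comment> \<open>A vector of \<open>Q2\<close> is determined by its products with the family
    \<open>?f\<close>. Moving \<open>\<pi>2 x\<close> to the other side produces a member of the
    family that defines \<open>U1\<close>.\<close>
  have "U2 (\<pi>1 x v) = \<pi>2 x (U1 v)" if v: "v \<in> hcarrier P1" for x v
  proof (rule U2eq)
    fix i :: "'x \<times> 'h" assume "i \<in> ?I"
    then obtain y h where i: "i = (y, h)" "h \<in> hcarrier H" by auto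
    have "hinner Q2 (\<pi>2 y (V2 h)) (\<pi>2 x (U1 v)) = hinner P2 (hadj P2 Q2 (\<pi>2 x) (\<pi>2 y (V2 h))) (U1 v)"
      using B.PQ.hadj_inner[OF B.pi_bounded _ U1mem[OF v]] i by simp
    also have "\<dots> = hinner P1 (hadj P1 Q1 (\<pi>1 x) (\<pi>1 y (V1 h))) v"
      using U1f[OF v, of "(x, y, h)"] i by simp
    also have "\<dots> = hinner Q1 (\<pi>1 y (V1 h)) (\<pi>1 x v)"
      using A.PQ.hadj_inner[OF A.pi_bounded _ v] i by simp
    finally show "hinner Q2 (?f i) (\<pi>2 x (U1 v)) = hinner Q1 (?e i) (\<pi>1 x v)" by (simp add: i)
  qed (use v U1mem in auto)
  \<comment> \<open>The product of \<pi>(x)* \<pi>(y) V g with V h equals that of \<pi>(y) V g with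
    \<pi>(x) V h, which depends on \<Phi> only.\<close>
  moreover have "V2 h = U1 (V1 h)" if h: "h \<in> hcarrier H" for h
  proof (rule U1eq[symmetric])
    fix i :: "'x \<times> 'x \<times> 'h" assume "i \<in> ?J"
    then obtain x y g where i: "i = (x, y, g)" "g \<in> hcarrier H" by auto
    show "hinner P2 (?f' i) (V2 h) = hinner P1 (?e' i) (V1 h)"
      using i h by (simp add: A.PQ.hadj_inner[OF A.pi_bounded] B.PQ.hadj_inner[OF B.pi_bounded]
          A.inner_pi_V_pi_V B.inner_pi_V_pi_V)
  qed (use h in auto)
  moreover have "W2 k = U2 (W1 k)" if k: "k \<in> hcarrier K" for k
    by (rule U2eq[symmetric]) (use k in \<open>auto simp: A.inner_pi_V_W B.inner_pi_V_W\<close>)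
  ultimately show ?thesis using U1 U2 by blast
qed

section \<open>Completely positive maps\<close>

locale cp_map = hilbert_space H for H :: "'h::complex_vector hilbert" +
  fixes \<phi> :: "'a::cstar_algebra \<Rightarrow> 'h \<Rightarrow> 'h"
  assumes cp: "completely_positive H \<phi>"
begin

lemma phi_bounded: "\<phi> a \<in> bounded_ops H H"
  and phi_add: "h \<in> hcarrier H \<Longrightarrow> \<phi> (a + b) h = \<phi> a h + \<phi> b h"
  and phi_scaleC: "h \<in> hcarrier H \<Longrightarrow> \<phi> (c *\<^sub>C a) h = c *\<^sub>C \<phi> a h"
  using cp by (auto simp: completely_positive_def linear_into_ops_def)

lemmas phi_mem [simp] = bounded_opsD(1)[OF phi_bounded]
lemmas phi_add_vector = bounded_opsD(2)[OF phi_bounded]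
lemmas phi_scaleC_vector = bounded_opsD(3)[OF phi_bounded]

lemma phi_minus: "h \<in> hcarrier H \<Longrightarrow> \<phi> (- a) h = - \<phi> a h"
  using phi_scaleC[of h "-1" a] by (simp add: scaleC_minus1)

lemma phi_diff: "h \<in> hcarrier H \<Longrightarrow> \<phi> (a - b) h = \<phi> a h - \<phi> b h"
  using phi_add[of h a "- b"] by (simp add: phi_minus)

lemma phi_zero: "h \<in> hcarrier H \<Longrightarrow> \<phi> 0 h = 0"
  using phi_scaleC[of h 0 0] by simp

lemma phi_scaleR: "h \<in> hcarrier H \<Longrightarrow> \<phi> (r *\<^sub>R a) h = complex_of_real r *\<^sub>C \<phi> a h"
  by (simp add: scaleR_scaleC phi_scaleC)

text \<open>The matrix with entries \<open>star (b i) * b j\<close> is B* B, where row 0 of B is the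
  family \<open>b\<close> and all other rows vanish, so complete positivity applies to it.\<close>

lemma gram_positive:
  assumes I: "finite I" and h: "\<And>i. i \<in> I \<Longrightarrow> h i \<in> hcarrier H"
  shows "(\<Sum>i\<in>I. \<Sum>j\<in>I. hinner H (h i) (\<phi> (star (b i) * b j) (h j))) \<in> \<real>\<^sub>\<ge>\<^sub>0"
proof -
  define n where "n = card I"
  obtain f where f: "bij_betw f {..<n} I"
    using ex_bij_betw_nat_finite[OF I] by (auto simp: n_def atLeast0LessThan)
  then have fI: "f i \<in> I" if "i < n" for i using that by (auto simp: bij_betw_def)
  let ?a = "\<lambda>i j. star (b (f i)) * b (f j)"
  have "cstar_matrix_positive n ?a"
    unfolding cstar_matrix_positive_def
  proof (intro exI allI impI)
    fix i j assume "i < n" "j < n"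
    have "(\<Sum>k<n. star (if k = 0 then b (f i) else 0) * (if k = 0 then b (f j) else 0))
        = (\<Sum>k<n. if k = 0 then ?a i j else 0)"
      by (intro sum.cong) auto
    then show "?a i j = (\<Sum>k<n. star (if k = 0 then b (f i) else 0) * (if k = 0 then b (f j) else 0))"
      using \<open>i < n\<close> by simp
  qed
  moreover have "\<forall>i<n. h (f i) \<in> hcarrier H" using h fI by auto
  ultimately have "(\<Sum>i<n. \<Sum>j<n. hinner H (h (f i)) (\<phi> (?a i j) (h (f j)))) \<in> \<real>\<^sub>\<ge>\<^sub>0"
    using cp unfolding completely_positive_def by (meson)
  then show ?thesis
    by (simp add: sum.reindex_bij_betw[OF f, of "\<lambda>j. hinner H _ (\<phi> (_ * b j) (h j))"]
        sum.reindex_bij_betw[OF f, of "\<lambda>i. \<Sum>j\<in>I. hinner H (h i) (\<phi> (star (b i) * b j) (h j))"])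
qed

lemma gram_nonneg:
  assumes "finite I" "\<And>i. i \<in> I \<Longrightarrow> h i \<in> hcarrier H"
  shows "0 \<le> Re (\<Sum>i\<in>I. \<Sum>j\<in>I. hinner H (h i) (\<phi> (star (b i) * b j) (h j)))"
  using gram_positive[OF assms] unfolding complex_nonneg_Reals_iff by (rule conjunct1)

lemma phi_nonneg: "h \<in> hcarrier H \<Longrightarrow> 0 \<le> Re (hinner H h (\<phi> (star b * b) h))"
  using gram_nonneg[of "{()}" "\<lambda>_. h" "\<lambda>_. b"] by simp

text \<open>The Gram form of the two pairs \<open>(a, h)\<close> and \<open>(b, g)\<close> is real.
  Taken for g it gives the imaginary part of the claim, taken for i g the real part.\<close>

lemma phi_commute:
  assumes h: "h \<in> hcarrier H" and g: "g \<in> hcarrier H"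
  shows "hinner H g (\<phi> (star b * a) h) = cnj (hinner H h (\<phi> (star a * b) g))"
proof -
  let ?X = "hinner H h (\<phi> (star a * b) g)" and ?Y = "hinner H g (\<phi> (star b * a) h)"
  have one: "Im (hinner H h (\<phi> (star a * a) h)) = 0" if "h \<in> hcarrier H" for a h
    using gram_positive[of "{()}" "\<lambda>_. h" "\<lambda>_. a"] that
    by (simp add: complex_nonneg_Reals_iff)
  have two: "Im (hinner H h (\<phi> (star a * b) g) + hinner H g (\<phi> (star b * a) h)) = 0"
    if "h \<in> hcarrier H" "g \<in> hcarrier H" for h g
  proof -
    have "(\<Sum>i\<in>{True, False}. \<Sum>j\<in>{True, False}. hinner H (if i then h else g)
        (\<phi> (star (if i then a else b) * (if j then a else b)) (if j then h else g))) \<in> \<real>\<^sub>\<ge>\<^sub>0"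
      by (rule gram_positive) (use that in auto)
    then have "Im (\<Sum>i\<in>{True, False}. \<Sum>j\<in>{True, False}. hinner H (if i then h else g)
        (\<phi> (star (if i then a else b) * (if j then a else b)) (if j then h else g))) = 0"
      unfolding complex_nonneg_Reals_iff by (rule conjunct2)
    then show ?thesis using one[OF that(1), of a] one[OF that(2), of b] by simp
  qed
  have "Im (?X + ?Y) = 0" by (rule two[OF h g])
  moreover have "Im (\<i> * ?X - \<i> * ?Y) = 0"
    using two[of h "\<i> *\<^sub>C g"] h g
    by (simp add: phi_scaleC_vector inner_scaleC_right inner_scaleC_left)
  ultimately show ?thesis by (simp add: complex_eq_iff)
qed

text \<open>After scaling, 1 - a*a = (1 - m)^2, so the difference of the two sides is the Gram form
  of the family b i - m b i.\<close>

lemma gram_mult_le: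
  assumes I: "finite I" and h: "\<And>i. i \<in> I \<Longrightarrow> h i \<in> hcarrier H"
  shows "Re (\<Sum>i\<in>I. \<Sum>j\<in>I. hinner H (h i) (\<phi> (star (b i) * (star a * a) * b j) (h j)))
    \<le> (norm a)\<^sup>2 * Re (\<Sum>i\<in>I. \<Sum>j\<in>I. hinner H (h i) (\<phi> (star (b i) * b j) (h j)))"
proof (cases "a = 0")
  case True
  then show ?thesis using h by (simp add: phi_zero)
next
  case False
  define r where "r = inverse ((norm a)\<^sup>2)"
  have r: "0 < r" using False by (simp add: r_def)
  define q where "q = r *\<^sub>R (star a * a)"
  have "star q = q" by (simp add: q_def star_scaleR star_mult star_star)
  moreover have "norm q \<le> 1" using False by (simp add: q_def r_def cstar_identity)
  ultimately obtain m where m: "star m = m" "m + m - m * m = q" using one_minus_square_root by metis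
  have eq: "star (b i - m * b i) * (b j - m * b j) = star (b i) * b j - star (b i) * q * b j" for i j
    unfolding m(2)[symmetric] by (simp add: star_diff star_mult m(1) algebra_simps)
  have q': "hinner H (h i) (\<phi> (star (b i) * q * b j) (h j))
      = complex_of_real r * hinner H (h i) (\<phi> (star (b i) * (star a * a) * b j) (h j))"
    if "i \<in> I" "j \<in> I" for i j
    using h that by (simp add: q_def phi_scaleR inner_scaleC_right)
  have "0 \<le> Re (\<Sum>i\<in>I. \<Sum>j\<in>I. hinner H (h i) (\<phi> (star (b i - m * b i) * (b j - m * b j)) (h j)))"
    by (rule gram_nonneg[OF I h])
  also have "\<dots> = Re (\<Sum>i\<in>I. \<Sum>j\<in>I. hinner H (h i) (\<phi> (star (b i) * b j) (h j))
      - complex_of_real r * hinner H (h i) (\<phi> (star (b i) * (star a * a) * b j) (h j)))"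
    unfolding eq using h
    by (intro arg_cong[where f = Re] sum.cong refl) (simp add: phi_diff inner_diff_right q')
  also have "\<dots> = Re (\<Sum>i\<in>I. \<Sum>j\<in>I. hinner H (h i) (\<phi> (star (b i) * b j) (h j)))
      - r * Re (\<Sum>i\<in>I. \<Sum>j\<in>I. hinner H (h i) (\<phi> (star (b i) * (star a * a) * b j) (h j)))"
    by (simp add: sum_subtractf sum_distrib_left)
  finally show ?thesis using r False by (simp add: r_def field_simps)
qed

text \<open>Automatic continuity by a gliding hump: the sum p of the 2^-(n+1) (a n)^2 satisfies
  \<open>\<phi>\<close> p \<ge> 2^-(n+1) \<open>\<phi>\<close> (a n)^2 for every n, since the remainder is again a square.\<close>

lemma phi_square_bounded:
  "\<exists>M\<ge>0. \<forall>a h. star a = a \<longrightarrow> norm a \<le> 1 \<longrightarrow> h \<in> hcarrier H \<longrightarrow>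
    Re (hinner H h (\<phi> (a * a) h)) \<le> M * (hnorm H h)\<^sup>2"
proof (rule ccontr)
  assume neg: "\<not> ?thesis"
  have "\<exists>a h. star a = a \<and> norm a \<le> 1 \<and> h \<in> hcarrier H \<and>
      4 ^ n * (hnorm H h)\<^sup>2 < Re (hinner H h (\<phi> (a * a) h))" for n :: nat
  proof (rule ccontr)
    assume "\<not> ?thesis"
    then have "\<forall>a h. star a = a \<longrightarrow> norm a \<le> 1 \<longrightarrow> h \<in> hcarrier H \<longrightarrow>
        Re (hinner H h (\<phi> (a * a) h)) \<le> 4 ^ n * (hnorm H h)\<^sup>2" by (meson not_le)
    then show False using neg by (meson zero_le_numeral zero_le_power)
  qed
  then obtain a h where sa: "\<And>n. star (a n) = a n" and na: "\<And>n. norm (a n) \<le> 1"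
    and h: "\<And>n::nat. h n \<in> hcarrier H"
    and big: "\<And>n. 4 ^ n * (hnorm H (h n))\<^sup>2 < Re (hinner H (h n) (\<phi> (a n * a n) (h n)))"
    by metis
  \<comment> \<open>The weights sum to 1, while t n 4^n = 2^n / 2 is unbounded; this is the reason
    for the growth 4^n above.\<close>
  define t where "t n = (1 / 2 :: real) ^ Suc n" for n
  have tpos: "0 < t n" for n by (simp add: t_def)
  have tsum: "t sums 1" unfolding t_def by (rule power_half_series)
  have "norm (t n *\<^sub>R (a n * a n)) \<le> t n" for n
  proof -
    have "norm (a n * a n) \<le> 1"
      using cstar_identity[of "a n"] na[of n] by (simp add: sa power_le_one)
    then show ?thesis using tpos[of n] by simp
  qed
  then have "summable (\<lambda>n. t n *\<^sub>R (a n * a n))"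
    by (intro summable_comparison_test[OF _ sums_summable[OF tsum]]) auto
  then obtain p where p: "(\<lambda>n. t n *\<^sub>R (a n * a n)) sums p" by (auto simp: summable_def)
  obtain C where C: "0 \<le> C" "\<And>x. x \<in> hcarrier H \<Longrightarrow> hnorm H (\<phi> p x) \<le> C * hnorm H x"
    using bounded_ops_bound[OF phi_bounded hilbert_space_axioms] by blast
  have key: "t n * Re (hinner H x (\<phi> (a n * a n) x)) \<le> C * (hnorm H x)\<^sup>2"
    if x: "x \<in> hcarrier H" for n x
  proof -
    define p' where "p' = p - t n *\<^sub>R (a n * a n)"
    define r where "r k = (if k = n then 0 else t k)" for k
    have "(\<lambda>k. t k *\<^sub>R (a k * a k) - (if k = n then t k *\<^sub>R (a k * a k) else 0)) sums p'"
      unfolding p'_def by (intro sums_diff p sums_single)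
    moreover have "t k *\<^sub>R (a k * a k) - (if k = n then t k *\<^sub>R (a k * a k) else 0) = r k *\<^sub>R (a k * a k)" for k
      by (simp add: r_def)
    ultimately have p': "(\<lambda>k. r k *\<^sub>R (a k * a k)) sums p'" by simp
    have "star p' = p'"
    proof -
      have "(\<lambda>k. star (r k *\<^sub>R (a k * a k))) sums star p'"
        by (rule bounded_linear.sums[OF bounded_linear_star p'])
      then show ?thesis using p' by (simp add: star_scaleR star_mult sa sums_unique2)
    qed
    \<comment> \<open>1 minus a partial sum is a convex combination of 1, with weight
      \<open>1 - ?R\<close>, and of the contractions 1 - (a k)^2. The bound passes to the limit and
      is the hypothesis for the square root of \<open>p'\<close>.\<close>
    moreover have "norm (y - p' * y) \<le> norm y" for y
    proof (rule LIMSEQ_le_const2)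
      show "(\<lambda>N. norm (y - (\<Sum>k<N. r k *\<^sub>R (a k * a k)) * y)) \<longlonglongrightarrow> norm (y - p' * y)"
        using p' unfolding sums_def by (intro tendsto_intros)
      have "norm (y - (\<Sum>k<N. r k *\<^sub>R (a k * a k)) * y) \<le> norm y" for N
      proof -
        let ?R = "\<Sum>k<N. r k"
        have r0: "0 \<le> r k" for k using tpos[of k] by (simp add: r_def)
        have "?R \<le> (\<Sum>k<N. t k)" using tpos by (intro sum_mono) (simp add: r_def less_imp_le)
        also have "\<dots> \<le> 1" using sum_le_suminf[OF sums_summable[OF tsum], of "{..<N}"] tpos
            sums_unique[OF tsum] by (simp add: less_imp_le)
        finally have R: "?R \<le> 1" .
        have "y - (\<Sum>k<N. r k *\<^sub>R (a k * a k)) * y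
            = (1 - ?R) *\<^sub>R y + (\<Sum>k<N. r k *\<^sub>R (y - a k * a k * y))"
          by (simp add: sum_distrib_right scaleR_right_diff_distrib sum_subtractf scaleR_left_diff_distrib
              scaleR_sum_left mult_scaleR_left)
        also have "norm \<dots> \<le> (1 - ?R) * norm y + (\<Sum>k<N. r k * norm y)"
        proof (intro order_trans[OF norm_triangle_ineq] add_mono sum_norm_le)
          show "norm ((1 - ?R) *\<^sub>R y) \<le> (1 - ?R) * norm y" using R by simp
          show "norm (r k *\<^sub>R (y - a k * a k * y)) \<le> r k * norm y" for k
            using mult_left_mono[OF one_minus_square_contraction[OF sa na] r0] r0[of k] by simp
        qed
        also have "\<dots> = norm y" by (simp add: left_diff_distrib flip: sum_distrib_right)
        finally show ?thesis .
      qed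
      then show "\<exists>N. \<forall>n\<ge>N. norm (y - (\<Sum>k<n. r k *\<^sub>R (a k * a k)) * y) \<le> norm y" by blast
    qed
    ultimately obtain s where s: "star s = s" "s * s = p'" using self_adjoint_square_root by blast
    have "0 \<le> Re (hinner H x (\<phi> p' x))" using phi_nonneg[OF x, of s] s by simp
    also have "\<dots> = Re (hinner H x (\<phi> p x)) - t n * Re (hinner H x (\<phi> (a n * a n) x))"
      using x by (simp add: p'_def phi_diff phi_scaleR inner_diff_right inner_scaleC_right)
    also have "Re (hinner H x (\<phi> p x)) \<le> hnorm H x * hnorm H (\<phi> p x)"
      using Cauchy_Schwarz[OF x phi_mem[OF x]] complex_Re_le_cmod order_trans by blast
    also have "\<dots> \<le> hnorm H x * (C * hnorm H x)" using C x by (intro mult_left_mono) auto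
    finally show ?thesis by (simp add: power2_eq_square mult_ac)
  qed
  obtain n where n: "2 * C < 2 ^ n" using real_arch_pow[of 2 "2 * C"] by auto
  have hp: "0 < (hnorm H (h n))\<^sup>2"
  proof (rule ccontr)
    assume "\<not> ?thesis"
    then have "hnorm H (h n) = 0" by simp
    then show False using big[of n] hnorm_eq_0_inner[OF h phi_mem[OF h]] by simp
  qed
  have "t n * (4 ^ n * (hnorm H (h n))\<^sup>2) < C * (hnorm H (h n))\<^sup>2"
    using key[OF h, of n n] mult_strict_left_mono[OF big tpos, of n n] by linarith
  then have "t n * 4 ^ n < C" using hp by (simp flip: mult.assoc)
  moreover have "t n * 4 ^ n = 2 ^ n / 2"
    by (simp add: t_def flip: power_mult_distrib)
  ultimately show False using n by simp
qed

text \<open>With b = r + i s for self-adjoint r and s, the sum b* b + b b* equals 2 (r^2 + s^2), and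
  it dominates the first term since \<open>\<phi> (b * star b)\<close> is nonnegative. This reduces
  the bound to squares of self-adjoint elements of norm at most ||b||; the factor 4 counts
  them.\<close>

lemma phi_star_mult_bounded:
  "\<exists>M\<ge>0. \<forall>b. \<forall>h\<in>hcarrier H. Re (hinner H h (\<phi> (star b * b) h)) \<le> M * (norm b)\<^sup>2 * (hnorm H h)\<^sup>2"
proof -
  obtain M where M0: "0 \<le> M" and M: "\<And>a h. star a = a \<Longrightarrow> norm a \<le> 1 \<Longrightarrow> h \<in> hcarrier H \<Longrightarrow>
    Re (hinner H h (\<phi> (a * a) h)) \<le> M * (hnorm H h)\<^sup>2"
    using phi_square_bounded by blast
  have sq: "Re (hinner H h (\<phi> (a * a) h)) \<le> M * B\<^sup>2 * (hnorm H h)\<^sup>2"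
    if sa: "star a = a" and h: "h \<in> hcarrier H" and B: "norm a \<le> B" for a h B
  proof -
    have "Re (hinner H h (\<phi> (a * a) h)) \<le> M * (norm a)\<^sup>2 * (hnorm H h)\<^sup>2"
    proof (cases "a = 0")
      case True
      then show ?thesis using h by (simp add: phi_zero)
    next
      case False
      define \<rho> where "\<rho> = inverse (norm a)"
      have "Re (hinner H h (\<phi> ((\<rho> *\<^sub>R a) * (\<rho> *\<^sub>R a)) h)) \<le> M * (hnorm H h)\<^sup>2"
        by (rule M) (use sa False h in \<open>simp_all add: star_scaleR \<rho>_def\<close>)
      then have "\<rho>\<^sup>2 * Re (hinner H h (\<phi> (a * a) h)) \<le> M * (hnorm H h)\<^sup>2"
        using h by (simp add: phi_scaleR inner_scaleC_right power2_eq_square mult.assoc)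
      then show ?thesis using False by (simp add: \<rho>_def field_simps)
    qed
    also have "\<dots> \<le> M * B\<^sup>2 * (hnorm H h)\<^sup>2"
      using B M0 by (intro mult_right_mono mult_left_mono power_mono) auto
    finally show ?thesis .
  qed
  have "Re (hinner H h (\<phi> (star b * b) h)) \<le> 4 * M * (norm b)\<^sup>2 * (hnorm H h)\<^sup>2"
    if h: "h \<in> hcarrier H" for b h
  proof -
    define r where "r = (1/2) *\<^sub>R (b + star b)"
    define d where "d = (1/2) *\<^sub>R (b - star b)"
    define s where "s = (- \<i>) *\<^sub>C d"
    have r: "star r = r" by (simp add: r_def star_scaleR star_add star_star add.commute)
    have d: "star d = - d"
      unfolding d_def by (simp add: star_scaleR star_diff star_star flip: scaleR_minus_right)
    have s: "star s = s" by (simp add: s_def star_scaleC star_minus d scaleC_minus_left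
          scaleC_module.scale_minus_right)
    have "(- \<i>) *\<^sub>C ((- \<i>) *\<^sub>C x) = - x" for x :: 'a
      by (simp add: scaleC_scaleC scaleC_minus1)
    then have ss: "s * s = - (d * d)"
      by (simp add: s_def mult_scaleC_left mult_scaleC_right)
    have nr: "norm r \<le> norm b" using norm_triangle_ineq[of b "star b"] by (simp add: r_def)
    have "norm s = norm d" by (simp add: s_def norm_scaleC)
    also have "\<dots> \<le> norm b" using norm_triangle_ineq4[of b "star b"] by (simp add: d_def)
    finally have ns: "norm s \<le> norm b" .
    have b: "b = r + d" "star b = r - d"
      by (simp_all add: r_def d_def flip: scaleR_add_right scaleR_diff_right)
    have eq: "star b * b + star (star b) * star b = (r * r + s * s) + (r * r + s * s)"
      unfolding star_star unfolding b(2) unfolding b(1) ss by (simp add: algebra_simps)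
    have "Re (hinner H h (\<phi> (star b * b) h))
        \<le> Re (hinner H h (\<phi> (star b * b) h)) + Re (hinner H h (\<phi> (star (star b) * star b) h))"
      using phi_nonneg[OF h, of "star b"] by simp
    also have "\<dots> = Re (hinner H h (\<phi> (star b * b + star (star b) * star b) h))"
      using h by (simp add: phi_add inner_add_right)
    also have "\<dots> = 2 * Re (hinner H h (\<phi> (r * r) h)) + 2 * Re (hinner H h (\<phi> (s * s) h))"
      unfolding eq using h by (simp add: phi_add inner_add_right)
    also have "\<dots> \<le> 4 * M * (norm b)\<^sup>2 * (hnorm H h)\<^sup>2"
      using sq[OF r h nr] sq[OF s h ns] by simp
    finally show ?thesis .
  qed
  then show ?thesis using M0 by (intro exI[of _ "4 * M"]) simp
qed

section \<open>The kernel of a completely positive map\<close>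

definition ker :: "'a \<times> 'h \<Rightarrow> 'a \<times> 'h \<Rightarrow> complex" where
  "ker s t = hinner H (snd s) (\<phi> (star (fst s) * fst t) (snd t))"

lemma ker_sum:
  assumes "T \<subseteq> UNIV \<times> hcarrier H"
  shows "(\<Sum>s\<in>T. \<Sum>t\<in>T. cnj (c s) * c t * ker s t)
    = (\<Sum>s\<in>T. \<Sum>t\<in>T. hinner H (c s *\<^sub>C snd s) (\<phi> (star (fst s) * fst t) (c t *\<^sub>C snd t)))"
proof (intro sum.cong refl)
  fix s t assume "s \<in> T" "t \<in> T"
  then have "snd s \<in> hcarrier H" "snd t \<in> hcarrier H" using assms by auto
  then show "cnj (c s) * c t * ker s t
      = hinner H (c s *\<^sub>C snd s) (\<phi> (star (fst s) * fst t) (c t *\<^sub>C snd t))"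
    by (simp add: ker_def phi_scaleC_vector inner_scaleC_left inner_scaleC_right)
qed

lemma positive_kernel_ker:
  assumes "S \<subseteq> UNIV \<times> hcarrier H"
  shows "positive_kernel S ker"
proof
  fix s t assume "s \<in> S" "t \<in> S"
  then have "snd s \<in> hcarrier H" "snd t \<in> hcarrier H" using assms by auto
  then show "ker t s = cnj (ker s t)" unfolding ker_def by (rule phi_commute)
next
  fix T and c :: "'a \<times> 'h \<Rightarrow> complex" assume T: "finite T" "T \<subseteq> S"
  then have "T \<subseteq> UNIV \<times> hcarrier H" using assms by blast
  then show "0 \<le> Re (\<Sum>s\<in>T. \<Sum>t\<in>T. cnj (c s) * c t * ker s t)"
    unfolding ker_sum[OF \<open>T \<subseteq> UNIV \<times> hcarrier H\<close>] using T(1) by (intro gram_nonneg) auto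
qed

end

section \<open>The Stinespring construction\<close>

locale cp_module = cp_map H \<phi> + K: hilbert_space K + X: hilbert_module act ip
  for H :: "'h::complex_vector hilbert" and K :: "'k::complex_vector hilbert"
    and act :: "'x::{complex_normed_vector, banach} \<Rightarrow> 'a::cstar_algebra \<Rightarrow> 'x"
    and ip :: "'x \<Rightarrow> 'x \<Rightarrow> 'a" and \<phi> :: "'a \<Rightarrow> 'h \<Rightarrow> 'h" +
  fixes \<Phi> :: "'x \<Rightarrow> 'h \<Rightarrow> 'k"
  assumes Phi_bounded: "\<Phi> x \<in> bounded_ops H K"
    and Phi_adj: "h \<in> hcarrier H \<Longrightarrow> hadj H K (\<Phi> x) (\<Phi> y h) = \<phi> (ip x y) h"
begin

sublocale HK: hilbert_pair H K by unfold_locales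

lemmas Phi_mem [simp] = bounded_opsD(1)[OF Phi_bounded]
lemmas Phi_scaleC_vector = bounded_opsD(3)[OF Phi_bounded]

lemma inner_Phi:
  assumes "h \<in> hcarrier H" "g \<in> hcarrier H"
  shows "hinner K (\<Phi> x h) (\<Phi> y g) = hinner H h (\<phi> (ip x y) g)"
  using HK.hadj_inner_right[OF Phi_bounded Phi_mem[OF assms(2)] assms(1)] Phi_adj[OF assms(2)] by simp

lemma ip_act_left: "ip (act x a) y = star a * ip x y"
  using X.ip_act_right[of y x a] X.star_ip star_mult[of "ip y x" a] by metis

lemma ip_diff_right: "ip x (y - z) = ip x y - ip x z"
  using X.ip_add_right[of x "y - z" z] by (simp add: algebra_simps)

lemma ip_diff_left: "ip (x - y) z = ip x z - ip y z"
  using ip_diff_right[of z x y] X.star_ip star_diff by metis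

lemma ip_eq_star_mult:
  obtains b where "ip x x = star b * b" "norm b = norm x"
proof -
  obtain b where b: "ip x x = star b * b" using X.ip_positive[of x] by (auto simp: cstar_positive_def)
  then have "norm x = norm b" by (simp add: X.norm_eq cstar_identity)
  with b show thesis using that by simp
qed

text \<open>\<open>\<Phi>\<close> is not assumed linear. Since <\<Phi>(x) h, \<Phi>(y) g> is
  additive in x and in y, the difference of the two sides has norm 0.\<close>

lemma Phi_diff:
  assumes h: "h \<in> hcarrier H"
  shows "\<Phi> (x - y) h = \<Phi> x h - \<Phi> y h"
proof -
  let ?d = "\<Phi> (x - y) h - (\<Phi> x h - \<Phi> y h)"
  have "hinner K ?d ?d = 0"
    using h by (simp add: K.inner_diff_left K.inner_diff_right inner_Phi ip_diff_left ip_diff_right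
        phi_diff inner_diff_right)
  then have "?d = 0" by (rule K.hinner_definite[rotated]) (use h in simp)
  then show ?thesis by simp
qed

text \<open>The first coordinates are closed under left multiplication and scalars, though in
  general not under sums. This suffices, as the functions in \<open>E.E\<close> inherit additivity
  from the kernel wherever it can be stated.\<close>

definition S :: "('a \<times> 'h) set" where "S = {ip x y | x y. True} \<times> hcarrier H"

lemma S_subset: "S \<subseteq> UNIV \<times> hcarrier H" by (auto simp: S_def)

lemma ip_mem_S: "h \<in> hcarrier H \<Longrightarrow> (ip x y, h) \<in> S" by (auto simp: S_def)

lemma mult_mem_S: "(a, g) \<in> S \<Longrightarrow> (c * a, g) \<in> S"
proof -
  assume "(a, g) \<in> S"
  then obtain x y where "a = ip x y" "g \<in> hcarrier H" by (auto simp: S_def)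
  then show ?thesis using ip_act_left[of x "star c" y] ip_mem_S[of g "act x (star c)" y] by (simp add: star_star)
qed

lemma scaleC_mem_S: "(a, g) \<in> S \<Longrightarrow> (c *\<^sub>C a, g) \<in> S"
  by (auto simp: S_def) (metis X.ip_scaleC_right)

sublocale E: positive_kernel S ker
  by (rule positive_kernel_ker[OF S_subset])

text \<open>The unrestricted index set serves for the Cauchy-Schwarz inequality against
  \<open>(e, h)\<close> with \<open>e\<close> from an approximate unit, where \<open>e\<close> may
  fail to be an inner product.\<close>

sublocale A: positive_kernel "UNIV \<times> hcarrier H" ker
  by (rule positive_kernel_ker) simp

definition vec :: "'a \<Rightarrow> 'h \<Rightarrow> 'a \<times> 'h \<Rightarrow> complex" where
  "vec a g = E.ev (E.delta (a, g))"

lemma vec_mem: "(a, g) \<in> S \<Longrightarrow> vec a g \<in> hcarrier E.E"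
  unfolding vec_def by (intro E.ev_mem E.delta_mem)

lemma vec_eq: "vec a g s = (if s \<in> S then ker s (a, g) else 0)"
  by (simp add: vec_def E.ev_delta)

lemma inner_vec: "(a, g) \<in> S \<Longrightarrow> v \<in> hcarrier E.E \<Longrightarrow> hinner E.E (vec a g) v = v (a, g)"
  unfolding vec_def by (rule E.reproducing)

lemma E_ext:
  assumes "v \<in> hcarrier E.E" "w \<in> hcarrier E.E" "\<And>a g. (a, g) \<in> S \<Longrightarrow> v (a, g) = w (a, g)"
  shows "v = w"
proof
  show "v s = w s" for s
    using assms(3)[of "fst s" "snd s"] E.E_outside[OF assms(1), of s] E.E_outside[OF assms(2), of s]
    by (cases "s \<in> S") auto
qed

text \<open>The value of \<open>v\<close> at \<open>(a, g)\<close> is its product with a kernel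
  vector, and kernel vectors are additive in \<open>a\<close>.\<close>

lemma E_add:
  assumes "v \<in> hcarrier E.E" "(a, g) \<in> S" "(b, g) \<in> S" "(a + b, g) \<in> S"
  shows "v (a + b, g) = v (a, g) + v (b, g)"
proof -
  have g: "g \<in> hcarrier H" using assms(2) by (auto simp: S_def)
  have "vec (a + b) g = vec a g + vec b g"
    using g by (auto simp: fun_eq_iff vec_eq ker_def S_def distrib_left phi_add inner_add_right)
  then show ?thesis
    using assms E.E.inner_add_left[of "vec a g" "vec b g" v] by (simp add: vec_mem flip: inner_vec)
qed

lemma E_scaleC:
  assumes "v \<in> hcarrier E.E" "(a, g) \<in> S"
  shows "v (c *\<^sub>C a, g) = cnj c * v (a, g)"
proof -
  have g: "g \<in> hcarrier H" using assms(2) by (auto simp: S_def)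
  have "vec (c *\<^sub>C a) g = c *\<^sub>C vec a g"
    using g by (auto simp: fun_eq_iff vec_eq ker_def S_def scaleC_fun_apply mult_scaleC_right
        phi_scaleC inner_scaleC_right)
  then show ?thesis
    using assms E.E.inner_scaleC_left[of "vec a g" v c] scaleC_mem_S[OF assms(2)]
    by (simp add: vec_mem flip: inner_vec)
qed

text \<open>The adjoint of the representation: T x k is the functional a \<otimes> g \<mapsto> \<open>\<langle>\<Phi>(xa)g, k\<rangle>\<close>.\<close>

definition T :: "'x \<Rightarrow> 'k \<Rightarrow> 'a \<times> 'h \<Rightarrow> complex" where
  "T x k = (\<lambda>(a, g). if (a, g) \<in> S then hinner K (\<Phi> (act x a) g) k else 0)"

text \<open>A combination of values of \<open>T x k\<close> is <y, k>, where y is a sum of vectors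
  \<Phi>(xa)(c g), and |y|^2 is the Gram form with <x,x> = b* b inserted in the middle.
  \<open>gram_mult_le\<close> removes it at the cost of ||b||^2 = ||x||^2, which leaves the bound
  required by \<open>memI_of_bound\<close>.\<close>

lemma T_mem:
  assumes k: "k \<in> hcarrier K"
  shows "T x k \<in> hcarrier E.E" and "hnorm E.E (T x k) \<le> norm x * hnorm K k"
proof -
  have bound: "cmod (\<Sum>s\<in>J. cnj (c s) * T x k s)
      \<le> norm x * hnorm K k * sqrt (Re (\<Sum>s\<in>J. \<Sum>t\<in>J. cnj (c s) * c t * ker s t))"
    if J: "finite J" "J \<subseteq> S" for J c
  proof -
    define z where "z s = \<Phi> (act x (fst s)) (c s *\<^sub>C snd s)" for s
    define y where "y = (\<Sum>s\<in>J. z s)"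
    have sndJ: "s \<in> J \<Longrightarrow> snd s \<in> hcarrier H" for s using J(2) by (auto simp: S_def)
    have JU: "J \<subseteq> UNIV \<times> hcarrier H" using J(2) S_subset by blast
    have z: "z s \<in> hcarrier K" if "s \<in> J" for s using sndJ[OF that] by (simp add: z_def)
    have y: "y \<in> hcarrier K" unfolding y_def using z by (rule K.sum_mem)
    have "(\<Sum>s\<in>J. cnj (c s) * T x k s) = (\<Sum>s\<in>J. hinner K (z s) k)"
      using J(2) sndJ k
      by (intro sum.cong refl)
         (auto simp: T_def z_def case_prod_beta Phi_scaleC_vector K.inner_scaleC_left)
    also have "\<dots> = hinner K y k"
      unfolding y_def using z k by (simp add: K.inner_sum_left)
    finally have eq: "(\<Sum>s\<in>J. cnj (c s) * T x k s) = hinner K y k" .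
    obtain b where b: "ip x x = star b * b" "norm b = norm x" using ip_eq_star_mult .
    have "hinner K y y = (\<Sum>s\<in>J. \<Sum>t\<in>J. hinner K (z s) (z t))"
      unfolding y_def using z by (simp add: K.inner_sum_left K.inner_sum_right K.sum_mem) (rule sum.swap)
    also have "\<dots> = (\<Sum>s\<in>J. \<Sum>t\<in>J. hinner H (c s *\<^sub>C snd s)
        (\<phi> (star (fst s) * (star b * b) * fst t) (c t *\<^sub>C snd t)))"
      using sndJ by (intro sum.cong refl)
        (simp add: z_def inner_Phi ip_act_left X.ip_act_right b(1) mult.assoc)
    finally have "(hnorm K y)\<^sup>2 = Re (\<Sum>s\<in>J. \<Sum>t\<in>J. hinner H (c s *\<^sub>C snd s)
        (\<phi> (star (fst s) * (star b * b) * fst t) (c t *\<^sub>C snd t)))"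
      using K.hnorm_sq[OF y] by simp
    also have "\<dots> \<le> (norm x)\<^sup>2 * Re (\<Sum>s\<in>J. \<Sum>t\<in>J. cnj (c s) * c t * ker s t)"
      unfolding ker_sum[OF JU] b(2)[symmetric] using J(1) sndJ by (intro gram_mult_le) auto
    finally have "hnorm K y \<le> norm x * sqrt (Re (\<Sum>s\<in>J. \<Sum>t\<in>J. cnj (c s) * c t * ker s t))"
      using real_le_rsqrt by (fastforce simp: real_sqrt_mult)
    then show ?thesis
      unfolding eq using K.Cauchy_Schwarz[OF y k] K.hnorm_nonneg[OF k]
        mult_right_mono[of "hnorm K y" _ "hnorm K k"] by (fastforce simp: mult_ac)
  qed
  have out: "T x k s = 0" if "s \<notin> S" for s using that by (cases s) (simp add: T_def)
  have C: "0 \<le> norm x * hnorm K k" using k by simp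
  show "T x k \<in> hcarrier E.E" "hnorm E.E (T x k) \<le> norm x * hnorm K k"
    by (rule E.memI_of_bound[OF out C bound], assumption+)+
qed

text \<open>This makes the kernel vectors members of the family in (c), and it reduces products with
  \<open>\<Phi> y g\<close> to point evaluations.\<close>

lemma T_Phi:
  assumes g: "g \<in> hcarrier H"
  shows "T x (\<Phi> y g) = vec (ip x y) g"
proof
  show "T x (\<Phi> y g) s = vec (ip x y) g s" for s
    using g by (cases s) (auto simp: T_def vec_eq ker_def S_def inner_Phi ip_act_left)
qed

section \<open>The target space and the representation of the module\<close>

definition KP :: "'k hilbert" where
  "KP = \<lparr>hcarrier = hclosed_span K {\<Phi> x h | x h. h \<in> hcarrier H}, hinner = hinner K\<rparr>"

lemma Phi_range: "{\<Phi> x h | x h. h \<in> hcarrier H} \<subseteq> hcarrier K" by auto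

lemma KP_sub: "k \<in> hcarrier KP \<Longrightarrow> k \<in> hcarrier K"
  by (simp add: KP_def hclosed_span_def)

lemma hinner_KP: "hinner KP = hinner K" by (simp add: KP_def)

lemma hnorm_KP: "hnorm KP = hnorm K" by (simp add: fun_eq_iff hnorm_def hinner_KP)

lemma Phi_mem_KP: "h \<in> hcarrier H \<Longrightarrow> \<Phi> x h \<in> hcarrier KP"
  using K.subset_hclosed_span[OF Phi_range] by (auto simp: KP_def)

sublocale KP: hilbert_space KP
  unfolding KP_def by (rule K.hcomplete_hclosed_span[OF Phi_range])

lemma span_KP: "hclosed_span KP {\<Phi> x h | x h. h \<in> hcarrier H} = hcarrier KP"
proof -
  have "{\<Phi> x h | x h. h \<in> hcarrier H} \<subseteq> hcarrier KP" using Phi_mem_KP by auto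
  then show ?thesis
    unfolding hclosed_span_def hnorm_KP by (auto simp: KP_def hclosed_span_def)
qed

lemma KP_ext:
  assumes "k \<in> hcarrier KP" "l \<in> hcarrier KP"
    "\<And>y g. g \<in> hcarrier H \<Longrightarrow> hinner K (\<Phi> y g) k = hinner K (\<Phi> y g) l"
  shows "k = l"
proof -
  have "k - l = 0"
    by (rule KP.total_of_hclosed_span[OF _ span_KP])
       (use assms Phi_mem_KP KP_sub in \<open>auto simp: hinner_KP K.inner_diff_right\<close>)
  then show ?thesis by simp
qed

sublocale KPE: hilbert_pair KP E.E by unfold_locales
sublocale EKP: hilbert_pair E.E KP by unfold_locales
sublocale EE: hilbert_pair E.E E.E by unfold_locales
sublocale KPK: hilbert_pair KP K by unfold_locales

lemma T_bounded: "T x \<in> bounded_ops KP E.E"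
proof (rule bounded_opsI[where C = "norm x"])
  show "T x (k + l) = T x k + T x l" if "k \<in> hcarrier KP" "l \<in> hcarrier KP" for k l
    using that by (auto simp: fun_eq_iff T_def S_def KP_sub K.inner_add_right)
  show "T x (c *\<^sub>C k) = c *\<^sub>C T x k" if "k \<in> hcarrier KP" for c k
    using that by (auto simp: fun_eq_iff T_def S_def KP_sub K.inner_scaleC_right scaleC_fun_apply)
qed (simp_all add: T_mem KP_sub hnorm_KP)

text \<open>On kernel vectors this is a \<otimes> g \<mapsto> \<Phi>(xa) g. As the adjoint of the
  explicit operator \<open>T x\<close> it is defined on the whole space at once.\<close>

definition rep :: "'x \<Rightarrow> ('a \<times> 'h \<Rightarrow> complex) \<Rightarrow> 'k" where "rep x = hadj KP E.E (T x)"

lemma rep_bounded: "rep x \<in> bounded_ops E.E KP"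
  unfolding rep_def by (rule KPE.hadj_bounded_ops[OF T_bounded])

lemma rep_mem: "v \<in> hcarrier E.E \<Longrightarrow> rep x v \<in> hcarrier KP"
  by (rule bounded_opsD(1)[OF rep_bounded])

lemma rep_adj: "k \<in> hcarrier KP \<Longrightarrow> hadj E.E KP (rep x) k = T x k"
  unfolding rep_def by (rule KPE.hadj_hadj[OF T_bounded])

lemma inner_rep: "k \<in> hcarrier KP \<Longrightarrow> v \<in> hcarrier E.E \<Longrightarrow>
    hinner K k (rep x v) = hinner E.E (T x k) v"
  using KPE.hadj_inner_right[OF T_bounded] by (simp add: rep_def hinner_KP)

text \<open>This is left multiplication c (a \<otimes> g) = (ca) \<otimes> g. For the functions,
  which are products with a \<otimes> g, it moves to the index as its adjoint, hence
  \<open>star c\<close>.\<close>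

definition alg_rep :: "'a \<Rightarrow> ('a \<times> 'h \<Rightarrow> complex) \<Rightarrow> 'a \<times> 'h \<Rightarrow> complex" where
  "alg_rep c v = (\<lambda>(a, g). if (a, g) \<in> S then v (star c * a, g) else 0)"

text \<open>As for \<open>T x\<close>, combinations of values are products with a vector y, here a
  combination of the kernel vectors at \<open>(star c * a, g)\<close>; its norm is controlled by
  \<open>gram_mult_le\<close> applied to \<open>star c\<close>.\<close>

lemma alg_rep_mem:
  assumes v: "v \<in> hcarrier E.E"
  shows "alg_rep c v \<in> hcarrier E.E" and "hnorm E.E (alg_rep c v) \<le> norm c * hnorm E.E v"
proof -
  have bound: "cmod (\<Sum>s\<in>J. cnj (d s) * alg_rep c v s)
      \<le> norm c * hnorm E.E v * sqrt (Re (\<Sum>s\<in>J. \<Sum>t\<in>J. cnj (d s) * d t * ker s t))"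
    if J: "finite J" "J \<subseteq> S" for J d
  proof -
    define z where "z s = vec (star c * fst s) (snd s)" for s
    define y where "y = (\<Sum>s\<in>J. d s *\<^sub>C z s)"
    have sndJ: "s \<in> J \<Longrightarrow> snd s \<in> hcarrier H" for s using J(2) by (auto simp: S_def)
    have JU: "J \<subseteq> UNIV \<times> hcarrier H" using J(2) S_subset by blast
    have mS: "(star c * fst s, snd s) \<in> S" if "s \<in> J" for s
      using J(2) that mult_mem_S[of "fst s" "snd s"] by auto
    have z: "z s \<in> hcarrier E.E" if "s \<in> J" for s
      unfolding z_def by (rule vec_mem[OF mS[OF that]])
    have zv: "hinner E.E (z s) w = w (star c * fst s, snd s)" if "s \<in> J" "w \<in> hcarrier E.E" for s w
      unfolding z_def by (rule inner_vec[OF mS[OF that(1)] that(2)])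
    have y: "y \<in> hcarrier E.E" unfolding y_def using z by (intro E.E.sum_mem) simp
    have "(\<Sum>s\<in>J. cnj (d s) * alg_rep c v s) = (\<Sum>s\<in>J. hinner E.E (d s *\<^sub>C z s) v)"
    proof (intro sum.cong refl)
      fix s assume s: "s \<in> J"
      have "alg_rep c v s = v (star c * fst s, snd s)"
        using s J(2) by (auto simp: alg_rep_def case_prod_beta)
      then show "cnj (d s) * alg_rep c v s = hinner E.E (d s *\<^sub>C z s) v"
        using z[OF s] v by (simp add: E.E.inner_scaleC_left zv[OF s v])
    qed
    also have "\<dots> = hinner E.E y v"
      unfolding y_def using z v by (simp add: E.E.inner_sum_left)
    finally have eq: "(\<Sum>s\<in>J. cnj (d s) * alg_rep c v s) = hinner E.E y v" .
    have "hinner E.E y y = (\<Sum>s\<in>J. \<Sum>t\<in>J. hinner E.E (d s *\<^sub>C z s) (d t *\<^sub>C z t))"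
      unfolding y_def using z by (simp add: E.E.inner_sum_left E.E.inner_sum_right E.E.sum_mem) (rule sum.swap)
    also have "\<dots> = (\<Sum>s\<in>J. \<Sum>t\<in>J. cnj (d s) * d t * ker (star c * fst s, snd s) (star c * fst t, snd t))"
    proof (intro sum.cong refl)
      fix s t assume s: "s \<in> J" and t: "t \<in> J"
      have "z t (star c * fst s, snd s) = ker (star c * fst s, snd s) (star c * fst t, snd t)"
        using mS[OF s] by (simp add: z_def vec_eq)
      then show "hinner E.E (d s *\<^sub>C z s) (d t *\<^sub>C z t)
          = cnj (d s) * d t * ker (star c * fst s, snd s) (star c * fst t, snd t)"
        using z[OF s] z[OF t]
        by (simp add: E.E.inner_scaleC_left E.E.inner_scaleC_right zv[OF s z[OF t]])
    qed
    also have "\<dots> = (\<Sum>s\<in>J. \<Sum>t\<in>J. hinner H (d s *\<^sub>C snd s)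
        (\<phi> (star (fst s) * (star (star c) * star c) * fst t) (d t *\<^sub>C snd t)))"
      using sndJ by (intro sum.cong refl)
        (simp add: ker_def phi_scaleC_vector inner_scaleC_left inner_scaleC_right star_mult mult.assoc)
    finally have "(hnorm E.E y)\<^sup>2 = Re (\<Sum>s\<in>J. \<Sum>t\<in>J. hinner H (d s *\<^sub>C snd s)
        (\<phi> (star (fst s) * (star (star c) * star c) * fst t) (d t *\<^sub>C snd t)))"
      using E.E.hnorm_sq[OF y] by simp
    also have "\<dots> \<le> (norm c)\<^sup>2 * Re (\<Sum>s\<in>J. \<Sum>t\<in>J. cnj (d s) * d t * ker s t)"
      unfolding ker_sum[OF JU] norm_star[of c, symmetric] using J(1) sndJ by (intro gram_mult_le) auto
    finally have "hnorm E.E y \<le> norm c * sqrt (Re (\<Sum>s\<in>J. \<Sum>t\<in>J. cnj (d s) * d t * ker s t))"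
      using real_le_rsqrt by (fastforce simp: real_sqrt_mult)
    then show ?thesis
      unfolding eq using E.E.Cauchy_Schwarz[OF y v] E.E.hnorm_nonneg[OF v]
        mult_right_mono[of "hnorm E.E y" _ "hnorm E.E v"] by (fastforce simp: mult_ac)
  qed
  have out: "alg_rep c v s = 0" if "s \<notin> S" for s using that by (cases s) (simp add: alg_rep_def)
  have C: "0 \<le> norm c * hnorm E.E v" using v by simp
  show "alg_rep c v \<in> hcarrier E.E" "hnorm E.E (alg_rep c v) \<le> norm c * hnorm E.E v"
    by (rule E.memI_of_bound[OF out C bound], assumption+)+
qed

lemma alg_rep_bounded: "alg_rep c \<in> bounded_ops E.E E.E"
proof (rule bounded_opsI[where C = "norm c"])
  show "alg_rep c (v + w) = alg_rep c v + alg_rep c w" for v w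
    by (auto simp: fun_eq_iff alg_rep_def)
  show "alg_rep c (z *\<^sub>C v) = z *\<^sub>C alg_rep c v" for z v
    by (auto simp: fun_eq_iff alg_rep_def scaleC_fun_apply)
qed (simp_all add: alg_rep_mem)

lemma alg_rep_vec:
  assumes "(a, g) \<in> S"
  shows "alg_rep c (vec a g) = vec (c * a) g"
proof
  show "alg_rep c (vec a g) s = vec (c * a) g s" for s
    using mult_mem_S
    by (cases s) (auto simp: alg_rep_def vec_eq ker_def star_mult star_star mult.assoc)
qed

lemma star_representation_alg_rep: "star_representation E.E alg_rep"
  unfolding star_representation_def linear_into_ops_def
proof (intro conjI allI ballI)
  show "alg_rep a \<in> bounded_ops E.E E.E" for a by (rule alg_rep_bounded)
next
  fix a b v assume v: "v \<in> hcarrier E.E"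
  have "v (star a * c + star b * c, g) = v (star a * c, g) + v (star b * c, g)" if "(c, g) \<in> S" for c g
    using E_add[OF v] mult_mem_S[OF that] by (metis distrib_right)
  then show "alg_rep (a + b) v = alg_rep a v + alg_rep b v"
    by (auto simp: fun_eq_iff alg_rep_def star_add distrib_right)
next
  fix z a v assume v: "v \<in> hcarrier E.E"
  show "alg_rep (z *\<^sub>C a) v = z *\<^sub>C alg_rep a v"
    using E_scaleC[OF v mult_mem_S]
    by (auto simp: fun_eq_iff alg_rep_def star_scaleC mult_scaleC_left scaleC_fun_apply)
next
  fix a b v assume v: "v \<in> hcarrier E.E"
  show "alg_rep (a * b) v = alg_rep a (alg_rep b v)"
    using mult_mem_S by (auto simp: fun_eq_iff alg_rep_def star_mult mult.assoc)
next
  fix a v assume v: "v \<in> hcarrier E.E"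
  let ?u = "hadj E.E E.E (alg_rep a) v"
  have u: "?u \<in> hcarrier E.E" by (rule EE.hadj_mem[OF alg_rep_bounded v])
  show "alg_rep (star a) v = ?u"
  proof (rule E_ext[OF alg_rep_mem(1)[OF v] u])
    fix b g assume s: "(b, g) \<in> S"
    have "?u (b, g) = hinner E.E (vec b g) ?u" by (rule inner_vec[OF s u, symmetric])
    also have "\<dots> = hinner E.E (alg_rep a (vec b g)) v"
      by (rule EE.hadj_inner_right[OF alg_rep_bounded v vec_mem[OF s]])
    also have "\<dots> = v (a * b, g)"
      unfolding alg_rep_vec[OF s] by (rule inner_vec[OF mult_mem_S[OF s] v])
    finally show "alg_rep (star a) v (b, g) = ?u (b, g)" using s by (simp add: alg_rep_def star_star)
  qed
qed

text \<open>At \<open>(a, g)\<close> the vector \<open>T x (rep y v)\<close> has the value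
  <\<Phi>(xa) g, rep y v>, and by \<open>T_Phi\<close> this is the value of \<open>v\<close> at <y,
  xa> = <x,y>* a.\<close>

lemma rep_adj_rep:
  assumes v: "v \<in> hcarrier E.E"
  shows "hadj E.E KP (rep x) (rep y v) = alg_rep (ip x y) v"
proof -
  have "T x (rep y v) = alg_rep (ip x y) v"
  proof (rule E_ext)
    show "T x (rep y v) \<in> hcarrier E.E" by (rule T_mem(1)[OF KP_sub[OF rep_mem[OF v]]])
    show "alg_rep (ip x y) v \<in> hcarrier E.E" by (rule alg_rep_mem(1)[OF v])
    fix a g assume s: "(a, g) \<in> S"
    then have g: "g \<in> hcarrier H" by (auto simp: S_def)
    have "T x (rep y v) (a, g) = hinner K (\<Phi> (act x a) g) (rep y v)" using s by (simp add: T_def)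
    also have "\<dots> = hinner E.E (vec (ip y (act x a)) g) v"
      using inner_rep[OF Phi_mem_KP[OF g] v] by (simp add: T_Phi[OF g])
    also have "\<dots> = v (ip y (act x a), g)" by (rule inner_vec[OF ip_mem_S[OF g] v])
    finally show "T x (rep y v) (a, g) = alg_rep (ip x y) v (a, g)"
      using s by (simp add: alg_rep_def X.star_ip X.ip_act_right)
  qed
  then show ?thesis by (simp add: rep_adj[OF rep_mem[OF v]])
qed

lemma module_representation_rep: "module_representation ip E.E KP rep"
  unfolding module_representation_def
  using rep_bounded star_representation_alg_rep rep_adj_rep by blast

text \<open>The kernel function of 1 \<otimes> h, written without a unit.\<close>

definition V :: "'h \<Rightarrow> 'a \<times> 'h \<Rightarrow> complex" where
  "V h = (\<lambda>(a, g). if (a, g) \<in> S then hinner H g (\<phi> (star a) h) else 0)"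

text \<open>In the absence of a unit, \<open>V h\<close> is approximated by the vectors \<open>e \<otimes> h\<close>, with e running
  through a bounded approximate unit.\<close>

lemma V_bound:
  "\<exists>C\<ge>0. \<forall>h\<in>hcarrier H. \<forall>J c. finite J \<longrightarrow> J \<subseteq> S \<longrightarrow> cmod (\<Sum>s\<in>J. cnj (c s) * V h s)
    \<le> C * hnorm H h * sqrt (Re (\<Sum>s\<in>J. \<Sum>t\<in>J. cnj (c s) * c t * ker s t))"
proof -
  obtain M where M0: "0 \<le> M" and M: "\<And>b h. h \<in> hcarrier H \<Longrightarrow>
      Re (hinner H h (\<phi> (star b * b) h)) \<le> M * (norm b)\<^sup>2 * (hnorm H h)\<^sup>2"
    using phi_star_mult_bounded by blast
  have sqM: "sqrt (Re (hinner H h (\<phi> (star b * b) h))) \<le> sqrt M * norm b * hnorm H h"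
    if "h \<in> hcarrier H" for b h
  proof -
    have "sqrt (Re (hinner H h (\<phi> (star b * b) h))) \<le> sqrt (M * (norm b)\<^sup>2 * (hnorm H h)\<^sup>2)"
      using M[OF that] by (rule real_sqrt_le_mono)
    then show ?thesis using that by (simp add: real_sqrt_mult)
  qed
  have main: "cmod (\<Sum>s\<in>J. cnj (c s) * V h s)
      \<le> sqrt M * 2 * hnorm H h * sqrt (Re (\<Sum>s\<in>J. \<Sum>t\<in>J. cnj (c s) * c t * ker s t))"
    if h: "h \<in> hcarrier H" and J: "finite J" "J \<subseteq> S" for h J c
  proof -
    let ?G = "sqrt (Re (\<Sum>s\<in>J. \<Sum>t\<in>J. cnj (c s) * c t * ker s t))"
    have JU: "J \<subseteq> UNIV \<times> hcarrier H" using J(2) S_subset by blast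
    have sndJ: "s \<in> J \<Longrightarrow> snd s \<in> hcarrier H" for s using JU by auto
    have "\<forall>s\<in>J. \<exists>x y. fst s = ip x y" using J(2) by (auto simp: S_def)
    then obtain x y where xy: "\<And>s. s \<in> J \<Longrightarrow> fst s = ip (x s) (y s)" by metis
    \<comment> \<open>At an inner product the value becomes a product of values of
      \<open>\<Phi>\<close>, in which x can be replaced by xe.\<close>
    have Vs: "V h s = hinner K (\<Phi> (y s) (snd s)) (\<Phi> (x s) h)" if "s \<in> J" for s
    proof -
      have "V h s = hinner H (snd s) (\<phi> (star (fst s)) h)"
        using that J(2) by (auto simp: V_def case_prod_beta)
      then show ?thesis using h sndJ[OF that] by (simp add: xy[OF that] inner_Phi X.star_ip)
    qed
    define N where "N = (\<Sum>s\<in>J. cmod (c s) * hnorm K (\<Phi> (y s) (snd s)))"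
    have N0: "0 \<le> N" unfolding N_def using sndJ by (intro sum_nonneg mult_nonneg_nonneg) auto
    have "\<exists>b. ip x x = star b * b \<and> norm b = norm x" for x
      by (rule ip_eq_star_mult[of x]) blast
    then obtain b where b: "\<And>x. ip x x = star (b x) * b x" "\<And>x. norm (b x) = norm x"
      by metis
    have Phi_norm: "hnorm K (\<Phi> z h) \<le> sqrt M * norm z * hnorm H h" for z
      using sqM[OF h, of "b z"] h by (simp add: hnorm_def inner_Phi b)
    have approx: "cmod (\<Sum>s\<in>J. cnj (c s) * V h s) \<le> sqrt M * 2 * hnorm H h * ?G + \<epsilon> * (N * sqrt M * hnorm H h)"
      if eps: "0 < \<epsilon>" for \<epsilon>
    proof -
      \<comment> \<open>\<open>e\<close> is chosen for the elements \<open>b (x s)\<close> with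
        <x,x> = b* b, because ||x - xe|| = ||b - be||.\<close>
      obtain e where e: "norm e \<le> 2"
        and be': "\<And>d. d \<in> (\<lambda>s. b (x s)) ` J \<Longrightarrow> norm (d - d * e) \<le> \<epsilon>"
        by (rule approximate_unit[OF finite_imageI[OF J(1)] eps]) blast
      have be: "norm (b (x s) - b (x s) * e) \<le> \<epsilon>" if "s \<in> J" for s
        using that by (intro be' imageI)
      have nx: "norm (x s - act (x s) e) \<le> \<epsilon>" if "s \<in> J" for s
      proof -
        have "ip (x s - act (x s) e) (x s - act (x s) e)
            = star (b (x s) - b (x s) * e) * (b (x s) - b (x s) * e)"
          by (simp add: ip_diff_left ip_diff_right ip_act_left X.ip_act_right b(1)[of "x s"]
              star_diff star_mult algebra_simps)
        then have "norm (x s - act (x s) e) = norm (b (x s) - b (x s) * e)"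
          by (simp add: X.norm_eq cstar_identity)
        then show ?thesis using be[OF that] by simp
      qed
      \<comment> \<open>Replacing \<Phi>(x) h by \<Phi>(xe) h produces the kernel value at
        \<open>(e, h)\<close>, and the rest is small. The main term is bounded by Cauchy-Schwarz for
        the kernel, with the 2 coming from the norm of \<open>e\<close>.\<close>
      have split: "cnj (c s) * V h s = cnj (c s) * ker s (e, h)
          + cnj (c s) * hinner K (\<Phi> (y s) (snd s)) (\<Phi> (x s - act (x s) e) h)" if "s \<in> J" for s
        using h sndJ[OF that]
        by (simp add: Vs[OF that] Phi_diff K.inner_diff_right ker_def inner_Phi xy[OF that]
            X.ip_act_right X.star_ip algebra_simps)
      have "cmod (\<Sum>s\<in>J. cnj (c s) * V h s)
          = cmod ((\<Sum>s\<in>J. cnj (c s) * ker s (e, h))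
            + (\<Sum>s\<in>J. cnj (c s) * hinner K (\<Phi> (y s) (snd s)) (\<Phi> (x s - act (x s) e) h)))"
        by (simp add: split flip: sum.distrib)
      also have "\<dots> \<le> cmod (\<Sum>s\<in>J. cnj (c s) * ker s (e, h))
          + cmod (\<Sum>s\<in>J. cnj (c s) * hinner K (\<Phi> (y s) (snd s)) (\<Phi> (x s - act (x s) e) h))"
        by (rule norm_triangle_ineq)
      also have "\<dots> \<le> ?G * (sqrt M * 2 * hnorm H h) + N * (sqrt M * \<epsilon> * hnorm H h)"
      proof (rule add_mono)
        have "sqrt (Re (ker (e, h) (e, h))) \<le> sqrt M * norm e * hnorm H h"
          using sqM[OF h] by (simp add: ker_def)
        also have "\<dots> \<le> sqrt M * 2 * hnorm H h"
          using e M0 h by (intro mult_right_mono mult_left_mono) auto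
        finally have eh: "sqrt (Re (ker (e, h) (e, h))) \<le> sqrt M * 2 * hnorm H h" .
        have "0 \<le> ?G" by (rule real_sqrt_ge_zero[OF A.kernel_nonneg[OF J(1) JU]])
        moreover have "cmod (\<Sum>s\<in>J. cnj (c s) * ker s (e, h)) \<le> ?G * sqrt (Re (ker (e, h) (e, h)))"
          by (rule A.kernel_Cauchy_Schwarz[OF J(1) JU]) (use h in simp)
        ultimately show "cmod (\<Sum>s\<in>J. cnj (c s) * ker s (e, h)) \<le> ?G * (sqrt M * 2 * hnorm H h)"
          using mult_left_mono[OF eh] order_trans by blast
        show "cmod (\<Sum>s\<in>J. cnj (c s) * hinner K (\<Phi> (y s) (snd s)) (\<Phi> (x s - act (x s) e) h))
            \<le> N * (sqrt M * \<epsilon> * hnorm H h)"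
          unfolding N_def sum_distrib_right
        proof (rule sum_norm_le)
          fix s assume s: "s \<in> J"
          have "cmod (hinner K (\<Phi> (y s) (snd s)) (\<Phi> (x s - act (x s) e) h))
              \<le> hnorm K (\<Phi> (y s) (snd s)) * hnorm K (\<Phi> (x s - act (x s) e) h)"
            using s sndJ h by (intro K.Cauchy_Schwarz) auto
          also have "\<dots> \<le> hnorm K (\<Phi> (y s) (snd s)) * (sqrt M * \<epsilon> * hnorm H h)"
          proof (rule mult_left_mono)
            show "hnorm K (\<Phi> (x s - act (x s) e) h) \<le> sqrt M * \<epsilon> * hnorm H h"
              by (rule order_trans[OF Phi_norm])
                 (use nx[OF s] M0 h in \<open>auto intro!: mult_right_mono mult_left_mono\<close>)
          qed (use s sndJ in auto)
          finally show "norm (cnj (c s) * hinner K (\<Phi> (y s) (snd s)) (\<Phi> (x s - act (x s) e) h))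
              \<le> cmod (c s) * hnorm K (\<Phi> (y s) (snd s)) * (sqrt M * \<epsilon> * hnorm H h)"
            by (simp add: norm_mult mult.assoc mult_left_mono)
        qed
      qed
      finally show ?thesis by (simp add: mult_ac)
    qed
    show ?thesis
    proof (rule field_le_epsilon)
      fix r :: real assume r: "0 < r"
      let ?D = "N * sqrt M * hnorm H h"
      have D: "0 \<le> ?D" using N0 M0 h by simp
      \<comment> \<open>The error is \<epsilon> times \<open>?D\<close>, so \<epsilon> = r / (?D +
        1) keeps it below r, also when \<open>?D\<close> is 0.\<close>
      have "r / (?D + 1) * ?D \<le> r" using r D by (simp add: field_simps)
      then show "cmod (\<Sum>s\<in>J. cnj (c s) * V h s) \<le> sqrt M * 2 * hnorm H h * ?G + r"
        using approx[of "r / (?D + 1)"] r D by simp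
    qed
  qed
  show ?thesis
    using main M0 by (intro exI[of _ "sqrt M * 2"]) auto
qed

lemma V_bounded: "V \<in> bounded_ops H E.E"
proof -
  from V_bound obtain C where V: "C \<ge> 0 \<and> (\<forall>h\<in>hcarrier H. \<forall>J c. finite J \<longrightarrow> J \<subseteq> S \<longrightarrow>
      cmod (\<Sum>s\<in>J. cnj (c s) * V h s)
        \<le> C * hnorm H h * sqrt (Re (\<Sum>s\<in>J. \<Sum>t\<in>J. cnj (c s) * c t * ker s t)))" ..
  note C0 = V[THEN conjunct1] and C = V[THEN conjunct2, rule_format]
  have out: "V h s = 0" if "s \<notin> S" for h s using that by (cases s) (simp add: V_def)
  have mem: "V h \<in> hcarrier E.E" "hnorm E.E (V h) \<le> C * hnorm H h" if h: "h \<in> hcarrier H" for h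
  proof -
    have "0 \<le> C * hnorm H h" using C0 h by simp
    note mem = E.memI_of_bound[of "V h", OF out this C[OF h]]
    show "V h \<in> hcarrier E.E" "hnorm E.E (V h) \<le> C * hnorm H h" by (rule mem, assumption+)+
  qed
  show ?thesis
  proof (rule bounded_opsI)
    show "V (h + h') = V h + V h'" if "h \<in> hcarrier H" "h' \<in> hcarrier H" for h h'
      using that by (auto simp: fun_eq_iff V_def S_def phi_add_vector inner_add_right)
    show "V (c *\<^sub>C h) = c *\<^sub>C V h" if "h \<in> hcarrier H" for c h
      using that by (auto simp: fun_eq_iff V_def S_def phi_scaleC_vector inner_scaleC_right
          scaleC_fun_apply)
  qed (rule mem, assumption)+
qed

lemma rep_V:
  assumes h: "h \<in> hcarrier H"
  shows "rep x (V h) = \<Phi> x h"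
proof (rule KP_ext)
  have V: "V h \<in> hcarrier E.E" by (rule bounded_opsD(1)[OF V_bounded h])
  then show "rep x (V h) \<in> hcarrier KP" by (rule rep_mem)
  show "\<Phi> x h \<in> hcarrier KP" by (rule Phi_mem_KP[OF h])
  fix y g assume g: "g \<in> hcarrier H"
  have "hinner K (\<Phi> y g) (rep x (V h)) = hinner E.E (vec (ip x y) g) (V h)"
    using inner_rep[OF Phi_mem_KP[OF g] V] by (simp add: T_Phi[OF g])
  also have "\<dots> = V h (ip x y, g)" by (rule inner_vec[OF ip_mem_S[OF g] V])
  finally show "hinner K (\<Phi> y g) (rep x (V h)) = hinner K (\<Phi> y g) (\<Phi> x h)"
    using g h ip_mem_S[OF g, of x y] by (simp add: V_def X.star_ip inner_Phi)
qed

text \<open>The orthogonal projection onto \<open>KP\<close>, taken as the adjoint of the inclusion.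
  Its own adjoint is then the inclusion, and since \<open>W\<close> fixes \<open>KP\<close> this
  gives W W* = 1.\<close>

definition W :: "'k \<Rightarrow> 'k" where "W = hadj KP K (\<lambda>k. k)"

lemma inclusion_bounded: "(\<lambda>k. k) \<in> bounded_ops KP K"
  unfolding bounded_ops_def hnorm_KP using KP_sub by (auto intro: exI[of _ 1])

lemma W_bounded: "W \<in> bounded_ops K KP"
  unfolding W_def by (rule KPK.hadj_bounded_ops[OF inclusion_bounded])

lemma W_adj: "k \<in> hcarrier KP \<Longrightarrow> hadj K KP W k = k"
  unfolding W_def by (rule KPK.hadj_hadj[OF inclusion_bounded])

lemma W_id: "k \<in> hcarrier KP \<Longrightarrow> W k = k"
  unfolding W_def by (rule KPK.hadj_unique) (simp_all add: hinner_KP)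

lemma stinespring_exists: "stinespring_construction ip H K \<Phi> E.E KP rep V W"
  unfolding stinespring_construction_def
proof (intro conjI allI ballI)
  show "hilbert_space E.E" "hilbert_space KP" by unfold_locales
  show "module_representation ip E.E KP rep" by (rule module_representation_rep)
  show "V \<in> bounded_ops H E.E" by (rule V_bounded)
  show "coisometry K KP W"
    unfolding coisometry_def using W_bounded W_adj W_id by simp
  show "\<Phi> x h = hadj K KP W (rep x (V h))" if "h \<in> hcarrier H" for x h
    using that by (simp add: rep_V W_adj Phi_mem_KP)
  have "{rep x (V h) | x h. h \<in> hcarrier H} = {\<Phi> x h | x h. h \<in> hcarrier H}"
    using rep_V by metis
  then show "hclosed_span KP {rep x (V h) | x h. h \<in> hcarrier H} = hcarrier KP"
    using span_KP by simp
  have Wm: "W k \<in> hcarrier KP" if "k \<in> hcarrier K" for k by (rule bounded_opsD(1)[OF W_bounded that])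
  show "hclosed_span E.E {hadj E.E KP (rep x) (W k) | x k. k \<in> hcarrier K} = hcarrier E.E"
  proof (rule E.E.hclosed_span_eq_carrierI)
    show "{hadj E.E KP (rep x) (W k) | x k. k \<in> hcarrier K} \<subseteq> hcarrier E.E"
      using EKP.hadj_mem[OF rep_bounded Wm] by auto
    fix v assume v: "v \<in> hcarrier E.E"
      and 0: "\<And>y. y \<in> {hadj E.E KP (rep x) (W k) | x k. k \<in> hcarrier K} \<Longrightarrow> hinner E.E y v = 0"
    show "v = 0"
    proof (rule E_ext[OF v])
      fix a g assume s: "(a, g) \<in> S"
      then obtain x y where a: "a = ip x y" and g: "g \<in> hcarrier H" by (auto simp: S_def)
      \<comment> \<open>Every kernel vector belongs to the family in (c), so a vector orthogonal to
        that family vanishes at every point of \<open>S\<close>.\<close>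
      have "vec a g = hadj E.E KP (rep x) (W (\<Phi> y g))"
        by (simp add: a W_id rep_adj Phi_mem_KP g T_Phi)
      then have "hinner E.E (vec a g) v = 0" using Phi_mem[OF g] by (intro 0) blast
      then show "v (a, g) = 0 (a, g)" using inner_vec[OF s v] by simp
    qed simp
  qed
qed

end

theorem theorem2p2:
  fixes act :: "'x::{complex_normed_vector, banach} \<Rightarrow> 'a::cstar_algebra \<Rightarrow> 'x"
    and ip :: "'x \<Rightarrow> 'x \<Rightarrow> 'a"
    and H :: "'h::complex_vector hilbert"
    and K :: "'k::complex_vector hilbert"
    and \<Phi> :: "'x \<Rightarrow> 'h \<Rightarrow> 'k"
  assumes "hilbert_module act ip"
    and "full_module ip"
    and "hilbert_space H"
    and "hilbert_space K"
    and "module_completely_positive ip H K \<Phi>"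
  shows "(\<exists>(H\<^sub>\<Phi> :: ('a \<times> 'h \<Rightarrow> complex) hilbert) (K\<^sub>\<Phi> :: 'k hilbert) \<pi>\<^sub>\<Phi> V\<^sub>\<Phi> W\<^sub>\<Phi>.
            stinespring_construction ip H K \<Phi> H\<^sub>\<Phi> K\<^sub>\<Phi> \<pi>\<^sub>\<Phi> V\<^sub>\<Phi> W\<^sub>\<Phi>) \<and>
         (\<forall>(H\<^sub>\<Phi> :: 'p::complex_vector hilbert) (K\<^sub>\<Phi> :: 'q::complex_vector hilbert) \<pi>\<^sub>\<Phi> V\<^sub>\<Phi> W\<^sub>\<Phi>
            (H' :: 'r::complex_vector hilbert) (K' :: 's::complex_vector hilbert) \<pi>\<^sub>X V' W'.
            stinespring_construction ip H K \<Phi> H\<^sub>\<Phi> K\<^sub>\<Phi> \<pi>\<^sub>\<Phi> V\<^sub>\<Phi> W\<^sub>\<Phi> \<and>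
            stinespring_construction ip H K \<Phi> H' K' \<pi>\<^sub>X V' W' \<longrightarrow>
            (\<exists>U\<^sub>1 U\<^sub>2. unitary_op H\<^sub>\<Phi> H' U\<^sub>1 \<and> unitary_op K\<^sub>\<Phi> K' U\<^sub>2 \<and>
              (\<forall>x. \<forall>h\<in>hcarrier H\<^sub>\<Phi>. U\<^sub>2 (\<pi>\<^sub>\<Phi> x h) = \<pi>\<^sub>X x (U\<^sub>1 h)) \<and>
              (\<forall>h\<in>hcarrier H. V' h = U\<^sub>1 (V\<^sub>\<Phi> h)) \<and>
              (\<forall>k\<in>hcarrier K. W' k = U\<^sub>2 (W\<^sub>\<Phi> k))))"
proof (intro conjI allI impI)
  obtain \<phi> where "completely_positive H \<phi>"
    "\<And>x y h. h \<in> hcarrier H \<Longrightarrow> hadj H K (\<Phi> x) (\<Phi> y h) = \<phi> (ip x y) h"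
    "\<And>x. \<Phi> x \<in> bounded_ops H K"
    using assms(5) by (auto simp: module_completely_positive_def)
  then interpret cp_module H K act ip \<phi> \<Phi>
    using assms by (intro cp_module.intro cp_map.intro cp_map_axioms.intro
        cp_module_axioms.intro)
  show "\<exists>(H\<^sub>\<Phi> :: ('a \<times> 'h \<Rightarrow> complex) hilbert) (K\<^sub>\<Phi> :: 'k hilbert) \<pi>\<^sub>\<Phi> V\<^sub>\<Phi> W\<^sub>\<Phi>.
      stinespring_construction ip H K \<Phi> H\<^sub>\<Phi> K\<^sub>\<Phi> \<pi>\<^sub>\<Phi> V\<^sub>\<Phi> W\<^sub>\<Phi>"
    using stinespring_exists by blast
qed (elim conjE, rule stinespring_unique[OF assms(1,3,4)])

end
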